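(* Let $\mathbb{F}$ be an algebraically closed field, $G$ an abelian group, $n=n_1+\dots+n_s$ with all $n_i\ge1$, and let $U(\mathscr{F})=UT(n_1,\ldots,n_s)\subset M_n(\mathbb{F})$ be the associative algebra of upper block-triangular matrices. Two $G$-gradings on $U(\mathscr{F})$, determined by $(T,\beta,(\kappa_1,\ldots,\kappa_s))$ and $(T',\beta',(\kappa_1',\ldots,\kappa_s'))$, are isomorphic if and only if $T'=T$, $\beta'=\beta$ and there exists $g\in G$ such that $\kappa_i'=g\kappa_i$ for all $i=1,2,\ldots,s$.
   Context: A $G$-grading on an algebra $A$ is a vector space decomposition $A=\bigoplus_{g\in G}A_g$ with $A_gA_h\subset A_{gh}$. Two $G$-gradings on $A$ are isomorphic if some algebra automorphism of $A$ maps each component of the first onto the component of the same degree of the second. $UT(n_1,\ldots,n_s)$ is the algebra of upper block-triangular matrices with diagonal blocks of sizes $n_1,\ldots,n_s$. Parameters: $T\subset G$ is a finite subgroup, $\beta:T\times T\to\mathbb{F}^\times$ is a non-degenerate alternating bicharacter (multiplicative in each variable, $\beta(u,u)=1$), and $\kappa_i:G/T\to\mathbb{Z}_{\ge0}$ ($1\le i\le s$) are functions with finite support such that $|\kappa_i|\sqrt{|T|}=n_i$, where $|\kappa|:=\sum_{x}\kappa(x)$. For $g\in G$, $(g\kappa)(x):=\kappa(g^{-1}x)$. The grading (defined up to isomorphism) determined by $(T,\beta,(\kappa_1,\ldots,\kappa_s))$: let $\ell=\sqrt{|T|}$, $k_i=|\kappa_i|$, $k=k_1+\dots+k_s$. For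 each $i$ choose a $k_i$-tuple $\gamma_i$ of elements of $G$ such that each coset $x\in G/T$ contains exactly $\kappa_i(x)$ entries of $\gamma_i$, and let $(g_1,\ldots,g_k)$ be the concatenation of $\gamma_1,\ldots,\gamma_s$. Choose a division grading on $M_\ell(\mathbb{F})$ (every nonzero homogeneous element invertible) with support $T$ and bicharacter $\beta$, i.e. $M_\ell(\mathbb{F})$ has one-dimensional components $\mathbb{F}X_t$, $t\in T$, with $X_uX_v=\beta(u,v)X_vX_u$. Identify $M_n=M_k\otimes M_\ell$ via Kronecker product, and declare $E_{ij}\otimes d$ ($d$ nonzero homogeneous in $M_\ell$) to be homogeneous of degree $g_i\deg(d)g_j^{-1}$. The $G$-grading on $U(\mathscr{F})$ is the restriction of this grading. *)

theory Defs
  imports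
    "Jordan_Normal_Form.Matrix"
    "HOL-Algebra.Coset"
    "HOL-Computational_Algebra.Polynomial"
    "HOL-Library.Discrete_Functions"
    Complex_Main
begin

definition mat_subspace :: "nat \<Rightarrow> 'f::field mat set \<Rightarrow> bool" where
  "mat_subspace n V \<longleftrightarrow>
     V \<subseteq> carrier_mat n n \<and> 0\<^sub>m n n \<in> V \<and>
     (\<forall>x\<in>V. \<forall>y\<in>V. x + y \<in> V) \<and> (\<forall>c. \<forall>x\<in>V. c \<cdot>\<^sub>m x \<in> V)"

text \<open>
  The middle clause is the direct sum decomposition: every element of \<open>A\<close> is in a unique
  way a finite sum of homogeneous elements. The values of \<open>\<Gamma>\<close> outside the carrier of \<open>G\<close>
  are irrelevant.
\<close>

definition is_grading ::
    "('g, 'b) monoid_scheme \<Rightarrow> nat \<Rightarrow> 'f::field mat set \<Rightarrow> ('g \<Rightarrow> 'f mat set) \<Rightarrow> bool" where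
  "is_grading G n A \<Gamma> \<longleftrightarrow>
     (\<forall>g\<in>carrier G. mat_subspace n (\<Gamma> g) \<and> \<Gamma> g \<subseteq> A) \<and>
     (\<forall>a\<in>A. \<exists>!f. (\<forall>g\<in>carrier G. f g \<in> \<Gamma> g) \<and> (\<forall>g. g \<notin> carrier G \<longrightarrow> f g = 0\<^sub>m n n) \<and>
        finite {g. f g \<noteq> 0\<^sub>m n n} \<and>
        a = finsum (ring_mat TYPE('f) n ()) f {g. f g \<noteq> 0\<^sub>m n n}) \<and>
     (\<forall>g\<in>carrier G. \<forall>h\<in>carrier G. \<forall>x\<in>\<Gamma> g. \<forall>y\<in>\<Gamma> h. x * y \<in> \<Gamma> (g \<otimes>\<^bsub>G\<^esub> h))"

definition algebra_automorphism :: "'f::field mat set \<Rightarrow> ('f mat \<Rightarrow> 'f mat) \<Rightarrow> bool" where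
  "algebra_automorphism A \<phi> \<longleftrightarrow>
     bij_betw \<phi> A A \<and>
     (\<forall>x\<in>A. \<forall>y\<in>A. \<phi> (x + y) = \<phi> x + \<phi> y) \<and>
     (\<forall>c. \<forall>x\<in>A. \<phi> (c \<cdot>\<^sub>m x) = c \<cdot>\<^sub>m \<phi> x) \<and>
     (\<forall>x\<in>A. \<forall>y\<in>A. \<phi> (x * y) = \<phi> x * \<phi> y)"

definition isomorphic_gradings ::
    "('g, 'b) monoid_scheme \<Rightarrow> 'f::field mat set \<Rightarrow> ('g \<Rightarrow> 'f mat set) \<Rightarrow> ('g \<Rightarrow> 'f mat set) \<Rightarrow> bool"
  where
  "isomorphic_gradings G A \<Gamma> \<Gamma>' \<longleftrightarrow>
     (\<exists>\<phi>. algebra_automorphism A \<phi> \<and> (\<forall>g\<in>carrier G. \<phi> ` \<Gamma> g = \<Gamma>' g))"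

text \<open>Rows, columns and blocks are numbered from \<open>0\<close>.\<close>

definition block_index :: "nat list \<Rightarrow> nat \<Rightarrow> nat" where
  "block_index ns i = (LEAST r. i < sum_list (take (Suc r) ns))"

definition UT :: "nat list \<Rightarrow> 'f::field mat set" where
  "UT ns = {A \<in> carrier_mat (sum_list ns) (sum_list ns).
     \<forall>i < sum_list ns. \<forall>j < sum_list ns.
       block_index ns j < block_index ns i \<longrightarrow> A $$ (i, j) = 0}"

text \<open>
  An alternating bicharacter is skew-symmetric, so its left and right radicals coincide and
  non-degeneracy need only be required on one side.
\<close>

definition nondeg_alternating_bichar ::
    "('g, 'b) monoid_scheme \<Rightarrow> 'g set \<Rightarrow> ('g \<Rightarrow> 'g \<Rightarrow> 'f::field) \<Rightarrow> bool" where
  "nondeg_alternating_bichar G T \<beta> \<longleftrightarrow>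
     (\<forall>u\<in>T. \<forall>v\<in>T. \<beta> u v \<noteq> 0) \<and>
     (\<forall>u\<in>T. \<forall>v\<in>T. \<forall>w\<in>T. \<beta> (u \<otimes>\<^bsub>G\<^esub> v) w = \<beta> u w * \<beta> v w) \<and>
     (\<forall>u\<in>T. \<forall>v\<in>T. \<forall>w\<in>T. \<beta> u (v \<otimes>\<^bsub>G\<^esub> w) = \<beta> u v * \<beta> u w) \<and>
     (\<forall>u\<in>T. \<beta> u u = 1) \<and>
     (\<forall>u\<in>T. (\<forall>v\<in>T. \<beta> u v = 1) \<longrightarrow> u = \<one>\<^bsub>G\<^esub>)"

definition coset_support :: "('g, 'b) monoid_scheme \<Rightarrow> 'g set \<Rightarrow> ('g set \<Rightarrow> nat) \<Rightarrow> 'g set set" where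
  "coset_support G T \<kappa> = {x \<in> rcosets\<^bsub>G\<^esub> T. \<kappa> x \<noteq> 0}"

definition kappa_size :: "('g, 'b) monoid_scheme \<Rightarrow> 'g set \<Rightarrow> ('g set \<Rightarrow> nat) \<Rightarrow> nat" where
  "kappa_size G T \<kappa> = (\<Sum>x\<in>coset_support G T \<kappa>. \<kappa> x)"

definition shift_kappa :: "('g, 'b) monoid_scheme \<Rightarrow> 'g \<Rightarrow> ('g set \<Rightarrow> nat) \<Rightarrow> 'g set \<Rightarrow> nat" where
  "shift_kappa G g \<kappa> x = \<kappa> (inv\<^bsub>G\<^esub> g <#\<^bsub>G\<^esub> x)"

definition grading_parameters ::
    "('g, 'b) monoid_scheme \<Rightarrow> nat list \<Rightarrow> 'g set \<Rightarrow> ('g \<Rightarrow> 'g \<Rightarrow> 'f::field) \<Rightarrow>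
     ('g set \<Rightarrow> nat) list \<Rightarrow> bool" where
  "grading_parameters G ns T \<beta> \<kappa>s \<longleftrightarrow>
     subgroup T G \<and> finite T \<and> nondeg_alternating_bichar G T \<beta> \<and>
     length \<kappa>s = length ns \<and>
     (\<forall>i < length ns. finite (coset_support G T (\<kappa>s ! i)) \<and>
        real (kappa_size G T (\<kappa>s ! i)) * sqrt (real (card T)) = real (ns ! i))"

definition division_grading ::
    "('g, 'b) monoid_scheme \<Rightarrow> nat \<Rightarrow> 'g set \<Rightarrow> ('g \<Rightarrow> 'g \<Rightarrow> 'f::field) \<Rightarrow> ('g \<Rightarrow> 'f mat set) \<Rightarrow> bool"
  where
  "division_grading G l T \<beta> D \<longleftrightarrow>
     is_grading G l (carrier_mat l l) D \<and>
     (\<forall>g\<in>carrier G. \<forall>d\<in>D g. d \<noteq> 0\<^sub>m l l \<longrightarrow> invertible_mat d) \<and>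
     {g \<in> carrier G. D g \<noteq> {0\<^sub>m l l}} = T \<and>
     (\<exists>X. (\<forall>t\<in>T. X t \<noteq> 0\<^sub>m l l \<and> D t = {c \<cdot>\<^sub>m X t | c. True}) \<and>
          (\<forall>u\<in>T. \<forall>v\<in>T. X u * X v = \<beta> u v \<cdot>\<^sub>m (X v * X u)))"

definition kronecker :: "'f::field mat \<Rightarrow> 'f mat \<Rightarrow> 'f mat" where
  "kronecker A B = mat (dim_row A * dim_row B) (dim_col A * dim_col B)
     (\<lambda>(i, j). A $$ (i div dim_row B, j div dim_col B) * B $$ (i mod dim_row B, j mod dim_col B))"

definition matrix_unit :: "nat \<Rightarrow> nat \<Rightarrow> nat \<Rightarrow> 'f::field mat" where
  "matrix_unit k i j = mat k k (\<lambda>(a, b). if a = i \<and> b = j then 1 else 0)"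

text \<open>
  \<^const>\<open>kronecker\<close> lists the entries of the second factor innermost, so the index sets of the
  diagonal blocks of \<^const>\<open>UT\<close> correspond to the consecutive segments of the tuple \<open>gs\<close>.
  \<open>hull\<close> is the linear span.
\<close>

definition full_matrix_grading ::
    "('g, 'b) monoid_scheme \<Rightarrow> 'g list \<Rightarrow> nat \<Rightarrow> ('g \<Rightarrow> 'f::field mat set) \<Rightarrow> 'g \<Rightarrow> 'f mat set" where
  "full_matrix_grading G gs l D g =
     mat_subspace (length gs * l) hull
       {kronecker (matrix_unit (length gs) i j) d | i j d.
          i < length gs \<and> j < length gs \<and>
          (\<exists>t\<in>carrier G. d \<in> D t \<and> d \<noteq> 0\<^sub>m l l \<and> g = gs ! i \<otimes>\<^bsub>G\<^esub> t \<otimes>\<^bsub>G\<^esub> inv\<^bsub>G\<^esub> (gs ! j))}"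

text \<open>
  \<open>\<Gamma>\<close> is a grading obtained from \<open>(T, \<beta>, \<kappa>s)\<close> by some admissible choice of the tuples
  \<open>\<gamma>\<^sub>i\<close> (the entries of \<open>\<gamma>s\<close>) and of the division grading \<open>D\<close>. Non-degeneracy of \<open>\<beta>\<close>,
  or already the size condition on \<open>\<kappa>s\<close>, makes \<open>card T\<close> a perfect square,
  so \<open>l\<close> is the exact square root.
\<close>

definition determines_grading ::
    "('g, 'b) monoid_scheme \<Rightarrow> nat list \<Rightarrow> 'g set \<Rightarrow> ('g \<Rightarrow> 'g \<Rightarrow> 'f::field) \<Rightarrow>
     ('g set \<Rightarrow> nat) list \<Rightarrow> ('g \<Rightarrow> 'f mat set) \<Rightarrow> bool" where
  "determines_grading G ns T \<beta> \<kappa>s \<Gamma> \<longleftrightarrow>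
     (let l = floor_sqrt (card T) in
      \<exists>\<gamma>s D. length \<gamma>s = length \<kappa>s \<and>
        (\<forall>i < length \<kappa>s.
           set (\<gamma>s ! i) \<subseteq> carrier G \<and> length (\<gamma>s ! i) = kappa_size G T (\<kappa>s ! i) \<and>
           (\<forall>x \<in> rcosets\<^bsub>G\<^esub> T. length (filter (\<lambda>g. g \<in> x) (\<gamma>s ! i)) = (\<kappa>s ! i) x)) \<and>
        division_grading G l T \<beta> D \<and>
        (\<forall>g\<in>carrier G. \<Gamma> g = full_matrix_grading G (concat \<gamma>s) l D g \<inter> UT ns))"

end

theory Submission
  imports Defs "HOL-Combinatorics.Permutations" "Jordan_Normal_Form.Determinant"
begin

text \<open>
  Write \<open>A\<close> for the block-triangular algebra. In terms of the \<open>l \<times> l\<close> blocks, where \<open>l\<^sup>2 = |T|\<close>,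
  a matrix is homogeneous of degree \<open>g\<close> if and only if its block \<open>(i, j)\<close> has degree
  \<open>g\<^sub>i\<^sup>-\<^sup>1 g g\<^sub>j\<close> in the division grading (\<open>full_matrix_grading_iff\<close>), and homogeneity is always
  tested in this form.

  Suppose that \<open>\<phi>\<close> is an isomorphism of the gradings. The second grading contains, for every
  \<open>t\<close> in \<open>T'\<close>, an invertible element of degree \<open>t\<close> that commutes with the component of degree
  \<open>\<one>\<close> (\<open>centralizing_elements\<close>). Its preimage commutes with the block idempotents, so it is block
  diagonal, and its blocks lie in the component of degree \<open>t\<close> of the first division grading.
  This gives \<open>T' \<subseteq> T\<close> and compares the bicharacters; the inverse of \<open>\<phi>\<close> gives the other
  inclusion (\<open>support_and_bicharacter_determined\<close>).

  For the multiplicities, \<open>\<phi>\<close> is conjugation by a block-triangular matrix \<open>P\<close>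
  (\<open>UT_automorphism_conjugation\<close>, \<open>UT_automorphism_conjugator_UT\<close>). Modulo \<open>T\<close> both gradings
  are elementary gradings by \<open>G/T\<close>, coming from \<open>G/T\<close>-gradings of the column space, so \<open>P\<close> can
  be replaced by one of its \<open>G/T\<close>-homogeneous parts \<open>Q\<close>, of degree \<open>hT\<close> say. Being invertible,
  \<open>Q\<close> has a nonzero product in the Leibniz formula for its determinant. The permutation
  belonging to this product matches the basis vectors of each block and coset \<open>x\<close> with those of
  the same block and of coset \<open>hx\<close>. Hence \<open>\<kappa>'\<^sub>i = h\<kappa>\<^sub>i\<close> (\<open>graded_iso_permutation\<close>).

  Conversely, let the parameters agree up to a shift. Two division gradings \<open>D\<close>, \<open>D'\<close> with the
  same support and bicharacter are conjugate: with \<open>X\<^sub>t\<close> and \<open>X'\<^sub>t\<close> spanning their components,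
  the operators \<open>m \<mapsto> X\<^sub>t m X'\<^sub>t\<^sup>-\<^sup>1\<close> commute, so they have a common eigenvector over the
  algebraically closed field, and this eigenvector is invertible and conjugates one grading into
  the other (\<open>division_gradings_conjugate\<close>). A block monomial matrix built from it, from a
  bijection between the two tuples that respects the blocks and, up to the shift, the cosets, and
  from homogeneous elements that correct the degrees within the cosets, then conjugates the
  first grading of \<open>A\<close> into the second (\<open>isomorphic_of_matching_cosets\<close>).
\<close>

section \<open>Matrices cut into square blocks\<close>

definition block :: "nat \<Rightarrow> 'a mat \<Rightarrow> nat \<Rightarrow> nat \<Rightarrow> 'a mat" where
  "block l a i j = mat l l (\<lambda>(p, q). a $$ (i * l + p, j * l + q))"

definition from_blocks :: "nat \<Rightarrow> nat \<Rightarrow> (nat \<Rightarrow> nat \<Rightarrow> 'a mat) \<Rightarrow> 'a mat" where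
  "from_blocks k l f =
     mat (k * l) (k * l) (\<lambda>(r, s). f (r div l) (s div l) $$ (r mod l, s mod l))"

lemma block_offset_less: "i < k \<Longrightarrow> p < l \<Longrightarrow> i * l + p < k * (l::nat)"
proof -
  assume "i < k" "p < l"
  then have "i * l + p < Suc i * l" by simp
  also have "\<dots> \<le> k * l" using \<open>i < k\<close> by (intro mult_le_mono1) simp
  finally show ?thesis .
qed

lemma block_carrier [simp]: "block l a i j \<in> carrier_mat l l"
  by (simp add: block_def)

lemma from_blocks_carrier [simp]: "from_blocks k l f \<in> carrier_mat (k * l) (k * l)"
  by (simp add: from_blocks_def)

lemma block_from_blocks:
  assumes "i < k" "j < k" "f i j \<in> carrier_mat l l"
  shows "block l (from_blocks k l f) i j = f i j"
  using assms by (intro eq_matI) (auto simp: block_def from_blocks_def block_offset_less)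

lemma eq_blocksI:
  assumes a: "a \<in> carrier_mat (k * l) (k * l)" and b: "b \<in> carrier_mat (k * l) (k * l)"
    and eq: "\<And>i j. i < k \<Longrightarrow> j < k \<Longrightarrow> block l a i j = block l b i j"
  shows "a = b"
proof (rule eq_matI)
  fix r s assume "r < dim_row b" "s < dim_col b"
  then have rs: "r < k * l" "s < k * l" using b by auto
  then have l: "l > 0" by (cases l) auto
  have d: "r div l < k" "s div l < k" using rs l by (auto simp: div_less_iff_less_mult)
  have m: "r mod l < l" "s mod l < l" using l by auto
  from eq[OF d] have "block l a (r div l) (s div l) $$ (r mod l, s mod l) =
      block l b (r div l) (s div l) $$ (r mod l, s mod l)" by simp
  then show "a $$ (r, s) = b $$ (r, s)" using m by (simp add: block_def)
qed (use a b in auto)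

lemma block_add:
  assumes "a \<in> carrier_mat (k * l) (k * l)" "b \<in> carrier_mat (k * l) (k * l)" "i < k" "j < k"
  shows "block l (a + b) i j = block l a i j + block l b i j"
  using assms by (intro eq_matI) (auto simp: block_def block_offset_less)

lemma block_smult:
  assumes "a \<in> carrier_mat (k * l) (k * l)" "i < k" "j < k"
  shows "block l (c \<cdot>\<^sub>m a) i j = c \<cdot>\<^sub>m block l a i j"
  using assms by (intro eq_matI) (auto simp: block_def block_offset_less)

lemma block_zero:
  assumes "i < k" "j < k"
  shows "block l (0\<^sub>m (k * l) (k * l)) i j = 0\<^sub>m l l"
  using assms by (intro eq_matI) (auto simp: block_def block_offset_less)

lemma block_one:
  assumes "i < k" "j < k"
  shows "block l (1\<^sub>m (k * l)) i j = (if i = j then 1\<^sub>m l else 0\<^sub>m l l)"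
proof (intro eq_matI)
  fix p q assume "p < dim_row (if i = j then 1\<^sub>m l else 0\<^sub>m l l)"
    "q < dim_col (if i = j then 1\<^sub>m l else 0\<^sub>m l l)"
  then have pq: "p < l" "q < l" by (auto split: if_splits)
  have "i * l + p = j * l + q \<longleftrightarrow> i = j \<and> p = q"
  proof
    assume eq: "i * l + p = j * l + q"
    have "(i * l + p) div l = i" "(j * l + q) div l = j" using pq by auto
    with eq show "i = j \<and> p = q" by auto
  qed auto
  then show "block l (1\<^sub>m (k * l)) i j $$ (p, q) =
      (if i = j then 1\<^sub>m l else 0\<^sub>m l l) $$ (p, q)"
    using pq assms by (auto simp: block_def block_offset_less)
qed (auto simp: block_def)

lemma index_mult_mat_sum:
  assumes "a \<in> carrier_mat n m" "b \<in> carrier_mat m p" "i < n" "j < p"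
  shows "(a * b) $$ (i, j) = (\<Sum>s<m. a $$ (i, s) * b $$ (s, j))"
  using assms by (auto simp: scalar_prod_def atLeast0LessThan intro!: sum.cong)

lemma sum_lessThan_blocks:
  "(\<Sum>r<k * l. f r) = (\<Sum>m<k. \<Sum>p<l. f (m * l + p :: nat))"
proof -
  have "(\<Sum>r<k * l. f r) = (\<Sum>m<k. sum f {m * l..<m * l + l})"
    by (rule sum.nat_group[symmetric])
  also have "\<dots> = (\<Sum>m<k. \<Sum>p<l. f (m * l + p))"
    by (rule sum.cong[OF refl])
       (simp add: sum.atLeastLessThan_shift_0[of f "_ * l"] atLeast0LessThan)
  finally show ?thesis .
qed

lemma block_mult_index:
  fixes a b :: "'a::semiring_0 mat"
  assumes "a \<in> carrier_mat (k * l) (k * l)" "b \<in> carrier_mat (k * l) (k * l)"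
    "i < k" "j < k" "p < l" "q < l"
  shows "block l (a * b) i j $$ (p, q) =
    (\<Sum>m<k. (block l a i m * block l b m j) $$ (p, q))"
proof -
  have "block l (a * b) i j $$ (p, q) = (a * b) $$ (i * l + p, j * l + q)"
    using assms by (simp add: block_def)
  also have "\<dots> = (\<Sum>r<k * l. a $$ (i * l + p, r) * b $$ (r, j * l + q))"
    using assms by (intro index_mult_mat_sum) (auto simp: block_offset_less)
  also have "\<dots> = (\<Sum>m<k. \<Sum>s<l. a $$ (i * l + p, m * l + s) * b $$ (m * l + s, j * l + q))"
    by (rule sum_lessThan_blocks)
  also have "\<dots> = (\<Sum>m<k. (block l a i m * block l b m j) $$ (p, q))"
    using assms
    by (intro sum.cong[OF refl])
       (subst index_mult_mat_sum[of _ l l _ l], auto simp: block_def)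
  finally show ?thesis .
qed

lemma block_mult_only:
  fixes a b :: "'a::semiring_0 mat"
  assumes a: "a \<in> carrier_mat (k * l) (k * l)" and b: "b \<in> carrier_mat (k * l) (k * l)"
    and ij: "i < k" "j < k" and m: "m < k"
    and only: "\<And>t. t < k \<Longrightarrow> t \<noteq> m \<Longrightarrow> block l a i t = 0\<^sub>m l l \<or> block l b t j = 0\<^sub>m l l"
  shows "block l (a * b) i j = block l a i m * block l b m j"
proof (rule eq_matI)
  fix p q assume "p < dim_row (block l a i m * block l b m j)"
    "q < dim_col (block l a i m * block l b m j)"
  then have pq: "p < l" "q < l" by (auto simp: block_def)
  have z: "(block l a i t * block l b t j) $$ (p, q) = 0" if "t < k" "t \<noteq> m" for t
  proof -
    have "block l a i t * block l b t j = 0\<^sub>m l l"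
      using only[OF that] by (metis block_carrier left_mult_zero_mat right_mult_zero_mat)
    then show ?thesis using pq by simp
  qed
  have "block l (a * b) i j $$ (p, q) = (\<Sum>t<k. (block l a i t * block l b t j) $$ (p, q))"
    by (rule block_mult_index[OF a b ij pq])
  also have "\<dots> = (\<Sum>t<k. if t = m then (block l a i m * block l b m j) $$ (p, q) else 0)"
    by (rule sum.cong) (auto simp: z)
  also have "\<dots> = (block l a i m * block l b m j) $$ (p, q)"
    using m by simp
  finally show "block l (a * b) i j $$ (p, q) = (block l a i m * block l b m j) $$ (p, q)" .
qed (auto simp: block_def)

lemma block_mult_zero:
  fixes a b :: "'a::semiring_0 mat"
  assumes a: "a \<in> carrier_mat (k * l) (k * l)" and b: "b \<in> carrier_mat (k * l) (k * l)"
    and ij: "i < k" "j < k"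
    and z: "\<And>t. t < k \<Longrightarrow> block l a i t = 0\<^sub>m l l \<or> block l b t j = 0\<^sub>m l l"
  shows "block l (a * b) i j = 0\<^sub>m l l"
proof -
  have "block l (a * b) i j = block l a i i * block l b i j"
    using z ij by (intro block_mult_only[OF a b]) auto
  also have "\<dots> = 0\<^sub>m l l"
    using z[OF ij(1)] by (metis block_carrier left_mult_zero_mat right_mult_zero_mat)
  finally show ?thesis .
qed

definition single_block :: "nat \<Rightarrow> nat \<Rightarrow> nat \<Rightarrow> nat \<Rightarrow> 'a::zero mat \<Rightarrow> 'a mat" where
  "single_block k l i j d = from_blocks k l (\<lambda>i' j'. if i' = i \<and> j' = j then d else 0\<^sub>m l l)"

lemma single_block_carrier [simp]: "single_block k l i j d \<in> carrier_mat (k * l) (k * l)"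
  by (simp add: single_block_def)

lemma block_single_block:
  assumes "i' < k" "j' < k" "d \<in> carrier_mat l l"
  shows "block l (single_block k l i j d) i' j' = (if i' = i \<and> j' = j then d else 0\<^sub>m l l)"
  unfolding single_block_def using assms by (subst block_from_blocks) auto

lemma kronecker_matrix_unit:
  fixes d :: "'f::field mat"
  assumes "d \<in> carrier_mat l l"
  shows "kronecker (matrix_unit k i j) d = single_block k l i j d"
proof (rule eq_matI)
  fix r s assume "r < dim_row (single_block k l i j d)" "s < dim_col (single_block k l i j d)"
  then have rs: "r < k * l" "s < k * l" by (auto simp: single_block_def from_blocks_def)
  then have l: "l > 0" by (cases l) auto
  show "kronecker (matrix_unit k i j) d $$ (r, s) = single_block k l i j d $$ (r, s)"
    using rs l assms
    by (auto simp: kronecker_def matrix_unit_def single_block_def from_blocks_def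
        div_less_iff_less_mult)
qed (use assms in \<open>auto simp: kronecker_def matrix_unit_def single_block_def from_blocks_def\<close>)

lemma matrix_unit_as_single_block:
  assumes "r < k * l" "s < k * l"
  shows "matrix_unit (k * l) r s =
    single_block k l (r div l) (s div l) (matrix_unit l (r mod l) (s mod l))"
proof (rule eq_matI)
  fix a b
  assume "a < dim_row (single_block k l (r div l) (s div l) (matrix_unit l (r mod l) (s mod l)))"
    "b < dim_col (single_block k l (r div l) (s div l) (matrix_unit l (r mod l) (s mod l)))"
  then have ab: "a < k * l" "b < k * l" by (auto simp: single_block_def from_blocks_def)
  then have l: "l > 0" by (cases l) auto
  have dm: "x = y \<longleftrightarrow> x div l = y div l \<and> x mod l = y mod l" for x y
    by (metis div_mult_mod_eq)
  show "matrix_unit (k * l) r s $$ (a, b) =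
     single_block k l (r div l) (s div l) (matrix_unit l (r mod l) (s mod l)) $$ (a, b)"
    using ab l
    by (auto simp: matrix_unit_def single_block_def from_blocks_def dm[of a r] dm[of b s])
qed (auto simp: matrix_unit_def single_block_def from_blocks_def)

lemma matrix_unit_carrier [simp]: "matrix_unit n i j \<in> carrier_mat n n"
  by (simp add: matrix_unit_def)

lemma matrix_unit_mult:
  assumes "j < n" "j' < n"
  shows "matrix_unit n i j * matrix_unit n j' s =
    (if j = j' then matrix_unit n i s else 0\<^sub>m n n :: 'f::field mat)"
proof (rule eq_matI)
  fix a b assume "a < dim_row (if j = j' then matrix_unit n i s else 0\<^sub>m n n :: 'f mat)"
    "b < dim_col (if j = j' then matrix_unit n i s else 0\<^sub>m n n :: 'f mat)"
  then have ab: "a < n" "b < n" by (auto simp: matrix_unit_def split: if_splits)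
  have "(matrix_unit n i j * matrix_unit n j' s :: 'f mat) $$ (a, b) =
      (\<Sum>t<n. matrix_unit n i j $$ (a, t) * matrix_unit n j' s $$ (t, b))"
    using ab by (intro index_mult_mat_sum) auto
  also have "\<dots> = (\<Sum>t<n. if t = j then (if a = i \<and> j = j' \<and> b = s then 1 else 0) else 0)"
    using ab by (intro sum.cong) (auto simp: matrix_unit_def)
  also have "\<dots> = (if j = j' then matrix_unit n i s else 0\<^sub>m n n :: 'f mat) $$ (a, b)"
    using ab assms by (auto simp: matrix_unit_def)
  finally show "(matrix_unit n i j * matrix_unit n j' s) $$ (a, b) =
    (if j = j' then matrix_unit n i s else 0\<^sub>m n n :: 'f mat) $$ (a, b)" .
qed (auto simp: matrix_unit_def)

lemma mult_matrix_unit_index: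
  fixes a :: "'f::field mat"
  assumes "a \<in> carrier_mat n n" "r < n" "s < n" "i < n" "j < n"
  shows "(a * matrix_unit n i j) $$ (r, s) = (if s = j then a $$ (r, i) else 0)"
proof -
  have "(a * matrix_unit n i j) $$ (r, s) = (\<Sum>t<n. a $$ (r, t) * matrix_unit n i j $$ (t, s))"
    using assms by (intro index_mult_mat_sum) auto
  also have "\<dots> = (\<Sum>t<n. if t = i then (if s = j then a $$ (r, i) else 0) else 0)"
    using assms by (intro sum.cong) (auto simp: matrix_unit_def)
  finally show ?thesis using assms by simp
qed

section \<open>Invertible matrices\<close>

text \<open>Otherwise every summand of the Leibniz formula vanishes.\<close>

lemma det_nonzero_permutation:
  assumes "a \<in> carrier_mat n n" "det a \<noteq> 0"
  obtains p where "p permutes {..<n}" "\<And>i. i < n \<Longrightarrow> a $$ (i, p i) \<noteq> (0 :: 'f::field)"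
proof -
  have "\<exists>p. p permutes {0..<n} \<and> (\<Prod>i = 0..<n. a $$ (i, p i)) \<noteq> 0"
  proof (rule ccontr)
    assume "\<not> ?thesis"
    then have "det a = 0" unfolding det_def'[OF assms(1)] by (intro sum.neutral) auto
    with assms show False by simp
  qed
  then obtain p where "p permutes {0..<n}" "(\<Prod>i = 0..<n. a $$ (i, p i)) \<noteq> 0" by blast
  then show ?thesis by (intro that[of p]) (auto simp: atLeast0LessThan)
qed

lemma det_nonzeroI:
  fixes a :: "'f::field mat"
  assumes a: "a \<in> carrier_mat n n"
    and inj: "\<And>v. v \<in> carrier_vec n \<Longrightarrow> a *\<^sub>v v = 0\<^sub>v n \<Longrightarrow> v = 0\<^sub>v n"
  shows "det a \<noteq> 0"
  using det_0_iff_vec_prod_zero_field[OF a] inj by blast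

lemma inverse_of_det_nonzero:
  fixes a :: "'f::field mat"
  assumes a: "a \<in> carrier_mat n n" and "det a \<noteq> 0"
  obtains b where "b \<in> carrier_mat n n" "a * b = 1\<^sub>m n" "b * a = 1\<^sub>m n"
  using det_non_zero_imp_unit[OF assms] by (auto simp: Units_def ring_mat_simps)

lemma det_nonzero_of_inverse:
  fixes a :: "'f::field mat"
  assumes "a \<in> carrier_mat n n" "b \<in> carrier_mat n n" "a * b = 1\<^sub>m n"
  shows "det a \<noteq> 0"
  using det_mult[OF assms(1,2)] assms(3) by auto

section \<open>Upper block-triangular matrices\<close>

lemma block_index_ex:
  fixes i :: nat
  assumes "i < sum_list ns"
  shows "\<exists>r<length ns. i < sum_list (take (Suc r) ns)"
  using assms by (cases "ns = []") (auto intro!: exI[of _ "length ns - 1"])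

lemma block_index_less_length:
  assumes "i < sum_list ns"
  shows "block_index ns i < length ns"
proof -
  obtain r where r: "r < length ns" "i < sum_list (take (Suc r) ns)"
    using block_index_ex[OF assms] by blast
  then have "block_index ns i \<le> r" unfolding block_index_def by (intro Least_le)
  with r show ?thesis by simp
qed

lemma block_index_mono:
  assumes "i \<le> j" "j < sum_list ns"
  shows "block_index ns i \<le> block_index ns j"
proof -
  obtain r where "j < sum_list (take (Suc r) ns)" using block_index_ex[OF assms(2)] by blast
  then have "j < sum_list (take (Suc (block_index ns j)) ns)"
    unfolding block_index_def by (rule LeastI)
  with assms show ?thesis
    unfolding block_index_def[of ns i] by (intro Least_le) simp
qed

lemma block_index_Cons:
  assumes "i < sum_list (m # ms)"
  shows "block_index (m # ms) i = (if i < m then 0 else Suc (block_index ms (i - m)))"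
proof (cases "i < m")
  case True
  then show ?thesis unfolding block_index_def by (auto intro: Least_equality)
next
  case False
  obtain r where "i < sum_list (take (Suc r) (m # ms))" using block_index_ex[OF assms] by blast
  then have "(LEAST r. i < sum_list (take (Suc r) (m # ms))) =
      Suc (LEAST r. i < sum_list (take (Suc (Suc r)) (m # ms)))"
    using False by (intro Least_Suc) auto
  also have "(\<lambda>r. i < sum_list (take (Suc (Suc r)) (m # ms))) =
      (\<lambda>r. i - m < sum_list (take (Suc r) ms))"
    using False by (auto simp: fun_eq_iff)
  finally show ?thesis using False by (simp add: block_index_def)
qed

lemma block_index_scale:
  assumes "l > 0"
  shows "block_index (map (\<lambda>m. m * l) ks) r = block_index ks (r div l)"
proof -
  have "sum_list (take n (map (\<lambda>m. m * l) ks)) = sum_list (take n ks) * l" for n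
    by (simp add: take_map sum_list_mult_const)
  then show ?thesis using assms by (simp add: block_index_def div_less_iff_less_mult)
qed

text \<open>The block of a position in a concatenation is the index of the list that the position falls
  into, so counting positions per block counts entries per list.\<close>

lemma card_concat_block:
  assumes "p < length xss"
  shows "card {i. i < length (concat xss) \<and> block_index (map length xss) i = p \<and>
      Q (concat xss ! i)} = length (filter Q (xss ! p))"
  using assms
proof (induction xss arbitrary: p)
  case (Cons xs xss)
  let ?S = "{i. i < length (concat (xs # xss)) \<and>
    block_index (map length (xs # xss)) i = p \<and> Q (concat (xs # xss) ! i)}"
  have len: "length (concat (xs # xss)) = sum_list (map length (xs # xss))"
    by (simp add: length_concat)
  have bi: "block_index (map length (xs # xss)) i =
      (if i < length xs then 0 else Suc (block_index (map length xss) (i - length xs)))"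
    if "i < length (concat (xs # xss))" for i
    using that unfolding len by (simp add: block_index_Cons)
  show ?case
  proof (cases p)
    case 0
    have "?S = {i. i < length xs \<and> Q (xs ! i)}"
      using 0 bi by (auto simp: nth_append split: if_splits)
    then show ?thesis using 0 by (simp add: length_filter_conv_card)
  next
    case (Suc p')
    let ?S' = "{i. i < length (concat xss) \<and> block_index (map length xss) i = p' \<and>
      Q (concat xss ! i)}"
    have "?S = (\<lambda>i. i + length xs) ` ?S'"
    proof (intro equalityI subsetI)
      fix i assume i: "i \<in> ?S"
      then have "\<not> i < length xs" using bi[of i] Suc by (auto split: if_splits)
      then have "i - length xs \<in> ?S'" "i = (i - length xs) + length xs"
        using i bi[of i] Suc by (auto simp: nth_append)
      then show "i \<in> (\<lambda>i. i + length xs) ` ?S'" by blast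
    next
      fix i assume "i \<in> (\<lambda>i. i + length xs) ` ?S'"
      then obtain j where "i = j + length xs" "j \<in> ?S'" by blast
      then show "i \<in> ?S" using bi[of i] Suc by (auto simp: nth_append)
    qed
    moreover have "card ((\<lambda>i. i + length xs) ` ?S') = card ?S'"
      by (intro card_image) (auto simp: inj_on_def)
    ultimately show ?thesis using Cons.IH[of p'] Cons.prems Suc by simp
  qed
qed simp

lemma card_div_vimage: "card {r. r < k * l \<and> Q (r div l)} = l * card {i. i < k \<and> Q i}"
proof -
  have "card {r. r < k * l \<and> Q (r div l)} = (\<Sum>r<k * l. if Q (r div l) then 1 else 0)"
    by (simp add: sum.If_cases Int_def)
  also have "\<dots> = (\<Sum>m<k. \<Sum>p<l. if Q m then 1 else 0)"
    unfolding sum_lessThan_blocks by (intro sum.cong refl) auto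
  also have "\<dots> = (\<Sum>m<k. l * (if Q m then 1 else 0))" by (intro sum.cong) auto
  also have "\<dots> = l * (\<Sum>m<k. if Q m then 1 else 0)" by (simp only: sum_distrib_left)
  also have "\<dots> = l * card {i. i < k \<and> Q i}" by (simp add: sum.If_cases Int_def)
  finally show ?thesis .
qed

lemma UT_carrier: "a \<in> UT ns \<Longrightarrow> a \<in> carrier_mat (sum_list ns) (sum_list ns)"
  by (simp add: UT_def)

lemma UT_zero: "0\<^sub>m (sum_list ns) (sum_list ns) \<in> UT ns"
  by (simp add: UT_def)

lemma UT_add: "a \<in> UT ns \<Longrightarrow> b \<in> UT ns \<Longrightarrow> a + b \<in> UT ns"
  by (auto simp: UT_def)

lemma UT_smult: "a \<in> UT ns \<Longrightarrow> c \<cdot>\<^sub>m a \<in> UT ns"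
  by (auto simp: UT_def)

lemma UT_mult:
  assumes "a \<in> UT ns" "b \<in> UT ns"
  shows "a * b \<in> UT ns"
proof -
  let ?n = "sum_list ns"
  have car: "a \<in> carrier_mat ?n ?n" "b \<in> carrier_mat ?n ?n" using assms by (auto simp: UT_def)
  have "(a * b) $$ (i, j) = 0"
    if ij: "i < ?n" "j < ?n" and lt: "block_index ns j < block_index ns i" for i j
  proof -
    have "a $$ (i, s) * b $$ (s, j) = 0" if "s < ?n" for s
      using assms ij lt that by (cases "block_index ns s < block_index ns i") (auto simp: UT_def)
    then show ?thesis unfolding index_mult_mat_sum[OF car ij] by (intro sum.neutral) auto
  qed
  then show ?thesis using car by (auto simp: UT_def)
qed

lemma matrix_unit_UT:
  assumes "i < sum_list ns \<Longrightarrow> j < sum_list ns \<Longrightarrow> block_index ns i \<le> block_index ns j"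
  shows "matrix_unit (sum_list ns) i j \<in> UT ns"
  using assms by (auto simp: UT_def matrix_unit_def)

text \<open>Additive and homogeneous statements need only be tested on the matrix units that the
  algebra contains: the entries of a matrix can be restored one position at a time.\<close>

lemma UT_induct [consumes 1, case_names zero add unit]:
  assumes a: "a \<in> UT ns"
    and zero: "Q (0\<^sub>m (sum_list ns) (sum_list ns))"
    and add: "\<And>x y. x \<in> UT ns \<Longrightarrow> y \<in> UT ns \<Longrightarrow> Q x \<Longrightarrow> Q y \<Longrightarrow> Q (x + y)"
    and unit: "\<And>c i j. i < sum_list ns \<Longrightarrow> j < sum_list ns \<Longrightarrow>
      block_index ns i \<le> block_index ns j \<Longrightarrow> Q (c \<cdot>\<^sub>m matrix_unit (sum_list ns) i j)"
  shows "Q a"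
proof -
  let ?n = "sum_list ns"
  define part where "part S = mat ?n ?n (\<lambda>x. if x \<in> S then a $$ x else 0)" for S
  have "part S \<in> UT ns \<and> Q (part S)" if "finite S" "S \<subseteq> {..<?n} \<times> {..<?n}" for S
    using that
  proof (induction S rule: finite_induct)
    case empty
    have "part {} = 0\<^sub>m ?n ?n" by (auto simp: part_def)
    then show ?case using zero UT_zero by simp
  next
    case (insert x S)
    obtain i j where x: "x = (i, j)" by (cases x)
    have ij: "i < ?n" "j < ?n" using insert.prems x by auto
    have split: "part (insert x S) = a $$ (i, j) \<cdot>\<^sub>m matrix_unit ?n i j + part S"
      using insert.hyps ij by (intro eq_matI) (auto simp: part_def matrix_unit_def x)
    show ?case
    proof (cases "block_index ns i \<le> block_index ns j")
      case True
      have "a $$ (i, j) \<cdot>\<^sub>m matrix_unit ?n i j \<in> UT ns"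
        using True by (intro UT_smult matrix_unit_UT)
      then show ?thesis
        unfolding split using insert.IH insert.prems unit[OF ij True] by (auto intro: add UT_add)
    next
      case False
      then have "a $$ (i, j) = 0" using a ij by (auto simp: UT_def)
      then have "part (insert x S) = part S"
        unfolding split by (intro eq_matI) (auto simp: part_def matrix_unit_def)
      then show ?thesis using insert.IH insert.prems by simp
    qed
  qed
  from this[of "{..<?n} \<times> {..<?n}"] have "Q (part ({..<?n} \<times> {..<?n}))" by simp
  moreover have "part ({..<?n} \<times> {..<?n}) = a"
    using UT_carrier[OF a] by (intro eq_matI) (auto simp: part_def)
  ultimately show ?thesis by simp
qed

lemma UT_iff_blocks:
  assumes l: "l > 0"
  shows "a \<in> UT (map (\<lambda>m. m * l) ks) \<longleftrightarrow>
    a \<in> carrier_mat (sum_list ks * l) (sum_list ks * l) \<and>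
    (\<forall>i<sum_list ks. \<forall>j<sum_list ks. block_index ks j < block_index ks i \<longrightarrow>
      block l a i j = 0\<^sub>m l l)" (is "?L \<longleftrightarrow> ?R")
proof -
  let ?k = "sum_list ks"
  have n: "sum_list (map (\<lambda>m. m * l) ks) = ?k * l"
    by (simp add: sum_list_mult_const)
  show ?thesis
  proof
    assume L: ?L
    show ?R
    proof (intro conjI allI impI)
      fix i j assume ij: "i < ?k" "j < ?k" "block_index ks j < block_index ks i"
      show "block l a i j = 0\<^sub>m l l"
      proof (rule eq_matI)
        fix p q assume "p < dim_row (0\<^sub>m l l)" "q < dim_col (0\<^sub>m l l)"
        then show "block l a i j $$ (p, q) = 0\<^sub>m l l $$ (p, q)"
          using L ij by (auto simp: UT_def n block_index_scale[OF l] block_def block_offset_less)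
      qed (auto simp: block_def)
    qed (use L in \<open>auto simp: UT_def n\<close>)
  next
    assume R: ?R
    have "a $$ (r, s) = 0" if rs: "r < ?k * l" "s < ?k * l"
      and lt: "block_index ks (s div l) < block_index ks (r div l)" for r s
    proof -
      have "r div l < ?k" "s div l < ?k" using rs l by (auto simp: div_less_iff_less_mult)
      then have "block l a (r div l) (s div l) $$ (r mod l, s mod l) = 0"
        using R lt l by auto
      then show ?thesis using l by (simp add: block_def)
    qed
    with R show ?L by (auto simp: UT_def n block_index_scale[OF l])
  qed
qed

section \<open>Division gradings\<close>

lemma mat_subspaceD:
  assumes "mat_subspace n V"
  shows "V \<subseteq> carrier_mat n n" "0\<^sub>m n n \<in> V"
    "x \<in> V \<Longrightarrow> y \<in> V \<Longrightarrow> x + y \<in> V" "x \<in> V \<Longrightarrow> c \<cdot>\<^sub>m x \<in> V"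
  using assms by (auto simp: mat_subspace_def)

lemma smult_smult_mat:
  "a \<cdot>\<^sub>m (b \<cdot>\<^sub>m x) = (a * b) \<cdot>\<^sub>m (x :: 'f::field mat)"
  by (intro eq_matI) auto

lemma smult_cancel_mat:
  assumes "a \<cdot>\<^sub>m x = b \<cdot>\<^sub>m x" "x \<in> carrier_mat n m" "x \<noteq> (0\<^sub>m n m :: 'f::field mat)"
  shows "a = b"
proof -
  have "\<exists>i j. i < n \<and> j < m \<and> x $$ (i, j) \<noteq> 0"
  proof (rule ccontr)
    assume "\<not> ?thesis"
    then have "x = 0\<^sub>m n m" using assms(2) by (intro eq_matI) auto
    with assms(3) show False by simp
  qed
  then obtain i j where ij: "i < n" "j < m" "x $$ (i, j) \<noteq> 0" by blast
  have "(a \<cdot>\<^sub>m x) $$ (i, j) = (b \<cdot>\<^sub>m x) $$ (i, j)" using assms by simp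
  then show ?thesis using ij assms(2) by simp
qed

lemma zero_smult_mat: "x \<in> carrier_mat n m \<Longrightarrow> 0 \<cdot>\<^sub>m x = (0\<^sub>m n m :: 'f::field mat)"
  by (intro eq_matI) auto

lemma add_add_swap_mat:
  fixes a b c d :: "'f::field mat"
  assumes "a \<in> carrier_mat n m" "b \<in> carrier_mat n m" "c \<in> carrier_mat n m" "d \<in> carrier_mat n m"
  shows "(a + b) + (c + d) = (a + c) + (b + d)"
  using assms by (intro eq_matI) auto

lemma smult_mult_smult_mat:
  fixes x y :: "'f::field mat"
  assumes "x \<in> carrier_mat n n" "y \<in> carrier_mat n n"
  shows "(a \<cdot>\<^sub>m x) * (b \<cdot>\<^sub>m y) = (a * b) \<cdot>\<^sub>m (x * y)"
  unfolding mult_smult_assoc_mat[OF assms(1) smult_carrier_mat[OF assms(2)]]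
    mult_smult_distrib[OF assms] smult_smult_mat ..

lemma one_smult_mat: "1 \<cdot>\<^sub>m x = (x :: 'f::field mat)"
  by (intro eq_matI) auto

lemma smult_nonzero_mat:
  assumes "x \<in> carrier_mat n m" "x \<noteq> (0\<^sub>m n m :: 'f::field mat)" "c \<noteq> 0"
  shows "c \<cdot>\<^sub>m x \<noteq> 0\<^sub>m n m"
proof
  assume "c \<cdot>\<^sub>m x = 0\<^sub>m n m"
  then have "c \<cdot>\<^sub>m x = 0 \<cdot>\<^sub>m x" using assms(1) by (simp add: zero_smult_mat)
  then show False using smult_cancel_mat assms by blast
qed

locale division_algebra = comm_group G for G :: "('g, 'b) monoid_scheme" (structure) +
  fixes T :: "'g set" and \<beta> :: "'g \<Rightarrow> 'g \<Rightarrow> 'f::field" and l :: nat and D :: "'g \<Rightarrow> 'f mat set"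
  assumes subgroup_T: "subgroup T G"
    and finite_T: "finite T"
    and bichar: "nondeg_alternating_bichar G T \<beta>"
    and division: "division_grading G l T \<beta> D"
    and l_pos: "l > 0"
begin

lemma T_carrier [simp]: "t \<in> T \<Longrightarrow> t \<in> carrier G"
  using subgroup_T by (rule subgroup.mem_carrier)

lemma T_one [simp]: "\<one> \<in> T" using subgroup_T by (rule subgroup.one_closed)
lemma T_mult [simp]: "u \<in> T \<Longrightarrow> v \<in> T \<Longrightarrow> u \<otimes> v \<in> T" using subgroup_T by (rule subgroup.m_closed)
lemma T_inv [simp]: "u \<in> T \<Longrightarrow> inv u \<in> T" using subgroup_T by (rule subgroup.m_inv_closed)

lemma beta_mult_left: "u \<in> T \<Longrightarrow> v \<in> T \<Longrightarrow> w \<in> T \<Longrightarrow> \<beta> (u \<otimes> v) w = \<beta> u w * \<beta> v w"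
  using bichar by (auto simp: nondeg_alternating_bichar_def)
lemma beta_mult_right: "u \<in> T \<Longrightarrow> v \<in> T \<Longrightarrow> w \<in> T \<Longrightarrow> \<beta> u (v \<otimes> w) = \<beta> u v * \<beta> u w"
  using bichar by (auto simp: nondeg_alternating_bichar_def)
lemma beta_nonzero: "u \<in> T \<Longrightarrow> v \<in> T \<Longrightarrow> \<beta> u v \<noteq> 0"
  using bichar by (auto simp: nondeg_alternating_bichar_def)
lemma beta_self: "u \<in> T \<Longrightarrow> \<beta> u u = 1"
  using bichar by (auto simp: nondeg_alternating_bichar_def)

lemma beta_skew:
  assumes "u \<in> T" "v \<in> T"
  shows "\<beta> u v * \<beta> v u = 1"
proof -
  have "1 = \<beta> (u \<otimes> v) (u \<otimes> v)" using assms by (simp add: beta_self)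
  also have "\<dots> = (\<beta> u u * \<beta> u v) * (\<beta> v u * \<beta> v v)"
    using assms by (simp only: beta_mult_left beta_mult_right T_mult mult_ac)
  also have "\<dots> = \<beta> u v * \<beta> v u"
    using assms by (simp add: beta_self)
  finally show ?thesis by simp
qed

lemma D_grading: "is_grading G l (carrier_mat l l) D"
  using division by (simp add: division_grading_def)

lemma D_subspace: "g \<in> carrier G \<Longrightarrow> mat_subspace l (D g)"
  using D_grading by (simp add: is_grading_def)

lemma D_carrier: "d \<in> D g \<Longrightarrow> g \<in> carrier G \<Longrightarrow> d \<in> carrier_mat l l"
  using mat_subspaceD(1)[OF D_subspace] by blast

lemma D_zero [simp]: "g \<in> carrier G \<Longrightarrow> 0\<^sub>m l l \<in> D g"
  by (simp add: mat_subspaceD(2)[OF D_subspace])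

lemma D_add: "g \<in> carrier G \<Longrightarrow> x \<in> D g \<Longrightarrow> y \<in> D g \<Longrightarrow> x + y \<in> D g"
  by (simp add: mat_subspaceD(3)[OF D_subspace])

lemma D_smult: "g \<in> carrier G \<Longrightarrow> x \<in> D g \<Longrightarrow> c \<cdot>\<^sub>m x \<in> D g"
  by (simp add: mat_subspaceD(4)[OF D_subspace])

lemma D_mult:
  "g \<in> carrier G \<Longrightarrow> h \<in> carrier G \<Longrightarrow> x \<in> D g \<Longrightarrow> y \<in> D h \<Longrightarrow> x * y \<in> D (g \<otimes> h)"
  using D_grading by (simp add: is_grading_def)

lemma D_support: "g \<in> carrier G \<Longrightarrow> g \<notin> T \<Longrightarrow> D g = {0\<^sub>m l l}"
  using division unfolding division_grading_def by blast

lemma D_multiple: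
  assumes t: "t \<in> T" and x: "x \<in> D t" and y: "y \<in> D t" "y \<noteq> 0\<^sub>m l l"
  obtains c where "x = c \<cdot>\<^sub>m y"
proof -
  from division obtain X where "\<forall>t\<in>T. X t \<noteq> 0\<^sub>m l l \<and> D t = {c \<cdot>\<^sub>m X t | c. True}"
    unfolding division_grading_def by blast
  with t have X: "D t = {c \<cdot>\<^sub>m X t | c. True}" by blast
  have "X t = 1 \<cdot>\<^sub>m X t" by (simp add: one_smult_mat)
  then have "X t \<in> D t" using X by blast
  then have car: "X t \<in> carrier_mat l l" using D_carrier t by simp
  obtain a b where a: "x = a \<cdot>\<^sub>m X t" and b: "y = b \<cdot>\<^sub>m X t" using x y X by blast
  have "b \<noteq> 0" using b y(2) zero_smult_mat[OF car] by auto
  then have "x = (a / b) \<cdot>\<^sub>m y" using a b by (simp add: smult_smult_mat)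
  then show ?thesis using that by blast
qed

lemma D_nonzero_ex:
  assumes "t \<in> T"
  obtains x where "x \<in> D t" "x \<noteq> 0\<^sub>m l l"
proof -
  from assms division have "D t \<noteq> {0\<^sub>m l l}"
    unfolding division_grading_def by blast
  moreover have "0\<^sub>m l l \<in> D t" using assms by simp
  ultimately show ?thesis using that by blast
qed

lemma D_commute:
  assumes "u \<in> T" "v \<in> T" "x \<in> D u" "y \<in> D v"
  shows "x * y = \<beta> u v \<cdot>\<^sub>m (y * x)"
proof -
  from division obtain X where X: "\<forall>t\<in>T. X t \<noteq> 0\<^sub>m l l \<and> D t = {c \<cdot>\<^sub>m X t | c. True}"
    and XX: "\<forall>u\<in>T. \<forall>v\<in>T. X u * X v = \<beta> u v \<cdot>\<^sub>m (X v * X u)"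
    unfolding division_grading_def by blast
  have Xc: "X t \<in> carrier_mat l l" if "t \<in> T" for t
  proof -
    have "X t = 1 \<cdot>\<^sub>m X t" by (simp add: one_smult_mat)
    then have "X t \<in> D t" using X that by blast
    then show ?thesis using D_carrier that by simp
  qed
  note car = Xc[OF assms(1)] Xc[OF assms(2)]
  obtain a b where a: "x = a \<cdot>\<^sub>m X u" and b: "y = b \<cdot>\<^sub>m X v" using assms X by blast
  have "x * y = (a * b) \<cdot>\<^sub>m (X u * X v)" "y * x = (a * b) \<cdot>\<^sub>m (X v * X u)"
    unfolding a b using car by (simp_all only: smult_mult_smult_mat mult.commute)
  moreover have "X u * X v = \<beta> u v \<cdot>\<^sub>m (X v * X u)" using XX assms by blast
  ultimately show ?thesis by (metis smult_smult_mat mult.commute)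
qed

lemma one_mat_nonzero: "1\<^sub>m l \<noteq> (0\<^sub>m l l :: 'f mat)"
proof
  assume "1\<^sub>m l = (0\<^sub>m l l :: 'f mat)"
  then have "1\<^sub>m l $$ (0, 0) = (0\<^sub>m l l :: 'f mat) $$ (0, 0)" by simp
  then show False using l_pos by simp
qed

lemma D_inverse_mat:
  assumes "g \<in> carrier G" "x \<in> D g" "x \<noteq> 0\<^sub>m l l"
  obtains y where "y \<in> carrier_mat l l" "x * y = 1\<^sub>m l" "y * x = 1\<^sub>m l"
proof -
  have x: "x \<in> carrier_mat l l" using assms D_carrier by blast
  have "invertible_mat x" using division assms unfolding division_grading_def by blast
  then obtain y where y: "x * y = 1\<^sub>m l" "y * x = 1\<^sub>m (dim_row y)"
    using x by (auto simp: invertible_mat_def inverts_mat_def)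
  have "dim_col y = l" using y(1) by (metis index_mult_mat(3) index_one_mat(3))
  moreover have "dim_row y = l" using y(2) x by (metis carrier_matD(2) index_mult_mat(3) index_one_mat(3))
  ultimately show ?thesis using that y by auto
qed

lemma D_mult_nonzero:
  assumes "g \<in> carrier G" "x \<in> D g" "x \<noteq> 0\<^sub>m l l" "y \<in> carrier_mat l m" "y \<noteq> 0\<^sub>m l m"
  shows "x * y \<noteq> 0\<^sub>m l m"
proof
  assume xy: "x * y = 0\<^sub>m l m"
  obtain z where z: "z \<in> carrier_mat l l" "z * x = 1\<^sub>m l" using D_inverse_mat assms by metis
  have x: "x \<in> carrier_mat l l" using assms D_carrier by blast
  have "y = (z * x) * y" using z assms by simp
  also have "\<dots> = z * (x * y)" using z x assms by (intro assoc_mult_mat) auto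
  also have "\<dots> = 0\<^sub>m l m" using xy z by simp
  finally show False using assms by simp
qed

text \<open>A nonzero element of degree \<open>\<one>\<close> is invertible and, the component being a line closed under
  multiplication, it is proportional to its own square.\<close>

lemma D_one: "1\<^sub>m l \<in> D \<one>"
proof -
  obtain x where x: "x \<in> D \<one>" "x \<noteq> 0\<^sub>m l l" using D_nonzero_ex[of \<one>] by auto
  have car: "x \<in> carrier_mat l l" using x D_carrier by simp
  have "x * x \<in> D \<one>" using D_mult[of \<one> \<one> x x] x by simp
  then obtain c where c: "x * x = c \<cdot>\<^sub>m x" using D_multiple[of \<one>] x by (metis T_one)
  obtain y where y: "y \<in> carrier_mat l l" "x * y = 1\<^sub>m l" "y * x = 1\<^sub>m l"
    using D_inverse_mat x by (metis one_closed)
  have "x = (y * x) * x" using y car by simp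
  also have "\<dots> = y * (x * x)" using y car by (intro assoc_mult_mat) auto
  also have "\<dots> = c \<cdot>\<^sub>m 1\<^sub>m l" using y car by (simp add: c mult_smult_distrib[of _ l l _ l])
  finally have xc: "x = c \<cdot>\<^sub>m 1\<^sub>m l" .
  then have "c \<noteq> 0" using x(2) zero_smult_mat[OF one_carrier_mat[of l]] by auto
  then have "1\<^sub>m l = inverse c \<cdot>\<^sub>m x" by (simp add: xc smult_smult_mat one_smult_mat)
  then show ?thesis using D_smult x by simp
qed

text \<open>The matrix inverse is homogeneous: for any nonzero \<open>y\<close> of degree \<open>inv t\<close>, the product \<open>x y\<close>
  is a nonzero element of degree \<open>\<one>\<close>, that is, a scalar.\<close>

lemma D_inverse:
  assumes t: "t \<in> T" and x: "x \<in> D t" "x \<noteq> 0\<^sub>m l l"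
  obtains y where "y \<in> D (inv t)" "x * y = 1\<^sub>m l" "y * x = 1\<^sub>m l"
proof -
  obtain y where y: "y \<in> D (inv t)" "y \<noteq> 0\<^sub>m l l" using D_nonzero_ex[of "inv t"] t by auto
  have car: "x \<in> carrier_mat l l" "y \<in> carrier_mat l l" using x y t D_carrier by auto
  have xy: "x * y \<noteq> 0\<^sub>m l l" using D_mult_nonzero t x car y by (metis T_carrier)
  have "x * y \<in> D \<one>" using D_mult[of t "inv t" x y] t x y by simp
  then obtain c where c: "x * y = c \<cdot>\<^sub>m 1\<^sub>m l"
    using D_multiple[of \<one>] D_one one_mat_nonzero by (metis T_one)
  have c0: "c \<noteq> 0" using xy c zero_smult_mat[OF one_carrier_mat[of l]] by auto
  let ?y = "inverse c \<cdot>\<^sub>m y"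
  have right: "x * ?y = 1\<^sub>m l"
    using car c0 by (simp add: mult_smult_distrib[of _ l l _ l] c smult_smult_mat one_smult_mat)
  obtain z where z: "z \<in> carrier_mat l l" "z * x = 1\<^sub>m l"
    using D_inverse_mat t x by (metis T_carrier)
  have "z = z * (x * ?y)" using right z by simp
  also have "\<dots> = (z * x) * ?y"
    using z car by (intro assoc_mult_mat[symmetric, of _ l l _ l _ l]) auto
  also have "\<dots> = ?y" using z car by simp
  finally have "?y * x = 1\<^sub>m l" using z by simp
  then show ?thesis using that[of ?y] right D_smult y t by simp
qed

text \<open>Every matrix is a finite sum of homogeneous ones; components outside the support are zero.\<close>

lemma D_induct [consumes 1, case_names zero add homogeneous]:
  assumes a: "a \<in> carrier_mat l l"
    and zero: "Q (0\<^sub>m l l)"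
    and add: "\<And>x y. x \<in> carrier_mat l l \<Longrightarrow> y \<in> carrier_mat l l \<Longrightarrow> Q x \<Longrightarrow> Q y \<Longrightarrow> Q (x + y)"
    and hom: "\<And>t d. t \<in> T \<Longrightarrow> d \<in> D t \<Longrightarrow> Q d"
  shows "Q a"
proof -
  let ?R = "ring_mat TYPE('f) l ()"
  interpret R: semiring ?R by (rule semiring_mat)
  obtain f where f: "\<forall>g\<in>carrier G. f g \<in> D g" "\<forall>g. g \<notin> carrier G \<longrightarrow> f g = 0\<^sub>m l l"
    "finite {g. f g \<noteq> 0\<^sub>m l l}" "a = finsum ?R f {g. f g \<noteq> 0\<^sub>m l l}"
    using D_grading a unfolding is_grading_def by metis
  have car: "f g \<in> carrier_mat l l" for g
    using f D_carrier by (cases "g \<in> carrier G") auto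
  have Qf: "Q (f g)" for g
    using f hom zero D_support by (cases "g \<in> T"; cases "g \<in> carrier G") auto
  have "finsum ?R f F \<in> carrier_mat l l \<and> Q (finsum ?R f F)" if "finite F" for F
    using that
  proof (induction F rule: finite_induct)
    case empty
    then show ?case using zero by (simp add: ring_mat_simps)
  next
    case (insert x F)
    have "finsum ?R f (insert x F) = f x + finsum ?R f F"
      using insert.hyps car by (subst R.finsum_insert) (auto simp: ring_mat_simps)
    then show ?case using insert.IH car Qf add by simp
  qed
  then show ?thesis using f by simp
qed

end

section \<open>Conjugacy of division gradings\<close>

text \<open>Horner's scheme for \<open>p(L)(m)\<close>, where \<open>L\<close> is the operator \<open>n \<mapsto> x n y\<close>.\<close>

definition horner :: "'f::field mat \<Rightarrow> 'f mat \<Rightarrow> 'f mat \<Rightarrow> 'f poly \<Rightarrow> 'f mat" where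
  "horner x y m p = fold_coeffs (\<lambda>a n. a \<cdot>\<^sub>m m + x * n * y) p (0\<^sub>m (dim_row m) (dim_col m))"

context
  fixes x y m :: "'f::field mat" and l :: nat
  assumes car: "x \<in> carrier_mat l l" "y \<in> carrier_mat l l" "m \<in> carrier_mat l l"
begin

lemma horner_0: "horner x y m 0 = 0\<^sub>m l l"
  using car by (simp add: horner_def)

lemma horner_pCons: "horner x y m (pCons a p) = a \<cdot>\<^sub>m m + x * horner x y m p * y"
proof (cases "a = 0 \<and> p = 0")
  case True
  then show ?thesis using car by (auto simp: horner_0 intro!: eq_matI)
next
  case False
  then show ?thesis
    by (cases "p = 0") (simp_all add: horner_def)
qed

lemma horner_carrier: "horner x y m p \<in> carrier_mat l l"
  using car by (induction p) (auto simp: horner_0 horner_pCons)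

lemma horner_smult: "horner x y m (smult c p) = c \<cdot>\<^sub>m horner x y m p"
proof (induction p)
  case 0
  then show ?case by (simp add: horner_0)
next
  case (pCons a p)
  have "horner x y m (smult c (pCons a p)) = (c * a) \<cdot>\<^sub>m m + x * (c \<cdot>\<^sub>m horner x y m p) * y"
    by (simp add: horner_pCons pCons.IH)
  also have "x * (c \<cdot>\<^sub>m horner x y m p) * y = c \<cdot>\<^sub>m (x * horner x y m p * y)"
    using car horner_carrier[of p]
    by (simp add: mult_smult_distrib[of _ l l _ l] mult_smult_assoc_mat[of _ l l _ l])
  also have "(c * a) \<cdot>\<^sub>m m + c \<cdot>\<^sub>m (x * horner x y m p * y) =
      c \<cdot>\<^sub>m (a \<cdot>\<^sub>m m + x * horner x y m p * y)"
    using car horner_carrier[of p]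
    by (simp add: add_smult_distrib_left_mat[of _ l l] smult_smult_mat
        mult_carrier_mat[of _ l l])
  finally show ?case by (simp add: horner_pCons)
qed

lemma horner_add: "horner x y m (p + q) = horner x y m p + horner x y m q"
proof (induction p q rule: poly_induct2)
  case 0
  then show ?case by (simp add: horner_0)
next
  case (pCons a p b q)
  let ?p = "horner x y m p" and ?q = "horner x y m q"
  note c = car horner_carrier[of p] horner_carrier[of q]
  have "x * (?p + ?q) * y = x * ?p * y + x * ?q * y"
    using c by (simp add: mult_add_distrib_mat[of _ l l _ l] add_mult_distrib_mat[of _ l l _ _ l])
  moreover have "(a + b) \<cdot>\<^sub>m m = a \<cdot>\<^sub>m m + b \<cdot>\<^sub>m m"
    using c by (simp add: add_smult_distrib_right_mat)
  moreover have "(a \<cdot>\<^sub>m m + b \<cdot>\<^sub>m m) + (x * ?p * y + x * ?q * y) =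
      (a \<cdot>\<^sub>m m + x * ?p * y) + (b \<cdot>\<^sub>m m + x * ?q * y)"
    using c by (intro add_add_swap_mat[of _ l l] smult_carrier_mat mult_carrier_mat[of _ l l])
  ultimately show ?case by (simp add: horner_pCons pCons.IH)
qed

end

lemma smult_mat_mult_vec:
  fixes a :: "'f::field mat"
  assumes "a \<in> carrier_mat n m" "v \<in> carrier_vec m"
  shows "(c \<cdot>\<^sub>m a) *\<^sub>v v = c \<cdot>\<^sub>v (a *\<^sub>v v)"
  using assms by (intro eq_vecI) auto

lemma add_uminus_smult_eq_zero:
  fixes a b :: "'f::field mat"
  assumes "a \<in> carrier_mat n m" "b \<in> carrier_mat n m" "a + (- c) \<cdot>\<^sub>m b = 0\<^sub>m n m"
  shows "a = c \<cdot>\<^sub>m b"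
proof (rule eq_matI)
  fix i j assume "i < dim_row (c \<cdot>\<^sub>m b)" "j < dim_col (c \<cdot>\<^sub>m b)"
  then have ij: "i < n" "j < m" using assms by auto
  have "(a + (- c) \<cdot>\<^sub>m b) $$ (i, j) = 0" using assms(3) ij by simp
  then show "a $$ (i, j) = (c \<cdot>\<^sub>m b) $$ (i, j)" using assms(1,2) ij by simp
qed (use assms in auto)

context
  fixes x y m :: "'f::alg_closed_field mat" and l :: nat
  assumes car: "x \<in> carrier_mat l l" "y \<in> carrier_mat l l" "m \<in> carrier_mat l l"
begin

lemma horner_linear_factor:
  "horner x y m ([:- c, 1:] * q) = x * horner x y m q * y + (- c) \<cdot>\<^sub>m horner x y m q"
proof -
  note h = horner_carrier[OF car, of q]
  have "[:- c, 1:] * q = pCons 0 q + smult (- c) q" by simp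
  then have "horner x y m ([:- c, 1:] * q) = horner x y m (pCons 0 q) + (- c) \<cdot>\<^sub>m horner x y m q"
    by (simp only: horner_add[OF car] horner_smult[OF car])
  also have "horner x y m (pCons 0 q) = x * horner x y m q * y"
    using h car
    by (simp add: horner_pCons[OF car] zero_smult_mat[OF car(3)] left_add_zero_mat[of _ l l]
        mult_carrier_mat[of _ l l])
  finally show ?thesis .
qed

text \<open>A polynomial of least degree annihilating \<open>m\<close> has a root \<open>c\<close>; the quotient by
  the corresponding linear factor does not annihilate \<open>m\<close> and yields an eigenvector.\<close>

lemma horner_eigenvector:
  assumes m: "m \<noteq> 0\<^sub>m l l" and p: "p \<noteq> 0" "horner x y m p = 0\<^sub>m l l"
  obtains q c where "horner x y m q \<noteq> 0\<^sub>m l l"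
    "x * horner x y m q * y = c \<cdot>\<^sub>m horner x y m q"
proof -
  let ?P = "\<lambda>p. p \<noteq> 0 \<and> horner x y m p = 0\<^sub>m l l"
  obtain p where p: "?P p" and min: "\<And>q. ?P q \<Longrightarrow> degree p \<le> degree q"
    using ex_has_least_nat[of ?P _ degree] p by metis
  have "degree p \<noteq> 0"
  proof
    assume "degree p = 0"
    then obtain a where a: "p = [:a:]" by (rule degree_eq_zeroE)
    then have "horner x y m p = a \<cdot>\<^sub>m m"
      using car by (simp add: horner_pCons[OF car] horner_0[OF car] right_add_zero_mat[of _ l l])
    then show False using smult_nonzero_mat[OF car(3) m, of a] p a by auto
  qed
  then obtain c where "poly p c = 0" using alg_closed_imp_poly_has_root by blast
  then obtain q where q: "p = [:- c, 1:] * q" by (auto simp: poly_eq_0_iff_dvd elim: dvdE)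
  have q0: "q \<noteq> 0" using p q by auto
  then have "degree q < degree p" unfolding q by (subst degree_mult_eq) auto
  then have n: "horner x y m q \<noteq> 0\<^sub>m l l" using min[of q] q0 by auto
  let ?n = "horner x y m q"
  have h: "?n \<in> carrier_mat l l" "x * ?n * y \<in> carrier_mat l l"
    using horner_carrier[OF car] car by (auto intro!: mult_carrier_mat[of _ l l])
  have "x * ?n * y + (- c) \<cdot>\<^sub>m ?n = 0\<^sub>m l l" using p unfolding q horner_linear_factor by simp
  then have "x * ?n * y = c \<cdot>\<^sub>m ?n" using h by (intro add_uminus_smult_eq_zero)
  with n show ?thesis using that by blast
qed

end

lemmas (in division_algebra) square_simps =
  assoc_mult_mat[of _ l l _ l _ l] mult_carrier_mat[of _ l l _ l]
  mult_smult_assoc_mat[of _ l l _ l] mult_smult_distrib[of _ l l _ l] smult_smult_mat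

lemma (in division_algebra) beta_inv:
  assumes "u \<in> T" "v \<in> T"
  shows "\<beta> u v * \<beta> u (inv v) = 1"
proof -
  have "\<beta> u \<one> * \<beta> u \<one> = \<beta> u \<one>"
    using beta_mult_right[of u \<one> \<one>] assms by simp
  then have "\<beta> u \<one> = 1" using beta_nonzero[of u \<one>] assms by simp
  then show ?thesis using beta_mult_right[of u v "inv v"] assms by simp
qed

lemma (in division_algebra) pow_eq_one_ex:
  assumes u: "u \<in> T"
  obtains n :: nat where "n > 0" "u [^] n = \<one>"
proof -
  have T: "u [^] n \<in> T" for n :: nat by (induction n) (use u in auto)
  have "\<not> inj (\<lambda>n::nat. u [^] n)"
    using T finite_T finite_imageD[of "\<lambda>n::nat. u [^] n" UNIV] finite_subset[of _ T]
    by (metis image_subset_iff infinite_UNIV_nat)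
  then obtain a b :: nat where ab: "u [^] a = u [^] b" "a < b"
    unfolding inj_def by (metis linorder_neqE_nat)
  have "u [^] a \<otimes> u [^] (b - a) = u [^] (a + (b - a))"
    using u by (intro nat_pow_mult) simp
  also have "\<dots> = u [^] a \<otimes> \<one>" using ab u by simp
  finally have "u [^] a \<otimes> u [^] (b - a) = u [^] a \<otimes> \<one>" .
  then have "u [^] (b - a) = \<one>" using u by (simp del: r_one)
  with ab show ?thesis using that[of "b - a"] by simp
qed

locale division_algebra_pair =
  A: division_algebra G T \<beta> l D + B: division_algebra G T \<beta> l D'
  for G :: "('g, 'b) monoid_scheme" (structure) and T and \<beta> :: "'g \<Rightarrow> 'g \<Rightarrow> 'f::alg_closed_field"
    and l D D'
begin

text \<open>The powers of the operator \<open>m \<mapsto> x m y\<close> have the same shape, with homogeneous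
  coefficients whose degrees are the powers of \<open>u\<close> and of its inverse.\<close>

lemma horner_monom_homogeneous:
  assumes u: "u \<in> T" and x: "x \<in> D u" and y: "y \<in> D' (inv u)" and m: "m \<in> carrier_mat l l"
  shows "\<exists>a\<in>D (u [^] n). \<exists>b\<in>D' (inv u [^] n). horner x y m (monom 1 n) = a * m * b"
proof (induction n)
  case 0
  have car: "x \<in> carrier_mat l l" "y \<in> carrier_mat l l"
    using A.D_carrier[OF x] B.D_carrier[OF y] u by auto
  have "horner x y m (monom 1 0) = 1\<^sub>m l * m * 1\<^sub>m l"
    using m car
    by (simp add: monom_0 horner_pCons[OF car m] horner_0[OF car m] one_smult_mat
        right_add_zero_mat[of _ l l])
  then show ?case using A.D_one B.D_one by auto
next
  case (Suc n)
  then obtain a b where a: "a \<in> D (u [^] n)" and b: "b \<in> D' (inv u [^] n)"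
    and h: "horner x y m (monom 1 n) = a * m * b" by blast
  have car: "x \<in> carrier_mat l l" "y \<in> carrier_mat l l"
    "a \<in> carrier_mat l l" "b \<in> carrier_mat l l"
    using A.D_carrier[OF x] B.D_carrier[OF y] A.D_carrier[OF a] B.D_carrier[OF b] u by auto
  have "horner x y m (monom 1 (Suc n)) = 0 \<cdot>\<^sub>m m + x * (a * m * b) * y"
    by (simp add: monom_Suc horner_pCons[OF car(1,2) m] h)
  also have "\<dots> = x * (a * m * b) * y"
    using car m by (simp add: zero_smult_mat[OF m] left_add_zero_mat[of _ l l] A.square_simps)
  also have "\<dots> = (x * a) * m * (b * y)"
    using car m by (simp add: A.square_simps)
  finally have "horner x y m (monom 1 (Suc n)) = (x * a) * m * (b * y)" .
  moreover have "x * a \<in> D (u [^] Suc n)"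
    using A.D_mult[OF _ _ x a] u A.m_comm[of u "u [^] n"] by simp
  moreover have "b * y \<in> D' (inv u [^] Suc n)"
    using B.D_mult[OF _ _ b y] u by simp
  ultimately show ?case by blast
qed

text \<open>As \<open>u\<close> has finite order, some power of the operator has coefficients of degree \<open>\<one>\<close>, which are
  scalars; that power is therefore a scalar operator.\<close>

lemma horner_annihilator_ex:
  assumes u: "u \<in> T" and x: "x \<in> D u" and y: "y \<in> D' (inv u)" and m: "m \<in> carrier_mat l l"
  obtains p where "p \<noteq> 0" "horner x y m p = 0\<^sub>m l l"
proof -
  have car: "x \<in> carrier_mat l l" "y \<in> carrier_mat l l"
    using A.D_carrier[OF x] B.D_carrier[OF y] u by auto
  obtain n :: nat where n: "n > 0" "u [^] n = \<one>" using A.pow_eq_one_ex[OF u] by blast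
  then have "inv u [^] n = \<one>" using u by (simp add: A.nat_pow_inv)
  then obtain a b where a: "a \<in> D \<one>" and b: "b \<in> D' \<one>"
    and h: "horner x y m (monom 1 n) = a * m * b"
    using horner_monom_homogeneous[OF u x y m, of n] n by auto
  obtain c where c: "a = c \<cdot>\<^sub>m 1\<^sub>m l"
    using A.D_multiple[OF A.T_one a A.D_one A.one_mat_nonzero] by blast
  obtain d where d: "b = d \<cdot>\<^sub>m 1\<^sub>m l"
    using B.D_multiple[OF B.T_one b B.D_one B.one_mat_nonzero] by blast
  have "a * m = c \<cdot>\<^sub>m m" using m by (simp add: c A.square_simps)
  moreover have "(c \<cdot>\<^sub>m m) * b = d \<cdot>\<^sub>m (c \<cdot>\<^sub>m m)"
    using m by (simp add: d A.square_simps)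
  ultimately have am: "a * m * b = (d * c) \<cdot>\<^sub>m m" by (simp add: A.square_simps)
  let ?p = "monom 1 n + [:- (d * c):]"
  have "horner x y m ?p = (d * c) \<cdot>\<^sub>m m + (- (d * c)) \<cdot>\<^sub>m m"
    using car m
    by (simp add: horner_add[OF car m] h am horner_pCons[OF car m] horner_0[OF car m]
        right_add_zero_mat[of _ l l])
  also have "\<dots> = (d * c + (- (d * c))) \<cdot>\<^sub>m m"
    using m by (intro add_smult_distrib_right_mat[symmetric])
  also have "\<dots> = 0\<^sub>m l l" using m by (simp add: zero_smult_mat)
  finally have "horner x y m ?p = 0\<^sub>m l l" .
  moreover have "coeff ?p n = 1" using n by (cases n) (auto simp: coeff_pCons)
  then have "?p \<noteq> 0" by (metis coeff_0 zero_neq_one)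
  ultimately show ?thesis using that by blast
qed

text \<open>The operators \<open>m \<mapsto> x\<^sub>t m (x'\<^sub>t)\<^sup>-\<^sup>1\<close> commute, because both gradings have the same
  bicharacter, so they have a common eigenvector.\<close>

lemma common_eigenvector:
  assumes X: "\<And>t. t \<in> T \<Longrightarrow> X t \<in> D t" "\<And>t. t \<in> T \<Longrightarrow> X t \<noteq> 0\<^sub>m l l"
    and Y: "\<And>t. t \<in> T \<Longrightarrow> Y t \<in> D' t" "\<And>t. t \<in> T \<Longrightarrow> Y t \<noteq> 0\<^sub>m l l"
    and F: "F \<subseteq> T"
  shows "\<exists>m\<in>carrier_mat l l. m \<noteq> 0\<^sub>m l l \<and> (\<exists>\<chi>. \<forall>t\<in>F. X t * m = \<chi> t \<cdot>\<^sub>m (m * Y t))"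
proof -
  have Xc: "X t \<in> carrier_mat l l" and Yc: "Y t \<in> carrier_mat l l" if "t \<in> T" for t
    using X(1)[OF that] Y(1)[OF that] A.D_carrier B.D_carrier that by auto
  have "finite F" using F A.finite_T finite_subset by blast
  then show ?thesis using F
  proof (induction F rule: finite_induct)
    case empty
    then show ?case using A.one_mat_nonzero by (intro bexI[of _ "1\<^sub>m l"]) auto
  next
    case (insert u F)
    then obtain m \<chi> where m: "m \<in> carrier_mat l l" "m \<noteq> 0\<^sub>m l l"
      and \<chi>: "\<And>t. t \<in> F \<Longrightarrow> X t * m = \<chi> t \<cdot>\<^sub>m (m * Y t)" by auto
    have u: "u \<in> T" using insert.prems by simp
    obtain y where y: "y \<in> D' (inv u)" "Y u * y = 1\<^sub>m l" "y * Y u = 1\<^sub>m l"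
      using B.D_inverse[OF u Y(1)[OF u] Y(2)[OF u]] by blast
    have yc: "y \<in> carrier_mat l l" using B.D_carrier[OF y(1)] u by simp
    let ?x = "X u"
    note car = Xc[OF u] yc m(1)
    \<comment> \<open>The operator of \<open>u\<close> preserves the simultaneous eigenspace found so far, since the factors
      \<open>\<beta> t u\<close> and \<open>\<beta> t (inv u)\<close> cancel; so every polynomial in it does.\<close>
    have H: "X t * horner ?x y m p = \<chi> t \<cdot>\<^sub>m (horner ?x y m p * Y t)" if "t \<in> F" for t p
    proof (induction p)
      case 0
      have t: "t \<in> T" using insert.prems that by auto
      show ?case using Xc[OF t] Yc[OF t] by (simp add: horner_0[OF car])
    next
      case (pCons a p)
      have t: "t \<in> T" using insert.prems that by auto
      note tc = Xc[OF t] Yc[OF t]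
      let ?n = "horner ?x y m p"
      note nc = horner_carrier[OF car, of p]
      have com1: "X t * ?x = \<beta> t u \<cdot>\<^sub>m (?x * X t)"
        using A.D_commute[OF t u X(1)[OF t] X(1)[OF u]] .
      have com2: "Y t * y = \<beta> t (inv u) \<cdot>\<^sub>m (y * Y t)"
        using B.D_commute[OF t B.T_inv[OF u] Y(1)[OF t] y(1)] .
      have "X t * (?x * ?n * y) = (X t * ?x) * ?n * y"
        using tc car nc by (simp add: A.square_simps)
      also have "\<dots> = \<beta> t u \<cdot>\<^sub>m (?x * (X t * ?n) * y)"
        unfolding com1 using tc car nc
        by (simp add: A.square_simps)
      also have "\<dots> = (\<beta> t u * \<chi> t) \<cdot>\<^sub>m (?x * ?n * (Y t * y))"
        unfolding pCons.IH using tc car nc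
        by (simp add: A.square_simps)
      also have "\<dots> = ((\<beta> t u * \<beta> t (inv u)) * \<chi> t) \<cdot>\<^sub>m ((?x * ?n * y) * Y t)"
        unfolding com2 using tc car nc
        by (simp add: A.square_simps ac_simps)
      finally have step: "X t * (?x * ?n * y) = \<chi> t \<cdot>\<^sub>m ((?x * ?n * y) * Y t)"
        using A.beta_inv[OF t u] by simp
      have n'c: "?x * ?n * y \<in> carrier_mat l l" using car nc by simp
      have "X t * (a \<cdot>\<^sub>m m + ?x * ?n * y) = a \<cdot>\<^sub>m (X t * m) + X t * (?x * ?n * y)"
        using tc m n'c
        by (simp add: mult_add_distrib_mat[of _ l l _ l] A.square_simps)
      also have "\<dots> = \<chi> t \<cdot>\<^sub>m (a \<cdot>\<^sub>m (m * Y t)) + \<chi> t \<cdot>\<^sub>m ((?x * ?n * y) * Y t)"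
        unfolding step \<chi>[OF that] by (simp add: A.square_simps mult.commute)
      also have "\<dots> = \<chi> t \<cdot>\<^sub>m (a \<cdot>\<^sub>m (m * Y t) + (?x * ?n * y) * Y t)"
        using tc m n'c by (intro add_smult_distrib_left_mat[symmetric]) auto
      also have "a \<cdot>\<^sub>m (m * Y t) + (?x * ?n * y) * Y t = (a \<cdot>\<^sub>m m + ?x * ?n * y) * Y t"
        using tc m n'c
        by (simp add: add_mult_distrib_mat[of _ l l _ _ l] A.square_simps)
      finally show ?case by (simp add: horner_pCons[OF car])
    qed
    obtain p where p: "p \<noteq> 0" "horner ?x y m p = 0\<^sub>m l l"
      using horner_annihilator_ex[OF u X(1)[OF u] y(1) m(1)] by blast
    obtain q c where q: "horner ?x y m q \<noteq> 0\<^sub>m l l"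
      "?x * horner ?x y m q * y = c \<cdot>\<^sub>m horner ?x y m q"
      using horner_eigenvector[OF car m(2) p] by blast
    let ?n = "horner ?x y m q"
    note nc = horner_carrier[OF car, of q]
    have "?x * ?n = ?x * ?n * (y * Y u)" using y nc car by simp
    also have "\<dots> = (?x * ?n * y) * Y u"
      using nc car Yc[OF u] by (simp add: A.square_simps)
    also have "\<dots> = c \<cdot>\<^sub>m (?n * Y u)"
      unfolding q(2) using nc Yc[OF u] by (simp add: A.square_simps)
    finally have "?x * ?n = c \<cdot>\<^sub>m (?n * Y u)" .
    then have "\<forall>t\<in>insert u F. X t * ?n = (\<chi>(u := c)) t \<cdot>\<^sub>m (?n * Y t)"
      using H insert.hyps by auto
    then show ?case using nc q(1) by blast
  qed
qed

text \<open>The kernel of a common eigenvector \<open>m\<close> is stable under all matrices, so \<open>m\<close> is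
  invertible; conjugation by it carries one division grading to the other.\<close>

theorem division_gradings_conjugate:
  obtains m m' where "m \<in> carrier_mat l l" "m' \<in> carrier_mat l l" "m * m' = 1\<^sub>m l" "m' * m = 1\<^sub>m l"
    "\<And>g x. g \<in> carrier G \<Longrightarrow> x \<in> D g \<Longrightarrow> m' * x * m \<in> D' g"
    "\<And>g y. g \<in> carrier G \<Longrightarrow> y \<in> D' g \<Longrightarrow> m * y * m' \<in> D g"
proof -
  have "\<forall>t\<in>T. \<exists>x. x \<in> D t \<and> x \<noteq> 0\<^sub>m l l" "\<forall>t\<in>T. \<exists>x. x \<in> D' t \<and> x \<noteq> 0\<^sub>m l l"
    using A.D_nonzero_ex B.D_nonzero_ex by metis+
  then obtain X Y where X: "\<And>t. t \<in> T \<Longrightarrow> X t \<in> D t" "\<And>t. t \<in> T \<Longrightarrow> X t \<noteq> 0\<^sub>m l l"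
    and Y: "\<And>t. t \<in> T \<Longrightarrow> Y t \<in> D' t" "\<And>t. t \<in> T \<Longrightarrow> Y t \<noteq> 0\<^sub>m l l"
    by metis
  have Xc: "X t \<in> carrier_mat l l" and Yc: "Y t \<in> carrier_mat l l" if "t \<in> T" for t
    using X(1)[OF that] Y(1)[OF that] A.D_carrier B.D_carrier that by auto
  obtain m \<chi> where m: "m \<in> carrier_mat l l" "m \<noteq> 0\<^sub>m l l"
    and \<chi>: "\<And>t. t \<in> T \<Longrightarrow> X t * m = \<chi> t \<cdot>\<^sub>m (m * Y t)"
    using common_eigenvector[OF X Y subset_refl] by blast
  have \<chi>0: "\<chi> t \<noteq> 0" if t: "t \<in> T" for t
  proof
    assume "\<chi> t = 0"
    then have "X t * m = 0\<^sub>m l l" using \<chi>[OF t] m Yc[OF t] by (simp add: zero_smult_mat[of _ l l])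
    then show False
      using A.D_mult_nonzero[OF _ X(1)[OF t] X(2)[OF t] m] t by simp
  qed
  have "det m \<noteq> 0"
  proof (rule det_nonzeroI[OF m(1)])
    fix v assume v: "v \<in> carrier_vec l" and mv: "m *\<^sub>v v = 0\<^sub>v l"
    \<comment> \<open>\<open>m Y\<^sub>t\<close> is a multiple of \<open>X\<^sub>t m\<close> and kills \<open>v\<close>; the \<open>Y\<^sub>t\<close> span all matrices.\<close>
    have ker: "m *\<^sub>v (a *\<^sub>v v) = 0\<^sub>v l" if "a \<in> carrier_mat l l" for a
      using that
    proof (induction a rule: B.D_induct)
      case zero
      have "0\<^sub>m l l *\<^sub>v v = 0\<^sub>v l" using v by (intro eq_vecI) auto
      then show ?case using m by (intro eq_vecI) auto
    next
      case (add a b)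
      have "m *\<^sub>v ((a + b) *\<^sub>v v) = m *\<^sub>v (a *\<^sub>v v) + m *\<^sub>v (b *\<^sub>v v)"
        using add m v
        by (simp add: add_mult_distrib_mat_vec[of _ l l] mult_add_distrib_mat_vec[of _ l l])
      then show ?case using add by simp
    next
      case (homogeneous t d)
      obtain c where d: "d = c \<cdot>\<^sub>m Y t"
        using B.D_multiple[OF homogeneous Y[OF homogeneous(1)]] by blast
      note Yt = Yc[OF homogeneous(1)] Xc[OF homogeneous(1)]
      have "m * Y t = (1 / \<chi> t) \<cdot>\<^sub>m (X t * m)"
        using \<chi>[OF homogeneous(1)] \<chi>0[OF homogeneous(1)]
        by (simp add: A.square_simps one_smult_mat)
      then have "m * d = (c / \<chi> t) \<cdot>\<^sub>m (X t * m)"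
        using m Yt by (simp add: d A.square_simps)
      moreover have "(X t * m) *\<^sub>v v = X t *\<^sub>v (m *\<^sub>v v)"
        by (rule assoc_mult_mat_vec[OF Yt(2) m(1) v])
      moreover have "X t *\<^sub>v 0\<^sub>v l = 0\<^sub>v l" using Yt(2) by (intro eq_vecI) auto
      ultimately have md: "m * d = (c / \<chi> t) \<cdot>\<^sub>m (X t * m)" and Xm: "(X t * m) *\<^sub>v v = 0\<^sub>v l"
        using mv by auto
      have dc: "d \<in> carrier_mat l l" using Yt d by simp
      have "m *\<^sub>v (d *\<^sub>v v) = (m * d) *\<^sub>v v" by (rule assoc_mult_mat_vec[OF m(1) dc v, symmetric])
      also have "\<dots> = (c / \<chi> t) \<cdot>\<^sub>v ((X t * m) *\<^sub>v v)"
        unfolding md using m Yt v by (intro smult_mat_mult_vec[of _ l l]) (auto simp: A.square_simps)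
      also have "\<dots> = 0\<^sub>v l" unfolding Xm by (intro eq_vecI) auto
      finally show ?case .
    qed
    show "v = 0\<^sub>v l"
    proof (rule ccontr)
      assume "v \<noteq> 0\<^sub>v l"
      then obtain b where b: "b < l" "v $ b \<noteq> 0" using v by (metis carrier_vecD eq_vecI index_zero_vec)
      have "m $$ (i, j) = 0" if ij: "i < l" "j < l" for i j
      proof -
        have "(matrix_unit l j b *\<^sub>v v) = v $ b \<cdot>\<^sub>v unit_vec l j"
          using b ij v
          by (intro eq_vecI)
            (auto simp: matrix_unit_def scalar_prod_def unit_vec_def sum.delta if_distrib[of "\<lambda>x. x * _"]
              cong: if_cong)
        then have "m *\<^sub>v (v $ b \<cdot>\<^sub>v unit_vec l j) = 0\<^sub>v l" using ker[of "matrix_unit l j b"] by simp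
        then have "(m *\<^sub>v (v $ b \<cdot>\<^sub>v unit_vec l j)) $ i = 0" using ij by simp
        then have "v $ b * m $$ (i, j) = 0"
          using ij m by (simp add: mult_mat_vec[OF m(1)] scalar_prod_right_unit)
        then show ?thesis using b by simp
      qed
      then have "m = 0\<^sub>m l l" using m by (intro eq_matI) auto
      with m show False by simp
    qed
  qed
  then obtain m' where m': "m' \<in> carrier_mat l l" "m * m' = 1\<^sub>m l" "m' * m = 1\<^sub>m l"
    using inverse_of_det_nonzero[OF m(1)] by blast
  have to: "m' * x * m \<in> D' g" if g: "g \<in> carrier G" and x: "x \<in> D g" for g x
  proof (cases "g \<in> T")
    case True
    obtain c where c: "x = c \<cdot>\<^sub>m X g" using A.D_multiple[OF True x X[OF True]] by blast
    note cc = Xc[OF True] Yc[OF True]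
    have "m' * x * m = c \<cdot>\<^sub>m (m' * (X g * m))"
      using m m' cc by (simp add: c A.square_simps)
    also have "\<dots> = (c * \<chi> g) \<cdot>\<^sub>m (m' * (m * Y g))"
      unfolding \<chi>[OF True] using m m' cc
      by (simp add: A.square_simps)
    also have "m' * (m * Y g) = Y g"
      using assoc_mult_mat[OF m'(1) m(1) cc(2)] m' cc by simp
    finally show ?thesis using B.D_smult Y True g by simp
  next
    case False
    then have "x = 0\<^sub>m l l" using A.D_support[OF g] x by simp
    then show ?thesis using m m' g by simp
  qed
  have fro: "m * y * m' \<in> D g" if g: "g \<in> carrier G" and y: "y \<in> D' g" for g y
  proof (cases "g \<in> T")
    case True
    obtain c where c: "y = c \<cdot>\<^sub>m Y g" using B.D_multiple[OF True y Y[OF True]] by blast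
    note cc = Xc[OF True] Yc[OF True]
    have mY: "m * Y g = (1 / \<chi> g) \<cdot>\<^sub>m (X g * m)"
      using \<chi>[OF True] \<chi>0[OF True] by (simp add: A.square_simps one_smult_mat)
    have "m * y * m' = c \<cdot>\<^sub>m ((m * Y g) * m')"
      using m m' cc by (simp add: c A.square_simps)
    also have "\<dots> = (c / \<chi> g) \<cdot>\<^sub>m (X g * m * m')"
      unfolding mY using m m' cc
      by (simp add: A.square_simps)
    also have "X g * m * m' = X g"
      using m m' cc by (simp add: A.square_simps)
    finally show ?thesis using A.D_smult X True g by simp
  next
    case False
    then have "y = 0\<^sub>m l l" using B.D_support[OF g] y by simp
    then show ?thesis using m m' g by simp
  qed
  show ?thesis using that[OF m(1) m' to fro] by blast
qed

end

section \<open>Gradings of block-triangular algebras\<close>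

lemma mat_subspace_hull: 
  assumes "s \<subseteq> carrier_mat n n"
  shows "mat_subspace n (mat_subspace n hull s)"
proof -
  have "mat_subspace n (carrier_mat n n)" by (auto simp: mat_subspace_def)
  then have "mat_subspace n hull s \<subseteq> carrier_mat n n" using assms by (rule hull_minimal[rotated])
  then show ?thesis by (auto simp: mat_subspace_def hull_def)
qed

text \<open>The list \<open>ks\<close> gives the sizes of the diagonal blocks of the triangular algebra in units of
  \<open>l\<close>; it partitions the tuple \<open>gs\<close>.\<close>

locale block_graded_algebra = division_algebra G T \<beta> l D
  for G :: "('g, 'b) monoid_scheme" (structure) and T and \<beta> :: "'g \<Rightarrow> 'g \<Rightarrow> 'f::field"
    and l D +
  fixes gs :: "'g list" and ks :: "nat list"
  assumes gs_carrier: "set gs \<subseteq> carrier G" and length_gs: "length gs = sum_list ks"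
begin

abbreviation "k \<equiv> length gs"
abbreviation "n \<equiv> k * l"
abbreviation "sizes \<equiv> map (\<lambda>m. m * l) ks"

definition component :: "'g \<Rightarrow> 'f mat set" where
  "component g = full_matrix_grading G gs l D g \<inter> UT sizes"

lemma sum_list_sizes: "sum_list sizes = n"
  by (simp add: sum_list_mult_const length_gs)

lemma gs_nth [simp]: "i < k \<Longrightarrow> gs ! i \<in> carrier G"
  using gs_carrier nth_mem by blast

text \<open>The blockwise description defines a subspace that contains the generators, and a matrix
  satisfying it is the sum of its blocks, each of which is zero or a generator.\<close>

lemma full_matrix_grading_iff:
  assumes g: "g \<in> carrier G"
  shows "a \<in> full_matrix_grading G gs l D g \<longleftrightarrow> a \<in> carrier_mat n n \<and>
    (\<forall>i<k. \<forall>j<k. block l a i j \<in> D (inv (gs ! i) \<otimes> g \<otimes> gs ! j))"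
    (is "a \<in> ?L \<longleftrightarrow> a \<in> carrier_mat n n \<and> ?P a")
proof -
  let ?R = "{a \<in> carrier_mat n n. ?P a}"
  let ?S = "{kronecker (matrix_unit k i j) d | i j d. i < k \<and> j < k \<and>
    (\<exists>t\<in>carrier G. d \<in> D t \<and> d \<noteq> 0\<^sub>m l l \<and> g = gs ! i \<otimes> t \<otimes> inv (gs ! j))}"
  have L: "?L = mat_subspace n hull ?S" by (simp add: full_matrix_grading_def)
  have deg: "inv (gs ! i) \<otimes> g \<otimes> gs ! j \<in> carrier G" if "i < k" "j < k" for i j
    using that g by simp
  have SR: "?S \<subseteq> ?R"
  proof
    fix a assume "a \<in> ?S"
    then obtain i j d t where ij: "i < k" "j < k" and t: "t \<in> carrier G" "d \<in> D t"
      and g: "g = gs ! i \<otimes> t \<otimes> inv (gs ! j)" and a: "a = kronecker (matrix_unit k i j) d" by auto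
    have d: "d \<in> carrier_mat l l" using D_carrier t by blast
    have "inv (gs ! i) \<otimes> g \<otimes> gs ! j = t"
      using ij t by (simp add: g m_assoc[symmetric] inv_solve_left)
        (simp add: m_assoc)
    then show "a \<in> ?R" unfolding a kronecker_matrix_unit[OF d]
      using t d deg by (auto simp: block_single_block)
  qed
  have "mat_subspace n ?R"
    unfolding mat_subspace_def
    by (auto simp: block_zero block_add block_smult deg intro!: D_add D_smult)
  then have "?L \<subseteq> ?R" unfolding L using SR by (intro hull_minimal)
  moreover have "?R \<subseteq> ?L"
  proof
    fix a assume a: "a \<in> ?R"
    have "?S \<subseteq> carrier_mat n n" using SR by blast
    note sub = mat_subspace_hull[OF this]
    define part where
      "part F = from_blocks k l (\<lambda>i j. if (i, j) \<in> F then block l a i j else 0\<^sub>m l l)" for F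
    have blk: "block l (part F) i j = (if (i, j) \<in> F then block l a i j else 0\<^sub>m l l)"
      if "i < k" "j < k" for i j F
      unfolding part_def using that by (subst block_from_blocks) auto
    have pc: "part F \<in> carrier_mat n n" for F by (simp add: part_def)
    have "part F \<in> mat_subspace n hull ?S" if "finite F" "F \<subseteq> {..<k} \<times> {..<k}" for F
      using that
    proof (induction F rule: finite_induct)
      case empty
      have "part {} = 0\<^sub>m n n"
        by (rule eq_blocksI[OF pc]) (auto simp: blk block_zero)
      then show ?case using mat_subspaceD(2)[OF sub] by simp
    next
      case (insert x F)
      obtain i j where x: "x = (i, j)" by (cases x)
      have ij: "i < k" "j < k" using insert.prems x by auto
      let ?d = "block l a i j"
      have split: "part (insert x F) = single_block k l i j ?d + part F"
        using insert.hyps x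
        by (intro eq_blocksI[OF pc])
          (auto simp: blk block_add[OF single_block_carrier pc] block_single_block pc
            intro!: right_add_zero_mat[symmetric] left_add_zero_mat[symmetric] add_carrier_mat)
      show ?case
      proof (cases "?d = 0\<^sub>m l l")
        case True
        then have "part (insert x F) = part F"
          using x by (intro eq_blocksI[OF pc pc]) (auto simp: blk)
        then show ?thesis using insert by simp
      next
        case False
        let ?t = "inv (gs ! i) \<otimes> g \<otimes> gs ! j"
        have "g = gs ! i \<otimes> ?t \<otimes> inv (gs ! j)"
          using ij g by (simp add: m_assoc[symmetric]) (simp add: m_assoc)
        moreover have "?d \<in> D ?t" using a ij by blast
        ultimately have "kronecker (matrix_unit k i j) ?d \<in> ?S"
          using ij False deg[OF ij] by blast
        then have "single_block k l i j ?d \<in> ?S"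
          by (simp only: kronecker_matrix_unit[OF block_carrier])
        then have "single_block k l i j ?d \<in> mat_subspace n hull ?S" by (rule hull_inc)
        then show ?thesis
          unfolding split using insert by (intro mat_subspaceD(3)[OF sub]) auto
      qed
    qed
    from this[of "{..<k} \<times> {..<k}"] have "part ({..<k} \<times> {..<k}) \<in> mat_subspace n hull ?S" by simp
    moreover have "part ({..<k} \<times> {..<k}) = a"
      using a by (intro eq_blocksI[OF pc]) (auto simp: blk)
    ultimately show "a \<in> ?L" by (simp add: L)
  qed
  ultimately show ?thesis by blast
qed

lemma UT_sizes_iff:
  "a \<in> UT sizes \<longleftrightarrow> a \<in> carrier_mat n n \<and>
    (\<forall>i<k. \<forall>j<k. block_index ks j < block_index ks i \<longrightarrow> block l a i j = 0\<^sub>m l l)"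
  using UT_iff_blocks[OF l_pos, of a ks] by (simp add: length_gs)

lemma component_iff:
  assumes g: "g \<in> carrier G"
  shows "a \<in> component g \<longleftrightarrow> a \<in> UT sizes \<and>
    (\<forall>i<k. \<forall>j<k. block l a i j \<in> D (inv (gs ! i) \<otimes> g \<otimes> gs ! j))"
  unfolding component_def using full_matrix_grading_iff[OF g] UT_sizes_iff by blast

lemma inv_mult_conj: "i < k \<Longrightarrow> t \<in> carrier G \<Longrightarrow> inv (gs ! i) \<otimes> t \<otimes> gs ! i = t"
  by (metis gs_nth inv_closed l_inv m_assoc m_comm r_one)

lemma single_block_component:
  assumes ij: "i < k" "j < k" "block_index ks i \<le> block_index ks j"
    and t: "t \<in> carrier G" and d: "d \<in> D t"
  shows "single_block k l i j d \<in> component (gs ! i \<otimes> t \<otimes> inv (gs ! j))"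
proof -
  have dc: "d \<in> carrier_mat l l" using D_carrier d t by blast
  have "inv (gs ! i) \<otimes> (gs ! i \<otimes> t \<otimes> inv (gs ! j)) \<otimes> gs ! j = t"
    using ij t by (simp add: m_assoc[symmetric]) (simp add: m_assoc)
  then show ?thesis
    using ij t d by (auto simp: component_iff UT_sizes_iff block_single_block[OF _ _ dc])
qed

text \<open>Up to rescaling the diagonal blocks suitably, \<open>1 \<otimes> X\<^sub>t\<close> is homogeneous of degree \<open>t\<close> and
  centralizes the component of degree \<open>\<one>\<close>. The scalar in block \<open>i\<close> compensates for the
  position of \<open>gs ! i\<close> in its coset.\<close>

lemma centralizing_elements:
  obtains Z where "\<And>t. t \<in> T \<Longrightarrow> Z t \<in> component t"
    "\<And>t e. t \<in> T \<Longrightarrow> e \<in> component \<one> \<Longrightarrow> Z t * e = e * Z t"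
    "\<And>t y. t \<in> T \<Longrightarrow> y \<in> carrier_mat n n \<Longrightarrow> Z t * y = 0\<^sub>m n n \<Longrightarrow> y = 0\<^sub>m n n"
    "\<And>u v. u \<in> T \<Longrightarrow> v \<in> T \<Longrightarrow> Z u * Z v = \<beta> u v \<cdot>\<^sub>m (Z v * Z u)"
proof -
  have "\<forall>t\<in>T. \<exists>x. x \<in> D t \<and> x \<noteq> 0\<^sub>m l l" using D_nonzero_ex by metis
  then obtain X where X: "\<And>t. t \<in> T \<Longrightarrow> X t \<in> D t" "\<And>t. t \<in> T \<Longrightarrow> X t \<noteq> 0\<^sub>m l l" by metis
  have Xc: "X t \<in> carrier_mat l l" if "t \<in> T" for t using X(1)[OF that] D_carrier that by simp
  \<comment> \<open>\<open>\<tau> i\<close> is the position of \<open>gs ! i\<close> relative to a representative of its coset that depends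
    on the coset only.\<close>
  define rep where "rep i = (SOME r. r \<in> T #> gs ! i)" for i
  have rep: "rep i \<in> T #> gs ! i" if "i < k" for i
    unfolding rep_def
    by (rule someI[of _ "gs ! i"]) (use rcos_self[OF _ subgroup_T] that in simp)
  define \<tau> where "\<tau> i = inv (rep i) \<otimes> gs ! i" for i
  have \<tau>: "\<tau> i \<in> T" if i: "i < k" for i
  proof -
    obtain s where s: "s \<in> T" "rep i = s \<otimes> gs ! i" using rep[OF i] by (auto simp: r_coset_def)
    have "\<tau> i = inv s"
      using s i by (simp add: \<tau>_def inv_mult m_assoc)
    then show ?thesis using s by simp
  qed
  have shift: "\<tau> j = \<tau> i \<otimes> (inv (gs ! i) \<otimes> gs ! j)"
    if ij: "i < k" "j < k" and u: "inv (gs ! i) \<otimes> gs ! j \<in> T" for i j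
  proof -
    have gj: "gs ! j = (inv (gs ! i) \<otimes> gs ! j) \<otimes> gs ! i"
      using ij by (metis gs_nth inv_closed m_assoc m_comm r_inv r_one)
    have "T #> (inv (gs ! i) \<otimes> gs ! j) #> gs ! i = T #> ((inv (gs ! i) \<otimes> gs ! j) \<otimes> gs ! i)"
      using ij by (intro coset_mult_assoc subgroup.subset[OF subgroup_T]) auto
    moreover have "T #> (inv (gs ! i) \<otimes> gs ! j) = T"
      using u by (intro coset_join2[OF _ subgroup_T]) auto
    ultimately have "T #> gs ! j = T #> gs ! i" using gj by simp
    then have "rep j = rep i" by (simp add: rep_def)
    moreover have "rep i \<in> carrier G"
      using rep[OF ij(1)] r_coset_subset_G[OF subgroup.subset[OF subgroup_T] gs_nth[OF ij(1)]]
      by blast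
    ultimately show ?thesis
      using ij by (simp add: \<tau>_def m_assoc) (simp add: m_assoc[symmetric])
  qed
  define Z where
    "Z t = from_blocks k l (\<lambda>i j. if i = j then \<beta> t (\<tau> i) \<cdot>\<^sub>m X t else 0\<^sub>m l l)" for t
  have Zc: "Z t \<in> carrier_mat n n" for t by (simp add: Z_def)
  have blk: "block l (Z t) i j = (if i = j then \<beta> t (\<tau> i) \<cdot>\<^sub>m X t else 0\<^sub>m l l)"
    if "t \<in> T" "i < k" "j < k" for t i j
    unfolding Z_def using that Xc by (subst block_from_blocks) auto
  have blk_left: "block l (Z t * y) i j = (\<beta> t (\<tau> i) \<cdot>\<^sub>m X t) * block l y i j"
    if "t \<in> T" "i < k" "j < k" "y \<in> carrier_mat n n" for t y i j
    using that by (subst block_mult_only[OF Zc, of _ i j i]) (auto simp: blk)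
  have blk_right: "block l (y * Z t) i j = block l y i j * (\<beta> t (\<tau> j) \<cdot>\<^sub>m X t)"
    if "t \<in> T" "i < k" "j < k" "y \<in> carrier_mat n n" for t y i j
    using that by (subst block_mult_only[OF _ Zc, of _ i j j]) (auto simp: blk)
  show ?thesis
  proof
    fix t assume t: "t \<in> T"
    show "Z t \<in> component t"
      using t X D_smult by (auto simp: component_iff UT_sizes_iff Zc blk inv_mult_conj)
    show "Z t * e = e * Z t" if e: "e \<in> component \<one>" for e
    proof (rule eq_blocksI)
      have ec: "e \<in> carrier_mat n n" using e by (simp add: component_iff UT_sizes_iff)
      show "Z t * e \<in> carrier_mat n n" "e * Z t \<in> carrier_mat n n"
        using mult_carrier_mat[OF Zc ec] mult_carrier_mat[OF ec Zc] .
      fix i j assume ij: "i < k" "j < k"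
      let ?u = "inv (gs ! i) \<otimes> gs ! j" and ?e = "block l e i j"
      have eD: "?e \<in> D ?u" using e ij by (simp add: component_iff)
      show "block l (Z t * e) i j = block l (e * Z t) i j"
      proof (cases "?u \<in> T")
        case True
        have "?e * X t = \<beta> ?u t \<cdot>\<^sub>m (X t * ?e)" by (rule D_commute[OF True t eD X(1)[OF t]])
        moreover have "\<beta> t (\<tau> j) * \<beta> ?u t = \<beta> t (\<tau> i) * (\<beta> t ?u * \<beta> ?u t)"
          unfolding shift[OF ij True] using t True \<tau>[OF ij(1)]
          by (simp add: beta_mult_right mult_ac)
        ultimately show ?thesis
          unfolding blk_left[OF t ij ec] blk_right[OF t ij ec] using Xc[OF t] beta_skew[OF t True]
          by (simp add: mult_smult_assoc_mat[of _ l l _ l] mult_smult_distrib[of _ l l _ l]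
              smult_smult_mat)
      next
        case False
        then have "?e = 0\<^sub>m l l" using eD D_support[of ?u] ij by simp
        then show ?thesis
          unfolding blk_left[OF t ij ec] blk_right[OF t ij ec] using Xc[OF t] by simp
      qed
    qed
    show "y = 0\<^sub>m n n" if y: "y \<in> carrier_mat n n" and Zy: "Z t * y = 0\<^sub>m n n" for y
    proof (rule eq_blocksI[OF y])
      fix i j assume ij: "i < k" "j < k"
      have bx: "\<beta> t (\<tau> i) \<cdot>\<^sub>m X t \<in> D t" using D_smult X t by simp
      have bx0: "\<beta> t (\<tau> i) \<cdot>\<^sub>m X t \<noteq> 0\<^sub>m l l"
        using smult_nonzero_mat[OF Xc X(2)] t beta_nonzero \<tau> ij by simp
      have "(\<beta> t (\<tau> i) \<cdot>\<^sub>m X t) * block l y i j = 0\<^sub>m l l"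
        using blk_left[OF t ij y] unfolding Zy block_zero[OF ij] by (rule sym)
      then show "block l y i j = block l (0\<^sub>m n n) i j"
        using D_mult_nonzero[OF _ bx bx0, of "block l y i j" l] t by (auto simp: block_zero[OF ij])
    qed auto
  next
    fix u v assume uv: "u \<in> T" "v \<in> T"
    show "Z u * Z v = \<beta> u v \<cdot>\<^sub>m (Z v * Z u)"
    proof (rule eq_blocksI)
      show "Z u * Z v \<in> carrier_mat n n" "\<beta> u v \<cdot>\<^sub>m (Z v * Z u) \<in> carrier_mat n n"
        using mult_carrier_mat[OF Zc Zc] by auto
      fix i j assume ij: "i < k" "j < k"
      have ZZ: "Z v * Z u \<in> carrier_mat n n" using mult_carrier_mat[OF Zc Zc] .
      have com: "(\<beta> u (\<tau> i) \<cdot>\<^sub>m X u) * (\<beta> v (\<tau> i) \<cdot>\<^sub>m X v) =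
          \<beta> u v \<cdot>\<^sub>m ((\<beta> v (\<tau> i) \<cdot>\<^sub>m X v) * (\<beta> u (\<tau> i) \<cdot>\<^sub>m X u))"
        using uv X D_smult by (intro D_commute) auto
      show "block l (Z u * Z v) i j = block l (\<beta> u v \<cdot>\<^sub>m (Z v * Z u)) i j"
        using ij uv Xc com
        by (auto simp: block_smult[OF ZZ] blk_left[OF _ _ _ Zc] blk right_mult_zero_mat[of _ l l l])
    qed
  qed
qed

end

lemma algebra_automorphismD:
  assumes "algebra_automorphism A \<phi>"
  shows "bij_betw \<phi> A A" "x \<in> A \<Longrightarrow> y \<in> A \<Longrightarrow> \<phi> (x + y) = \<phi> x + \<phi> y"
    "x \<in> A \<Longrightarrow> \<phi> (c \<cdot>\<^sub>m x) = c \<cdot>\<^sub>m \<phi> x" "x \<in> A \<Longrightarrow> y \<in> A \<Longrightarrow> \<phi> (x * y) = \<phi> x * \<phi> y"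
    "x \<in> A \<Longrightarrow> \<phi> x \<in> A" "x \<in> A \<Longrightarrow> y \<in> A \<Longrightarrow> \<phi> x = \<phi> y \<Longrightarrow> x = y"
  using assms by (auto simp: algebra_automorphism_def bij_betw_def inj_on_def)

lemma UT_automorphism_zero:
  assumes "algebra_automorphism (UT ns) \<phi>"
  shows "\<phi> (0\<^sub>m (sum_list ns) (sum_list ns)) = 0\<^sub>m (sum_list ns) (sum_list ns)"
proof -
  let ?z = "0\<^sub>m (sum_list ns) (sum_list ns)"
  have z: "\<phi> ?z \<in> carrier_mat (sum_list ns) (sum_list ns)"
    using algebra_automorphismD(5)[OF assms UT_zero] by (rule UT_carrier)
  have "\<phi> ?z = \<phi> (0 \<cdot>\<^sub>m ?z)" by (simp add: zero_smult_mat[of _ "sum_list ns" "sum_list ns"])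
  also have "\<dots> = ?z"
    unfolding algebra_automorphismD(3)[OF assms UT_zero] by (rule zero_smult_mat[OF z])
  finally show ?thesis .
qed

text \<open>The preimage \<open>a\<close> of a centralizing element of degree \<open>t\<close> commutes with the block
  idempotents, hence is block diagonal; its first diagonal block is a nonzero
  element of degree \<open>t\<close>, and these blocks obey the commutation relations of both bicharacters.\<close>

lemma support_and_bicharacter_determined:
  fixes G :: "('g, 'b) monoid_scheme" (structure) and \<beta> \<beta>' :: "'g \<Rightarrow> 'g \<Rightarrow> 'f::field"
  assumes A: "block_graded_algebra G T \<beta> l D gs ks"
    and B: "block_graded_algebra G T' \<beta>' l' D' gs' ks'"
    and sizes: "map (\<lambda>m. m * l) ks = map (\<lambda>m. m * l') ks'"
    and nonempty: "length gs > 0"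
    and aut: "algebra_automorphism (UT (map (\<lambda>m. m * l) ks)) \<phi>"
    and iso: "\<And>g. g \<in> carrier G \<Longrightarrow> \<phi> ` block_graded_algebra.component G l D gs ks g =
      block_graded_algebra.component G l' D' gs' ks' g"
  shows "T' \<subseteq> T \<and> (\<forall>u\<in>T'. \<forall>v\<in>T'. \<beta>' u v = \<beta> u v)"
proof -
  interpret A: block_graded_algebra G T \<beta> l D gs ks by (rule A)
  interpret B: block_graded_algebra G T' \<beta>' l' D' gs' ks' by (rule B)
  let ?A = "UT A.sizes"
  have n: "B.n = A.n" using A.sum_list_sizes B.sum_list_sizes sizes by simp
  note phi = algebra_automorphismD[OF aut]
  have zero: "\<phi> (0\<^sub>m A.n A.n) = 0\<^sub>m A.n A.n" "0\<^sub>m A.n A.n \<in> ?A"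
    using UT_automorphism_zero[OF aut] UT_zero[of A.sizes] by (simp_all add: A.sum_list_sizes)
  have comp_UT: "a \<in> ?A" if "a \<in> A.component g" for a g
    using that by (simp add: A.component_def)
  have car: "a \<in> carrier_mat A.n A.n" if "a \<in> ?A" for a
    using that by (simp add: A.UT_sizes_iff)
  obtain Z where "\<And>t. t \<in> T' \<Longrightarrow> Z t \<in> B.component t"
    "\<And>t e. t \<in> T' \<Longrightarrow> e \<in> B.component \<one> \<Longrightarrow> Z t * e = e * Z t"
    "\<And>t y. t \<in> T' \<Longrightarrow> y \<in> carrier_mat B.n B.n \<Longrightarrow> Z t * y = 0\<^sub>m B.n B.n \<Longrightarrow> y = 0\<^sub>m B.n B.n"
    "\<And>u v. u \<in> T' \<Longrightarrow> v \<in> T' \<Longrightarrow> Z u * Z v = \<beta>' u v \<cdot>\<^sub>m (Z v * Z u)"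
    using B.centralizing_elements by blast
  note Z = this[unfolded n]
  have "\<forall>t\<in>T'. \<exists>a. a \<in> A.component t \<and> \<phi> a = Z t"
  proof
    fix t assume t: "t \<in> T'"
    have "Z t \<in> \<phi> ` A.component t"
      unfolding iso[OF B.T_carrier[OF t]] by (rule Z(1)[OF t])
    then obtain a where "Z t = \<phi> a" "a \<in> A.component t" by (rule imageE)
    then show "\<exists>a. a \<in> A.component t \<and> \<phi> a = Z t" by (intro exI[of _ a]) simp
  qed
  then have "\<exists>a. \<forall>t\<in>T'. a t \<in> A.component t \<and> \<phi> (a t) = Z t" by (rule bchoice)
  then obtain a where "\<forall>t\<in>T'. a t \<in> A.component t \<and> \<phi> (a t) = Z t" by (rule exE)
  then have a: "a t \<in> A.component t" "\<phi> (a t) = Z t" if "t \<in> T'" for t using that by auto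
  have aA: "a t \<in> ?A" and ac: "a t \<in> carrier_mat A.n A.n" if "t \<in> T'" for t
    using comp_UT[OF a(1)[OF that]] car by auto
  define \<epsilon> where "\<epsilon> i = single_block A.k l i i (1\<^sub>m l :: 'f mat)" for i
  have \<epsilon>: "\<epsilon> i \<in> A.component \<one>" if "i < A.k" for i
    using A.single_block_component[OF that that order_refl A.one_closed A.D_one] that
    by (simp add: \<epsilon>_def A.r_inv)
  have \<epsilon>A: "\<epsilon> i \<in> ?A" if "i < A.k" for i using comp_UT[OF \<epsilon>[OF that]] .
  have \<epsilon>c: "\<epsilon> i \<in> carrier_mat A.n A.n" for i by (simp add: \<epsilon>_def)
  have blk\<epsilon>: "block l (\<epsilon> i) p q = (if p = i \<and> q = i then 1\<^sub>m l else 0\<^sub>m l l)"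
    if "p < A.k" "q < A.k" for i p q
    unfolding \<epsilon>_def using that by (simp add: block_single_block)
  have com: "a t * \<epsilon> i = \<epsilon> i * a t" if "t \<in> T'" "i < A.k" for t i
  proof -
    note aAt = aA[OF that(1)] and \<epsilon>Ai = \<epsilon>A[OF that(2)]
    have "\<phi> (\<epsilon> i) \<in> B.component \<one>"
      using imageI[OF \<epsilon>[OF that(2)], of \<phi>] unfolding iso[OF A.one_closed] .
    then have "Z t * \<phi> (\<epsilon> i) = \<phi> (\<epsilon> i) * Z t" by (rule Z(2)[OF that(1)])
    then have "\<phi> (a t * \<epsilon> i) = \<phi> (\<epsilon> i * a t)"
      unfolding phi(4)[OF aAt \<epsilon>Ai] phi(4)[OF \<epsilon>Ai aAt] a(2)[OF that(1)] .
    then show ?thesis by (rule phi(6)[OF UT_mult[OF aAt \<epsilon>Ai] UT_mult[OF \<epsilon>Ai aAt]])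
  qed
  have off: "block l (a t) j i = 0\<^sub>m l l"
    if "t \<in> T'" "i < A.k" "j < A.k" "j \<noteq> i" for t i j
  proof -
    have "block l (a t * \<epsilon> i) j i = block l (a t) j i * block l (\<epsilon> i) i i"
      using that ac \<epsilon>c by (intro block_mult_only) (auto simp: blk\<epsilon>)
    also have "\<dots> = block l (a t) j i"
      using that by (simp add: blk\<epsilon> right_mult_one_mat[of _ l l])
    finally have "block l (a t) j i = block l (\<epsilon> i * a t) j i" using com that by simp
    also have "\<dots> = 0\<^sub>m l l"
      using that ac \<epsilon>c by (intro block_mult_zero) (auto simp: blk\<epsilon>)
    finally show ?thesis .
  qed
  let ?b = "\<lambda>t. block l (a t) 0 0"
  have b0: "?b t \<noteq> 0\<^sub>m l l" if t: "t \<in> T'" for t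
  proof
    assume z: "?b t = 0\<^sub>m l l"
    have "a t * \<epsilon> 0 = 0\<^sub>m A.n A.n"
    proof (rule eq_blocksI)
      fix i j assume ij: "i < A.k" "j < A.k"
      have "block l (a t * \<epsilon> 0) i j = 0\<^sub>m l l"
        using ij z off[OF t, of 0 i] nonempty
        by (intro block_mult_zero[OF ac[OF t] \<epsilon>c ij]) (auto simp: blk\<epsilon>)
      then show "block l (a t * \<epsilon> 0) i j = block l (0\<^sub>m A.n A.n) i j"
        by (simp add: block_zero[OF ij])
    qed (use mult_carrier_mat[OF ac[OF t] \<epsilon>c[of 0]] in auto)
    then have "Z t * \<phi> (\<epsilon> 0) = 0\<^sub>m A.n A.n"
      using phi(4)[OF aA[OF t] \<epsilon>A[OF nonempty]] zero a(2)[OF t] by simp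
    then have "\<phi> (\<epsilon> 0) = \<phi> (0\<^sub>m A.n A.n)"
      using Z(3)[OF t car[OF phi(5)[OF \<epsilon>A[OF nonempty]]]] zero by simp
    then have "\<epsilon> 0 = 0\<^sub>m A.n A.n" using phi(6) \<epsilon>A[OF nonempty] zero by blast
    then have "1\<^sub>m l = (0\<^sub>m l l :: 'f mat)"
      using blk\<epsilon>[OF nonempty nonempty, of 0] block_zero[OF nonempty nonempty, of l] by metis
    then show False using A.one_mat_nonzero by simp
  qed
  have bD: "?b t \<in> D t" if "t \<in> T'" for t
  proof -
    have "?b t \<in> D (inv (gs ! 0) \<otimes> t \<otimes> gs ! 0)"
      using a(1)[OF that] nonempty unfolding A.component_iff[OF B.T_carrier[OF that]] by blast
    then show ?thesis by (simp only: A.inv_mult_conj[OF nonempty B.T_carrier[OF that]])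
  qed
  have sub: "t \<in> T" if "t \<in> T'" for t
    using bD[OF that] b0[OF that] A.D_support[of t] B.T_carrier[OF that] by blast
  have "\<beta>' u v = \<beta> u v" if uv: "u \<in> T'" "v \<in> T'" for u v
  proof -
    note uA = aA[OF uv(1)] and vA = aA[OF uv(2)]
    have "\<phi> (a u * a v) = \<phi> (\<beta>' u v \<cdot>\<^sub>m (a v * a u))"
      unfolding phi(3)[OF UT_mult[OF vA uA]] phi(4)[OF uA vA] phi(4)[OF vA uA]
        a(2)[OF uv(1)] a(2)[OF uv(2)] by (rule Z(4)[OF uv])
    then have eq: "a u * a v = \<beta>' u v \<cdot>\<^sub>m (a v * a u)"
      by (rule phi(6)[OF UT_mult[OF uA vA] UT_smult[OF UT_mult[OF vA uA]]])
    have prod: "block l (a s * a t) 0 0 = ?b s * ?b t" if "s \<in> T'" "t \<in> T'" for s t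
      using that nonempty ac off by (intro block_mult_only) auto
    have c: "a v * a u \<in> carrier_mat A.n A.n" using mult_carrier_mat[OF ac ac] uv by blast
    have "\<beta>' u v \<cdot>\<^sub>m (?b v * ?b u) = \<beta> u v \<cdot>\<^sub>m (?b v * ?b u)"
      using A.D_commute[OF sub[OF uv(1)] sub[OF uv(2)] bD[OF uv(1)] bD[OF uv(2)]]
      unfolding prod[OF uv, symmetric] prod[OF uv(2,1), symmetric] eq
        block_smult[OF c nonempty nonempty] .
    moreover have "?b v * ?b u \<noteq> 0\<^sub>m l l"
      using A.D_mult_nonzero[OF _ bD[OF uv(2)] b0[OF uv(2)] _ b0[OF uv(1)]] B.T_carrier uv by simp
    ultimately show ?thesis
      by (rule smult_cancel_mat[OF _ mult_carrier_mat[OF block_carrier block_carrier]])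
  qed
  with sub show ?thesis by blast
qed

section \<open>Automorphisms of block-triangular algebras\<close>

text \<open>With \<open>m\<close> the last index, column \<open>i\<close> of the conjugating matrix is column \<open>c\<close> of
  \<open>\<phi> E\<^sub>i\<^sub>m\<close>. If \<open>c\<close> is chosen with \<open>\<phi> E\<^sub>0\<^sub>m\<close> nonzero in column \<open>c\<close>, the kernel of
  this matrix is an invariant subspace that does not contain the first basis vector, hence zero.\<close>

lemma UT_automorphism_conjugation:
  fixes \<phi> :: "'f::field mat \<Rightarrow> 'f mat"
  assumes aut: "algebra_automorphism (UT ns) \<phi>" and pos: "sum_list ns > 0"
  obtains P P' where "P \<in> carrier_mat (sum_list ns) (sum_list ns)"
    "P' \<in> carrier_mat (sum_list ns) (sum_list ns)"
    "P * P' = 1\<^sub>m (sum_list ns)" "P' * P = 1\<^sub>m (sum_list ns)"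
    "\<And>a. a \<in> UT ns \<Longrightarrow> \<phi> a * P = P * a"
proof -
  define n where "n = sum_list ns"
  define m where "m = n - 1"
  note phi = algebra_automorphismD[OF aut]
  let ?U = "\<lambda>i j. matrix_unit n i j :: 'f mat"
  have m: "m < n" using pos by (simp add: m_def n_def)
  have U_UT: "?U i m \<in> UT ns" if "i < n" for i
    using that unfolding n_def
    by (intro matrix_unit_UT block_index_mono) (auto simp: m_def n_def)
  have U0_UT: "?U 0 j \<in> UT ns" for j
    unfolding n_def by (intro matrix_unit_UT block_index_mono) auto
  have car: "a \<in> carrier_mat n n" if "a \<in> UT ns" for a :: "'f mat"
    using UT_carrier[OF that] by (simp add: n_def)
  have phi0: "\<phi> (0\<^sub>m n n) = 0\<^sub>m n n" using UT_automorphism_zero[OF aut] by (simp add: n_def)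
  have z_UT: "0\<^sub>m n n \<in> (UT ns :: 'f mat set)" unfolding n_def by (rule UT_zero)
  have n0: "0 < n" using m by simp
  have "\<exists>r c. r < n \<and> c < n \<and> \<phi> (?U 0 m) $$ (r, c) \<noteq> 0"
  proof (rule ccontr)
    assume "\<not> ?thesis"
    then have "\<phi> (?U 0 m) = 0\<^sub>m n n"
      using car[OF phi(5)[OF U_UT[OF n0]]] by (intro eq_matI) auto
    then have "?U 0 m = 0\<^sub>m n n" using phi(6)[OF U_UT[OF n0] z_UT] phi0 by simp
    then have "?U 0 m $$ (0, m) = 0" using m by simp
    then show False using m by (simp add: matrix_unit_def)
  qed
  then obtain r0 c where r0: "r0 < n" and c: "c < n" and rc: "\<phi> (?U 0 m) $$ (r0, c) \<noteq> 0" by blast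
  define P where "P = mat n n (\<lambda>(r, i). \<phi> (?U i m) $$ (r, c))"
  have Pc: "P \<in> carrier_mat n n" by (simp add: P_def)
  have inter: "\<phi> a * P = P * a" if a: "a \<in> UT ns" for a
    using a
  proof (induction a rule: UT_induct)
    case zero
    have "\<phi> (0\<^sub>m n n) * P = P * 0\<^sub>m n n" unfolding phi0 using Pc by simp
    then show ?case by (simp add: n_def)
  next
    case (add x y)
    note xc = car[OF add.hyps(1)] car[OF add.hyps(2)]
    note pc = car[OF phi(5)[OF add.hyps(1)]] car[OF phi(5)[OF add.hyps(2)]]
    have "\<phi> (x + y) * P = \<phi> x * P + \<phi> y * P"
      unfolding phi(2)[OF add.hyps(1,2)] by (rule add_mult_distrib_mat[OF pc Pc])
    also have "\<dots> = P * (x + y)"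
      unfolding add.IH by (rule mult_add_distrib_mat[OF Pc xc, symmetric])
    finally show ?case .
  next
    case (unit d s t)
    let ?u = "?U s t"
    have st: "s < n" "t < n" using unit by (auto simp: n_def)
    have u: "?u \<in> UT ns" using unit unfolding n_def by (intro matrix_unit_UT)
    have "(\<phi> ?u * P) $$ (r, i) = (P * ?u) $$ (r, i)" if ri: "r < n" "i < n" for r i
    proof -
      note Ui = U_UT[OF ri(2)]
      have "(\<phi> ?u * P) $$ (r, i) = (\<Sum>q<n. \<phi> ?u $$ (r, q) * \<phi> (?U i m) $$ (q, c))"
        unfolding index_mult_mat_sum[OF car[OF phi(5)[OF u]] Pc ri]
        using ri by (intro sum.cong) (auto simp: P_def)
      also have "\<dots> = (\<phi> ?u * \<phi> (?U i m)) $$ (r, c)"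
        by (rule index_mult_mat_sum[OF car[OF phi(5)[OF u]] car[OF phi(5)[OF Ui]] ri(1) c, symmetric])
      also have "\<phi> ?u * \<phi> (?U i m) = \<phi> (?u * ?U i m)" by (rule phi(4)[OF u Ui, symmetric])
      also have "?u * ?U i m = (if t = i then ?U s m else 0\<^sub>m n n)"
        by (rule matrix_unit_mult[OF st(2) ri(2)])
      also have "\<phi> \<dots> $$ (r, c) = (if t = i then P $$ (r, s) else 0)"
        using phi0 ri st c by (auto simp: P_def)
      also have "\<dots> = (P * ?u) $$ (r, i)"
        unfolding mult_matrix_unit_index[OF Pc ri st] by simp
      finally show ?thesis .
    qed
    then have "\<phi> ?u * P = P * ?u"
      using car[OF phi(5)[OF u]] Pc by (intro eq_matI) (auto simp: matrix_unit_def)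
    then have "\<phi> (d \<cdot>\<^sub>m ?u) * P = P * (d \<cdot>\<^sub>m ?u)"
      unfolding phi(3)[OF u] mult_smult_assoc_mat[OF car[OF phi(5)[OF u]] Pc]
        mult_smult_distrib[OF Pc car[OF u]] by simp
    then show ?case by (simp add: n_def)
  qed
  have "det P \<noteq> 0"
  proof (rule det_nonzeroI[OF Pc])
    fix v assume v: "v \<in> carrier_vec n" and Pv: "P *\<^sub>v v = 0\<^sub>v n"
    have "v $ j = 0" if j: "j < n" for j
    proof -
      have "(P * ?U 0 j) *\<^sub>v v = \<phi> (?U 0 j) *\<^sub>v (P *\<^sub>v v)"
        unfolding inter[OF U0_UT, symmetric]
        by (rule assoc_mult_mat_vec[OF car[OF phi(5)[OF U0_UT]] Pc v])
      also have "\<dots> = 0\<^sub>v n"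
        unfolding Pv using car[OF phi(5)[OF U0_UT[of j]]] by (intro eq_vecI) auto
      finally have "((P * ?U 0 j) *\<^sub>v v) $ r0 = 0" using r0 by simp
      moreover have "((P * ?U 0 j) *\<^sub>v v) $ r0 = (\<Sum>q<n. (P * ?U 0 j) $$ (r0, q) * v $ q)"
        using v Pc r0 by (auto simp: scalar_prod_def atLeast0LessThan matrix_unit_def intro!: sum.cong)
      moreover have "\<dots> = (\<Sum>q<n. if q = j then P $$ (r0, 0) * v $ j else 0)"
        using mult_matrix_unit_index[OF Pc r0 _ n0 j] by (intro sum.cong) auto
      moreover have "\<dots> = P $$ (r0, 0) * v $ j" using j by simp
      moreover have "P $$ (r0, 0) \<noteq> 0" using rc r0 n0 by (simp add: P_def)
      ultimately show ?thesis by simp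
    qed
    then show "v = 0\<^sub>v n" using v by (intro eq_vecI) auto
  qed
  then obtain P' where "P' \<in> carrier_mat n n" "P * P' = 1\<^sub>m n" "P' * P = 1\<^sub>m n"
    using inverse_of_det_nonzero[OF Pc] by blast
  with Pc inter show ?thesis using that unfolding n_def by blast
qed

text \<open>If \<open>P\<close> had an entry \<open>(r, i)\<close> below the block diagonal, then \<open>P'\<close> would map the
  standard flag subspace of the block of \<open>r\<close> into the smaller one of the block of \<open>i\<close>.\<close>

lemma UT_automorphism_conjugator_UT:
  fixes \<phi> :: "'f::field mat \<Rightarrow> 'f mat"
  assumes aut: "algebra_automorphism (UT ns) \<phi>"
    and P: "P \<in> carrier_mat (sum_list ns) (sum_list ns)"
    and P': "P' \<in> carrier_mat (sum_list ns) (sum_list ns)" "P' * P = 1\<^sub>m (sum_list ns)"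
    and inter: "\<And>a. a \<in> UT ns \<Longrightarrow> \<phi> a * P = P * a"
  shows "P \<in> UT ns"
proof (rule ccontr)
  define n where "n = sum_list ns"
  let ?b = "block_index ns"
  note Pc = P[folded n_def] and P'c = P'(1)[folded n_def] and P'P = P'(2)[folded n_def]
  note phi = algebra_automorphismD[OF aut]
  assume "P \<notin> UT ns"
  then obtain r i where ri: "r < n" "i < n" "?b i < ?b r" and nz: "P $$ (r, i) \<noteq> 0"
    using P by (auto simp: UT_def n_def)
  \<comment> \<open>This entry, multiplied by \<open>P $$ (r, i)\<close>, is an entry below the block diagonal of the
    preimage of the matrix unit at \<open>(a, r)\<close>.\<close>
  have zero: "P' $$ (u, a) = 0" if ua: "u < n" "a < n" "?b i < ?b u" "?b a \<le> ?b r" for u a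
  proof -
    let ?E = "matrix_unit n a r :: 'f mat"
    have E: "?E \<in> UT ns" using ua unfolding n_def by (intro matrix_unit_UT) auto
    then obtain x where x: "x \<in> UT ns" "\<phi> x = ?E"
      using phi(1) by (metis bij_betw_imp_surj_on imageE)
    have xc: "x \<in> carrier_mat n n" using UT_carrier[OF x(1)] by (simp add: n_def)
    have Ec: "?E \<in> carrier_mat n n" by simp
    have "(P' * ?E) * P = P' * (P * x)"
      unfolding assoc_mult_mat[OF P'c Ec Pc] using inter[OF x(1)] x(2) by simp
    also have "\<dots> = x" using assoc_mult_mat[OF P'c Pc xc] P'P xc by simp
    finally have eq: "(P' * ?E) * P = x" .
    have "((P' * ?E) * P) $$ (u, i) = (\<Sum>s<n. (P' * ?E) $$ (u, s) * P $$ (s, i))"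
      by (rule index_mult_mat_sum[OF mult_carrier_mat[OF P'c Ec] Pc ua(1) ri(2)])
    also have "\<dots> = (\<Sum>s<n. if s = r then P' $$ (u, a) * P $$ (r, i) else 0)"
      using mult_matrix_unit_index[OF P'c ua(1) _ ua(2) ri(1)] by (intro sum.cong) auto
    also have "\<dots> = P' $$ (u, a) * P $$ (r, i)" using ri by simp
    finally have "P' $$ (u, a) * P $$ (r, i) = x $$ (u, i)" unfolding eq by simp
    also have "\<dots> = 0" using x(1) ua ri by (auto simp: UT_def n_def)
    finally show ?thesis using nz by simp
  qed
  obtain p where p: "p permutes {..<n}" "\<And>u. u < n \<Longrightarrow> P' $$ (u, p u) \<noteq> 0"
    using det_nonzero_permutation[OF P'c det_nonzero_of_inverse[OF P'c Pc P'P]] by blast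
  have pn: "p u < n" if "u < n" for u using permutes_in_image[OF p(1), of u] that by simp
  let ?S = "\<lambda>q. {u. u < n \<and> q < ?b u}"
  \<comment> \<open>So \<open>p\<close> would map a set injectively into a proper subset of it.\<close>
  have "p ` ?S (?b i) \<subseteq> ?S (?b r)"
    using zero p(2) pn by (force simp: not_le[symmetric])
  then have "card (?S (?b i)) \<le> card (?S (?b r))"
    using card_inj_on_le[of p "?S (?b i)" "?S (?b r)"] permutes_inj[OF p(1)]
    by (simp add: inj_on_subset[OF _ subset_UNIV])
  moreover have "?S (?b r) \<subset> ?S (?b i)" using ri by auto
  then have "card (?S (?b r)) < card (?S (?b i))" by (intro psubset_card_mono) auto
  ultimately show False by simp
qed

section \<open>Recovering the coset multiplicities\<close>

lemma (in comm_group) degree_cancel: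
  assumes [simp]: "a \<in> carrier G" "b \<in> carrier G" "c \<in> carrier G" "d \<in> carrier G" "t \<in> carrier G"
  shows "inv a \<otimes> (b \<otimes> t \<otimes> inv c) \<otimes> d \<otimes> (a \<otimes> c) = t \<otimes> (b \<otimes> d)"
proof -
  have "inv a \<otimes> (b \<otimes> t \<otimes> inv c) \<otimes> d \<otimes> (a \<otimes> c) =
      (inv a \<otimes> a) \<otimes> (inv c \<otimes> c) \<otimes> (t \<otimes> (b \<otimes> d))"
    by (simp only: m_ac m_closed inv_closed assms)
  then show ?thesis by simp
qed

context division_algebra
begin

lemma T_subset: "T \<subseteq> carrier G"
  using subgroup_T by (rule subgroup.subset)

lemma coset_eq_of_mem:
  assumes "t \<in> T" "x \<in> carrier G" "y = t \<otimes> x"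
  shows "T #> y = T #> x"
proof -
  have "T #> t #> x = T #> (t \<otimes> x)" using assms T_subset by (intro coset_mult_assoc) auto
  moreover have "T #> t = T" using assms subgroup_T by (intro coset_join2) auto
  ultimately show ?thesis using assms by simp
qed

lemma coset_mult_cancel:
  assumes "x \<in> carrier G" "y \<in> carrier G" "z \<in> carrier G"
  shows "T #> (x \<otimes> z) = T #> (y \<otimes> z) \<longleftrightarrow> T #> x = T #> y"
proof
  assume "T #> (x \<otimes> z) = T #> (y \<otimes> z)"
  then have "T #> (x \<otimes> z) #> inv z = T #> (y \<otimes> z) #> inv z" by simp
  then show "T #> x = T #> y" using assms T_subset by (simp add: coset_mult_assoc m_assoc)
next
  assume "T #> x = T #> y"
  then have "T #> x #> z = T #> y #> z" by simp
  then show "T #> (x \<otimes> z) = T #> (y \<otimes> z)" using assms T_subset by (simp add: coset_mult_assoc)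
qed

end

locale block_graded_pair =
  A: block_graded_algebra G T \<beta> l D gs ks + B: block_graded_algebra G T \<beta>' l D' gs' ks
  for G :: "('g, 'b) monoid_scheme" (structure) and T and \<beta> \<beta>' :: "'g \<Rightarrow> 'g \<Rightarrow> 'f::field"
    and l D D' gs gs' ks
begin

abbreviation "deg r \<equiv> gs ! (r div l)"
abbreviation "deg' r \<equiv> gs' ! (r div l)"

lemma same_length: "length gs' = length gs"
  using A.length_gs B.length_gs by simp

lemma div_less: "r < A.n \<Longrightarrow> r div l < A.k"
  using A.l_pos by (simp add: div_less_iff_less_mult)

lemma deg_carrier [simp]: "r < A.n \<Longrightarrow> deg r \<in> carrier G" "r < A.n \<Longrightarrow> deg' r \<in> carrier G"
  using A.gs_nth[OF div_less] B.gs_nth[of "r div l"] div_less[of r] by (auto simp: same_length)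

text \<open>Forgetting the degree inside a coset of \<open>T\<close> leaves an elementary grading by \<open>G/T\<close>, which
  every graded isomorphism respects. Matrix units are homogeneous for it.\<close>

lemma graded_iso_entry_cosets:
  assumes aut: "algebra_automorphism (UT A.sizes) \<phi>"
    and iso: "\<And>g. g \<in> carrier G \<Longrightarrow> \<phi> ` A.component g = B.component g"
    and ij: "i < A.k" "j < A.k" "block_index ks i \<le> block_index ks j"
    and d: "d \<in> carrier_mat l l"
    and rs: "r < A.n" "s < A.n" "\<phi> (single_block A.k l i j d) $$ (r, s) \<noteq> 0"
  shows "T #> (deg' r \<otimes> gs ! j) = T #> (gs ! i \<otimes> deg' s)"
proof -
  note phi = algebra_automorphismD[OF aut]
  let ?s = "single_block A.k l i j"
  have UT: "?s d \<in> UT A.sizes" if "d \<in> carrier_mat l l" for d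
    using that ij by (auto simp: A.UT_sizes_iff block_single_block)
  show ?thesis
  proof (rule ccontr)
    assume neq: "\<not> ?thesis"
    have "\<phi> (?s d) $$ (r, s) = 0"
      using d
    proof (induction d rule: A.D_induct)
      case zero
      have "?s (0\<^sub>m l l) = (0\<^sub>m A.n A.n :: 'f mat)"
        by (rule eq_blocksI[of _ A.k l]) (auto simp: block_single_block block_zero)
      then show ?case
        using UT_automorphism_zero[OF aut] rs unfolding A.sum_list_sizes by simp
    next
      case (add x y)
      have "?s (x + y) = ?s x + ?s y"
        by (rule eq_blocksI[of _ A.k l])
          (use add.hyps in \<open>auto simp: block_single_block block_add[OF single_block_carrier single_block_carrier]\<close>)
      moreover have "\<phi> (?s x) \<in> carrier_mat A.n A.n" "\<phi> (?s y) \<in> carrier_mat A.n A.n"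
        using phi(5)[OF UT] add.hyps by (auto simp: A.UT_sizes_iff)
      ultimately show ?case
        using add.IH rs by (simp add: phi(2)[OF UT[OF add.hyps(1)] UT[OF add.hyps(2)]])
    next
      case (homogeneous t x)
      let ?g = "gs ! i \<otimes> t \<otimes> inv (gs ! j)"
      have t: "t \<in> carrier G" using homogeneous by simp
      have g: "?g \<in> carrier G" using ij t by simp
      have "\<phi> (?s x) \<in> B.component ?g"
        using imageI[OF A.single_block_component[OF ij t homogeneous(2)], of \<phi>]
        unfolding iso[OF g] .
      then have blk: "block l (\<phi> (?s x)) (r div l) (s div l) \<in> D' (inv (deg' r) \<otimes> ?g \<otimes> deg' s)"
        using div_less rs unfolding B.component_iff[OF g] by (simp add: same_length)
      let ?w = "inv (deg' r) \<otimes> ?g \<otimes> deg' s"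
      have w: "?w \<in> carrier G" using rs g by simp
      have "?w \<notin> T"
      proof
        assume wT: "?w \<in> T"
        have "t \<otimes> (gs ! i \<otimes> deg' s) = ?w \<otimes> (deg' r \<otimes> gs ! j)"
          using rs(1,2) ij(1,2) t by (intro A.degree_cancel[symmetric]) simp_all
        then have "T #> (gs ! i \<otimes> deg' s) = T #> (deg' r \<otimes> gs ! j)"
          using A.coset_eq_of_mem[OF homogeneous(1), of "gs ! i \<otimes> deg' s"]
            A.coset_eq_of_mem[OF wT, of "deg' r \<otimes> gs ! j"] rs ij by simp
        with neq show False by simp
      qed
      then have "block l (\<phi> (?s x)) (r div l) (s div l) = 0\<^sub>m l l"
        using blk B.D_support[OF w] by simp
      then have "block l (\<phi> (?s x)) (r div l) (s div l) $$ (r mod l, s mod l) = 0"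
        using A.l_pos by simp
      then show ?case using A.l_pos by (simp add: block_def)
    qed
    with rs show False by simp
  qed
qed

text \<open>The conjugating matrix \<open>P\<close> splits into parts that are homogeneous for the
  \<open>G/T\<close>-degree, and each part intertwines as \<open>P\<close> does. The part \<open>Q\<close> that does not kill the first
  basis vector is injective, so some product in the Leibniz formula for \<open>det Q\<close> is nonzero. The
  corresponding permutation respects cosets up to the shift \<open>h\<close>, and respects blocks because
  \<open>Q\<close> is block triangular.\<close>

lemma graded_iso_permutation:
  assumes aut: "algebra_automorphism (UT A.sizes) \<phi>"
    and iso: "\<And>g. g \<in> carrier G \<Longrightarrow> \<phi> ` A.component g = B.component g"
    and nonempty: "A.k > 0"
  obtains h p where "h \<in> carrier G" "p permutes {..<A.n}"
    "\<And>r. r < A.n \<Longrightarrow> block_index A.sizes (p r) = block_index A.sizes r"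
    "\<And>r. r < A.n \<Longrightarrow> T #> deg' r = T #> (h \<otimes> deg (p r))"
proof -
  let ?n = A.n
  let ?b = "block_index A.sizes"
  note phi = algebra_automorphismD[OF aut]
  have n0: "0 < ?n" using nonempty A.l_pos by simp
  obtain P P' where P: "P \<in> carrier_mat ?n ?n" "P' \<in> carrier_mat ?n ?n"
    "P * P' = 1\<^sub>m ?n" "P' * P = 1\<^sub>m ?n" and inter: "\<And>a. a \<in> UT A.sizes \<Longrightarrow> \<phi> a * P = P * a"
    using UT_automorphism_conjugation[OF aut] n0 unfolding A.sum_list_sizes by blast
  have P_UT: "P \<in> UT A.sizes"
    using UT_automorphism_conjugator_UT[OF aut, unfolded A.sum_list_sizes, OF P(1,2,4) inter] .
  have "\<exists>r0<?n. P $$ (r0, 0) \<noteq> 0"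
  proof (rule ccontr)
    assume z: "\<not> ?thesis"
    have "(P' * P) $$ (0, 0) = (\<Sum>s<?n. P' $$ (0, s) * P $$ (s, 0))"
      by (rule index_mult_mat_sum[OF P(2,1) n0 n0])
    also have "\<dots> = 0" using z by (intro sum.neutral) auto
    finally show False using P(4) n0 by simp
  qed
  then obtain r0 where r0: "r0 < ?n" "P $$ (r0, 0) \<noteq> 0" by blast
  \<comment> \<open>The degree of the entry \<open>(r0, 0)\<close>, so that this entry survives in \<open>Q\<close>.\<close>
  define h where "h = deg' r0 \<otimes> inv (deg 0)"
  have h: "h \<in> carrier G" using r0 n0 by (simp add: h_def)
  have h0: "h \<otimes> deg 0 = deg' r0" using r0 n0 by (simp add: h_def A.m_assoc)
  define Q where
    "Q = mat ?n ?n (\<lambda>(r, s). if T #> deg' r = T #> (h \<otimes> deg s) then P $$ (r, s) else 0)"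
  have Qc: "Q \<in> carrier_mat ?n ?n" by (simp add: Q_def)
  have Q0: "Q $$ (r0, 0) \<noteq> 0" using r0 n0 h0 by (simp add: Q_def)
  let ?U = "\<lambda>j. matrix_unit ?n 0 j :: 'f mat"
  have U_UT: "?U j \<in> UT A.sizes" for j
    using matrix_unit_UT[of 0 A.sizes j] block_index_mono[of 0 j A.sizes]
    unfolding A.sum_list_sizes by auto
  have Uc: "\<phi> (?U j) \<in> carrier_mat ?n ?n" for j
    using phi(5)[OF U_UT] by (simp add: A.UT_sizes_iff)
  have coset: "T #> (deg' r \<otimes> deg j) = T #> (deg 0 \<otimes> deg' u)"
    if "r < ?n" "u < ?n" "j < ?n" "\<phi> (?U j) $$ (r, u) \<noteq> 0" for r u j
  proof -
    have "block_index ks 0 \<le> block_index ks (j div l)"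
      using div_less[OF that(3)] by (intro block_index_mono) (auto simp: A.length_gs)
    moreover have "\<phi> (single_block A.k l (0 div l) (j div l) (matrix_unit l (0 mod l) (j mod l))) $$ (r, u) \<noteq> 0"
      using that(4) unfolding matrix_unit_as_single_block[OF n0 that(3)] .
    ultimately show ?thesis
      using graded_iso_entry_cosets[OF aut iso, of "0 div l" "j div l" "matrix_unit l (0 mod l) (j mod l)" r u]
        div_less[OF n0] div_less[OF that(3)] that by simp
  qed
  have Q_inter: "\<phi> (?U j) * Q = Q * ?U j" if j: "j < ?n" for j
  proof (rule eq_matI)
    fix r s assume "r < dim_row (Q * ?U j)" "s < dim_col (Q * ?U j)"
    then have rs: "r < ?n" "s < ?n" using Qc by (auto simp: matrix_unit_def)
    let ?C = "T #> (deg' r \<otimes> deg j) = T #> (h \<otimes> deg s \<otimes> deg 0)"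
    \<comment> \<open>For the \<open>u\<close> that contribute to row \<open>r\<close> of the product, whether \<open>Q\<close> keeps the entry
      \<open>(u, s)\<close> of \<open>P\<close> depends on \<open>r\<close> and \<open>s\<close> only.\<close>
    have C: "T #> deg' u = T #> (h \<otimes> deg s) \<longleftrightarrow> ?C"
      if u: "u < ?n" and nz: "\<phi> (?U j) $$ (r, u) \<noteq> 0" for u
    proof -
      have "T #> deg' u = T #> (h \<otimes> deg s) \<longleftrightarrow>
          T #> (deg' u \<otimes> deg 0) = T #> (h \<otimes> deg s \<otimes> deg 0)"
        using u rs h n0 by (intro A.coset_mult_cancel[symmetric]) auto
      also have "deg' u \<otimes> deg 0 = deg 0 \<otimes> deg' u" using u n0 by (intro A.m_comm) auto
      finally show ?thesis using coset[OF rs(1) u j nz] by simp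
    qed
    have Cj: "?C \<longleftrightarrow> T #> deg' r = T #> (h \<otimes> deg 0)" if "s = j"
    proof -
      have "h \<otimes> deg s \<otimes> deg 0 = h \<otimes> deg 0 \<otimes> deg j"
        using that h n0 j by (simp add: A.m_ac)
      then show ?thesis using A.coset_mult_cancel[of "deg' r" "h \<otimes> deg 0" "deg j"] rs h n0 j by simp
    qed
    have "(\<phi> (?U j) * Q) $$ (r, s) = (\<Sum>u<?n. \<phi> (?U j) $$ (r, u) * Q $$ (u, s))"
      by (rule index_mult_mat_sum[OF Uc Qc rs])
    also have "\<dots> = (\<Sum>u<?n. if ?C then \<phi> (?U j) $$ (r, u) * P $$ (u, s) else 0)"
    proof (rule sum.cong[OF refl])
      fix u assume "u \<in> {..<?n}"
      then have u: "u < ?n" by simp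
      show "\<phi> (?U j) $$ (r, u) * Q $$ (u, s) =
          (if ?C then \<phi> (?U j) $$ (r, u) * P $$ (u, s) else 0)"
        using C[OF u] u rs by (cases "\<phi> (?U j) $$ (r, u) = 0") (simp_all add: Q_def)
    qed
    also have "\<dots> = (if ?C then (\<phi> (?U j) * P) $$ (r, s) else 0)"
      using index_mult_mat_sum[OF Uc P(1) rs] by simp
    also have "\<dots> = (if ?C then (if s = j then P $$ (r, 0) else 0) else 0)"
      unfolding inter[OF U_UT] mult_matrix_unit_index[OF P(1) rs n0 j] ..
    also have "\<dots> = (if s = j then Q $$ (r, 0) else 0)"
      using Cj rs n0 by (simp add: Q_def)
    also have "\<dots> = (Q * ?U j) $$ (r, s)"
      unfolding mult_matrix_unit_index[OF Qc rs n0 j] ..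
    finally show "(\<phi> (?U j) * Q) $$ (r, s) = (Q * ?U j) $$ (r, s)" .
  qed (use Uc Qc in \<open>auto simp: matrix_unit_def\<close>)
  have "det Q \<noteq> 0"
  proof (rule det_nonzeroI[OF Qc])
    fix v assume v: "v \<in> carrier_vec ?n" and Qv: "Q *\<^sub>v v = 0\<^sub>v ?n"
    have "v $ j = 0" if j: "j < ?n" for j
    proof -
      have "(Q * ?U j) *\<^sub>v v = \<phi> (?U j) *\<^sub>v (Q *\<^sub>v v)"
        unfolding Q_inter[OF j, symmetric] by (rule assoc_mult_mat_vec[OF Uc Qc v])
      also have "\<dots> = 0\<^sub>v ?n" unfolding Qv using Uc[of j] by (intro eq_vecI) auto
      finally have "((Q * ?U j) *\<^sub>v v) $ r0 = 0" using r0 by simp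
      moreover have "((Q * ?U j) *\<^sub>v v) $ r0 = (\<Sum>q<?n. (Q * ?U j) $$ (r0, q) * v $ q)"
        using v Qc r0 by (auto simp: scalar_prod_def atLeast0LessThan matrix_unit_def intro!: sum.cong)
      moreover have "\<dots> = (\<Sum>q<?n. if q = j then Q $$ (r0, 0) * v $ j else 0)"
        using mult_matrix_unit_index[OF Qc r0(1) _ n0 j] by (intro sum.cong) auto
      moreover have "\<dots> = Q $$ (r0, 0) * v $ j" using j by simp
      ultimately show ?thesis using Q0 by simp
    qed
    then show "v = 0\<^sub>v ?n" using v by (intro eq_vecI) auto
  qed
  then obtain p where p: "p permutes {..<?n}" "\<And>r. r < ?n \<Longrightarrow> Q $$ (r, p r) \<noteq> 0"
    using det_nonzero_permutation[OF Qc] by blast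
  have pn: "p r < ?n" if "r < ?n" for r using permutes_in_image[OF p(1), of r] that by simp
  have shift: "T #> deg' r = T #> (h \<otimes> deg (p r))" and Pp: "P $$ (r, p r) \<noteq> 0" if "r < ?n" for r
    using p(2)[OF that] that pn[OF that] by (auto simp: Q_def split: if_splits)
  have le: "?b r \<le> ?b (p r)" if "r < ?n" for r
    using P_UT Pp[OF that] that pn[OF that] unfolding UT_def A.sum_list_sizes
    by (metis (mono_tags, lifting) mem_Collect_eq not_le)
  \<comment> \<open>A permutation that never decreases the block index preserves it.\<close>
  have "(\<Sum>r<?n. ?b (p r)) = (\<Sum>r<?n. ?b r)"
    using sum.permute[OF p(1), of ?b] by (simp add: o_def)
  then have "?b r = ?b (p r)" if "r < ?n" for r
    using sum_mono_inv[of ?b "{..<?n}" "\<lambda>r. ?b (p r)" r] le that by simp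
  then show ?thesis using that[OF h p(1) _ shift] by simp
qed

text \<open>Every position of \<open>gs\<close> accounts for \<open>l\<close> basis vectors, so the counts of basis vectors that
  the permutation matches are \<open>l\<close> times the counts of positions.\<close>

lemma graded_iso_coset_cards:
  assumes "algebra_automorphism (UT A.sizes) \<phi>"
    and "\<And>g. g \<in> carrier G \<Longrightarrow> \<phi> ` A.component g = B.component g"
    and "A.k > 0"
  obtains h where "h \<in> carrier G"
    "\<And>q y. card {i. i < A.k \<and> block_index ks i = q \<and> T #> gs' ! i = y} =
      card {i. i < A.k \<and> block_index ks i = q \<and> T #> (h \<otimes> gs ! i) = y}"
proof -
  obtain h p where h: "h \<in> carrier G" and p: "p permutes {..<A.n}"
    and b: "\<And>r. r < A.n \<Longrightarrow> block_index A.sizes (p r) = block_index A.sizes r"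
    and c: "\<And>r. r < A.n \<Longrightarrow> T #> deg' r = T #> (h \<otimes> deg (p r))"
    using graded_iso_permutation[OF assms] by blast
  have "card {i. i < A.k \<and> block_index ks i = q \<and> T #> gs' ! i = y} =
      card {i. i < A.k \<and> block_index ks i = q \<and> T #> (h \<otimes> gs ! i) = y}" for q y
  proof -
    let ?S' = "{r. r < A.n \<and> block_index A.sizes r = q \<and> T #> deg' r = y}"
    let ?S = "{r. r < A.n \<and> block_index A.sizes r = q \<and> T #> (h \<otimes> deg r) = y}"
    have pin: "p r < A.n \<longleftrightarrow> r < A.n" for r using permutes_in_image[OF p, of r] by simp
    have "p ` ?S' = ?S"
    proof (intro equalityI subsetI)
      fix s assume "s \<in> p ` ?S'"
      then show "s \<in> ?S" using pin b c by auto
    next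
      fix s assume s: "s \<in> ?S"
      obtain r where r: "s = p r" using permutes_surj[OF p] by (metis surjD)
      then have "r \<in> ?S'" using s pin[of r] b[of r] c[of r] by auto
      with r show "s \<in> p ` ?S'" by blast
    qed
    then have "card ?S' = card ?S"
      using card_image[OF inj_on_subset[OF permutes_inj[OF p] subset_UNIV], of ?S'] by (simp only:)
    moreover have "card ?S' = l * card {i. i < A.k \<and> block_index ks i = q \<and> T #> gs' ! i = y}"
      using card_div_vimage[of A.k l "\<lambda>i. block_index ks i = q \<and> T #> gs' ! i = y"]
      by (simp add: block_index_scale[OF A.l_pos])
    moreover have "card ?S = l * card {i. i < A.k \<and> block_index ks i = q \<and> T #> (h \<otimes> gs ! i) = y}"
      using card_div_vimage[of A.k l "\<lambda>i. block_index ks i = q \<and> T #> (h \<otimes> gs ! i) = y"]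
      by (simp add: block_index_scale[OF A.l_pos])
    ultimately show ?thesis using A.l_pos by simp
  qed
  with h show ?thesis using that by blast
qed

end

section \<open>Constructing graded isomorphisms\<close>

lemma conjugation_automorphism:
  fixes P R :: "'f::field mat"
  assumes P: "P \<in> carrier_mat (sum_list ns) (sum_list ns)"
    and R: "R \<in> carrier_mat (sum_list ns) (sum_list ns)"
    and PR: "P * R = 1\<^sub>m (sum_list ns)" and RP: "R * P = 1\<^sub>m (sum_list ns)"
    and fwd: "\<And>a. a \<in> UT ns \<Longrightarrow> P * a * R \<in> UT ns"
    and bwd: "\<And>a. a \<in> UT ns \<Longrightarrow> R * a * P \<in> UT ns"
  shows "algebra_automorphism (UT ns) (\<lambda>a. P * a * R)"
proof -
  define n where "n = sum_list ns"
  note PRc = P[folded n_def] R[folded n_def]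
  note one = PR[folded n_def] RP[folded n_def]
  have car: "a \<in> carrier_mat n n" if "a \<in> UT ns" for a :: "'f mat"
    using UT_carrier[OF that] by (simp add: n_def)
  note sq = assoc_mult_mat[of _ n n _ n _ n] mult_carrier_mat[of _ n n _ n]
    mult_smult_assoc_mat[of _ n n _ n] mult_smult_distrib[of _ n n _ n]
    add_mult_distrib_mat[of _ n n _ _ n] mult_add_distrib_mat[of _ n n _ n]
    right_mult_one_mat[of _ n n]
  have cancel: "P * (R * x) = x" "R * (P * x) = x" if "x \<in> carrier_mat n n" for x
    using assoc_mult_mat[OF PRc that] assoc_mult_mat[OF PRc(2,1) that] one that by simp_all
  show ?thesis
    unfolding algebra_automorphism_def
  proof (intro conjI ballI allI)
    show "bij_betw (\<lambda>a. P * a * R) (UT ns) (UT ns)"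
    proof (rule bij_betw_byWitness[where f' = "\<lambda>a. R * a * P"])
      show "\<forall>a\<in>UT ns. R * (P * a * R) * P = a"
        using car PRc one by (simp add: sq cancel)
      show "\<forall>a\<in>UT ns. P * (R * a * P) * R = a"
        using car PRc one by (simp add: sq cancel)
    qed (use fwd bwd in auto)
    fix x y :: "'f mat" and c assume xy: "x \<in> UT ns"
    show "P * (c \<cdot>\<^sub>m x) * R = c \<cdot>\<^sub>m (P * x * R)"
      using car[OF xy] PRc by (simp add: sq)
    assume y: "y \<in> UT ns"
    show "P * (x + y) * R = P * x * R + P * y * R"
      using car[OF xy] car[OF y] PRc by (simp add: sq)
    show "P * (x * y) * R = P * x * R * (P * y * R)"
      using car[OF xy] car[OF y] PRc by (simp add: sq cancel)
  qed
qed

context block_graded_pair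
begin

text \<open>Conjugation by the block monomial matrix with blocks \<open>u i\<close> at \<open>(p i, i)\<close> takes block
  \<open>(i, j)\<close> to \<open>u i \<cdot> _ \<cdot> v j\<close> at \<open>(p i, p j)\<close>.\<close>

lemma block_monomial_isomorphism:
  fixes u v :: "nat \<Rightarrow> 'f mat"
  assumes p: "p permutes {..<A.k}"
    and bi: "\<And>i. i < A.k \<Longrightarrow> block_index ks (p i) = block_index ks i"
    and uc: "\<And>i. i < A.k \<Longrightarrow> u i \<in> carrier_mat l l"
    and vc: "\<And>i. i < A.k \<Longrightarrow> v i \<in> carrier_mat l l"
    and uv: "\<And>i. i < A.k \<Longrightarrow> u i * v i = 1\<^sub>m l" "\<And>i. i < A.k \<Longrightarrow> v i * u i = 1\<^sub>m l"
    and fwd: "\<And>i j g x. i < A.k \<Longrightarrow> j < A.k \<Longrightarrow> g \<in> carrier G \<Longrightarrow>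
      x \<in> D (inv (gs ! i) \<otimes> g \<otimes> gs ! j) \<Longrightarrow>
      u i * x * v j \<in> D' (inv (gs' ! p i) \<otimes> g \<otimes> gs' ! p j)"
    and bwd: "\<And>i j g x. i < A.k \<Longrightarrow> j < A.k \<Longrightarrow> g \<in> carrier G \<Longrightarrow>
      x \<in> D' (inv (gs' ! p i) \<otimes> g \<otimes> gs' ! p j) \<Longrightarrow>
      v i * x * u j \<in> D (inv (gs ! i) \<otimes> g \<otimes> gs ! j)"
  shows "\<exists>\<phi>. algebra_automorphism (UT A.sizes) \<phi> \<and>
    (\<forall>g\<in>carrier G. \<phi> ` A.component g = B.component g)"
proof -
  let ?n = A.n
  have pk: "p i < A.k \<longleftrightarrow> i < A.k" for i using permutes_in_image[OF p, of i] by simp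
  have pinj: "p i = p j \<longleftrightarrow> i = j" for i j using permutes_inj[OF p] by (auto dest: injD)
  have psurj: "\<exists>j. j < A.k \<and> i = p j" if "i < A.k" for i
    using permutes_surj[OF p] pk that by (metis surjD)
  define P where "P = from_blocks A.k l (\<lambda>r s. if r = p s then u s else 0\<^sub>m l l)"
  define R where "R = from_blocks A.k l (\<lambda>r s. if s = p r then v r else 0\<^sub>m l l)"
  have Pc: "P \<in> carrier_mat ?n ?n" and Rc: "R \<in> carrier_mat ?n ?n" by (simp_all add: P_def R_def)
  have blkP: "block l P r s = (if r = p s then u s else 0\<^sub>m l l)" if "r < A.k" "s < A.k" for r s
    unfolding P_def using that uc by (subst block_from_blocks) auto
  have blkR: "block l R r s = (if s = p r then v r else 0\<^sub>m l l)" if "r < A.k" "s < A.k" for r s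
    unfolding R_def using that vc by (subst block_from_blocks) auto
  have Pa: "block l (P * a) (p i) j = u i * block l a i j"
    if "a \<in> carrier_mat ?n ?n" "i < A.k" "j < A.k" for a i j
    using that pk pinj by (subst block_mult_only[OF Pc that(1), of "p i" j i]) (auto simp: blkP)
  have aP: "block l (a * P) i j = block l a i (p j) * u j"
    if "a \<in> carrier_mat ?n ?n" "i < A.k" "j < A.k" for a i j
    using that pk pinj by (subst block_mult_only[OF that(1) Pc, of i j "p j"]) (auto simp: blkP)
  have Ra: "block l (R * a) i j = v i * block l a (p i) j"
    if "a \<in> carrier_mat ?n ?n" "i < A.k" "j < A.k" for a i j
    using that pk pinj by (subst block_mult_only[OF Rc that(1), of i j "p i"]) (auto simp: blkR)
  have aR: "block l (a * R) i (p j) = block l a i j * v j"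
    if "a \<in> carrier_mat ?n ?n" "i < A.k" "j < A.k" for a i j
    using that pk pinj by (subst block_mult_only[OF that(1) Rc, of i "p j" j]) (auto simp: blkR)
  note car = mult_carrier_mat[of _ ?n ?n _ ?n]
  have PR: "P * R = 1\<^sub>m ?n"
  proof (rule eq_blocksI[OF car[OF Pc Rc]])
    fix i j assume ij: "i < A.k" "j < A.k"
    obtain i' j' where i': "i' < A.k" "i = p i'" and j': "j' < A.k" "j = p j'"
      using psurj ij by blast
    show "block l (P * R) i j = block l (1\<^sub>m ?n) i j"
      using Pa[OF Rc i'(1) ij(2)] i' j' ij uv(1) uc
      by (simp add: blkR block_one pinj pk right_mult_zero_mat[of _ l l l])
  qed simp
  have RP: "R * P = 1\<^sub>m ?n"
  proof (rule eq_blocksI[OF car[OF Rc Pc]])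
    fix i j assume ij: "i < A.k" "j < A.k"
    show "block l (R * P) i j = block l (1\<^sub>m ?n) i j"
      using Ra[OF Pc ij] ij uv(2) vc
      by (simp add: blkP block_one pinj pk right_mult_zero_mat[of _ l l l])
  qed simp
  have PaR: "block l (P * a * R) (p i) (p j) = u i * block l a i j * v j"
    if "a \<in> carrier_mat ?n ?n" "i < A.k" "j < A.k" for a i j
    using that pk aR[OF car[OF Pc that(1)]] Pa[OF that] by simp
  have RaP: "block l (R * a * P) i j = v i * block l a (p i) (p j) * u j"
    if "a \<in> carrier_mat ?n ?n" "i < A.k" "j < A.k" for a i j
    using that pk aP[OF car[OF Rc that(1)]] Ra[OF that(1,2)] by simp
  have UTc: "a \<in> carrier_mat ?n ?n" if "a \<in> UT A.sizes" for a
    using that by (simp add: A.UT_sizes_iff)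
  have fwd_UT: "P * a * R \<in> UT A.sizes" if a: "a \<in> UT A.sizes" for a
    unfolding A.UT_sizes_iff
  proof (intro conjI allI impI)
    fix i j assume ij: "i < A.k" "j < A.k" "block_index ks j < block_index ks i"
    obtain i' j' where i': "i' < A.k" "i = p i'" and j': "j' < A.k" "j = p j'"
      using psurj ij by blast
    have "block l a i' j' = 0\<^sub>m l l"
      using a i' j' ij(3) bi[OF i'(1)] bi[OF j'(1)] by (auto simp: A.UT_sizes_iff)
    then show "block l (P * a * R) i j = 0\<^sub>m l l"
      using PaR[OF UTc[OF a] i'(1) j'(1)] uc[OF i'(1)] vc[OF j'(1)] i' j'
      by (simp add: right_mult_zero_mat[of _ l l l])
  qed (rule car[OF car[OF Pc UTc[OF a]] Rc])
  have bwd_UT: "R * a * P \<in> UT A.sizes" if a: "a \<in> UT A.sizes" for a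
    unfolding A.UT_sizes_iff
  proof (intro conjI allI impI)
    fix i j assume ij: "i < A.k" "j < A.k" "block_index ks j < block_index ks i"
    have "block l a (p i) (p j) = 0\<^sub>m l l"
      using a ij pk bi[OF ij(1)] bi[OF ij(2)] by (auto simp: A.UT_sizes_iff)
    then show "block l (R * a * P) i j = 0\<^sub>m l l"
      using RaP[OF UTc[OF a] ij(1,2)] uc[OF ij(2)] vc[OF ij(1)]
      by (simp add: right_mult_zero_mat[of _ l l l])
  qed (rule car[OF car[OF Rc UTc[OF a]] Pc])
  have "algebra_automorphism (UT A.sizes) (\<lambda>a. P * a * R)"
    by (rule conjugation_automorphism)
      (simp_all add: A.sum_list_sizes Pc Rc PR RP fwd_UT bwd_UT)
  moreover have "(\<lambda>a. P * a * R) ` A.component g = B.component g" if g: "g \<in> carrier G" for g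
  proof (intro equalityI subsetI)
    fix b assume "b \<in> (\<lambda>a. P * a * R) ` A.component g"
    then obtain a where a: "a \<in> A.component g" "b = P * a * R" by blast
    have aUT: "a \<in> UT A.sizes" using a(1) by (simp add: A.component_def)
    have "block l b i j \<in> D' (inv (gs' ! i) \<otimes> g \<otimes> gs' ! j)" if ij: "i < A.k" "j < A.k" for i j
    proof -
      obtain i' j' where i': "i' < A.k" "i = p i'" and j': "j' < A.k" "j = p j'"
        using psurj ij by blast
      have "block l a i' j' \<in> D (inv (gs ! i') \<otimes> g \<otimes> gs ! j')"
        using a(1) i' j' unfolding A.component_iff[OF g] by blast
      then show ?thesis
        using fwd[OF i'(1) j'(1) g] PaR[OF UTc[OF aUT] i'(1) j'(1)] i' j' a(2) by simp
    qed
    then show "b \<in> B.component g"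
      using fwd_UT[OF aUT] a(2) unfolding B.component_iff[OF g] by (simp add: same_length)
  next
    fix b assume b: "b \<in> B.component g"
    have bUT: "b \<in> UT A.sizes" using b by (simp add: B.component_def)
    note bc = UTc[OF bUT]
    have "block l (R * b * P) i j \<in> D (inv (gs ! i) \<otimes> g \<otimes> gs ! j)" if ij: "i < A.k" "j < A.k" for i j
    proof -
      have "block l b (p i) (p j) \<in> D' (inv (gs' ! p i) \<otimes> g \<otimes> gs' ! p j)"
        using b ij pk unfolding B.component_iff[OF g] by (simp add: same_length)
      then show ?thesis using bwd[OF ij g] RaP[OF bc ij] by simp
    qed
    then have "R * b * P \<in> A.component g"
      using bwd_UT[OF bUT] unfolding A.component_iff[OF g] by simp
    moreover have "P * (R * b * P) * R = b"
    proof -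
      have "P * (R * b * P) * R = P * (R * b) * (P * R)"
        using Pc Rc bc car by (simp add: assoc_mult_mat[of _ ?n ?n _ ?n _ ?n])
      also have "P * (R * b) = b" using assoc_mult_mat[OF Pc Rc bc] PR bc by simp
      finally show ?thesis using PR bc by (simp add: right_mult_one_mat[of _ ?n ?n])
    qed
    ultimately show "b \<in> (\<lambda>a. P * a * R) ` A.component g" by (metis image_eqI)
  qed
  ultimately show ?thesis by blast
qed

end

text \<open>Let \<open>m\<close> conjugate \<open>D\<close> into \<open>D'\<close>, with inverse \<open>m'\<close>. Since \<open>gs' ! p i = s h (gs ! i)\<close> for
  some \<open>s\<close> in \<open>T\<close>, multiplication by a homogeneous unit of degree \<open>inv s\<close> before the
  conjugation by \<open>m\<close> makes the degrees in block row \<open>i\<close> correct; the shift \<open>h\<close> cancels.\<close>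

lemma isomorphic_of_matching_cosets:
  fixes G :: "('g, 'b) monoid_scheme" (structure) and \<beta> :: "'g \<Rightarrow> 'g \<Rightarrow> 'f::alg_closed_field"
  assumes A: "block_graded_algebra G T \<beta> l D gs ks" and B: "block_graded_algebra G T \<beta> l D' gs' ks"
    and h: "h \<in> carrier G"
    and p: "p permutes {..<length gs}"
    and bi: "\<And>i. i < length gs \<Longrightarrow> block_index ks (p i) = block_index ks i"
    and cosets: "\<And>i. i < length gs \<Longrightarrow> T #> gs' ! p i = T #> (h \<otimes> gs ! i)"
  shows "\<exists>\<phi>. algebra_automorphism (UT (map (\<lambda>m. m * l) ks)) \<phi> \<and>
    (\<forall>g\<in>carrier G. \<phi> ` block_graded_algebra.component G l D gs ks g =
      block_graded_algebra.component G l D' gs' ks g)"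
proof -
  interpret A: block_graded_algebra G T \<beta> l D gs ks by (rule A)
  interpret B: block_graded_algebra G T \<beta> l D' gs' ks by (rule B)
  interpret block_graded_pair G T \<beta> \<beta> l D D' gs gs' ks ..
  interpret division_algebra_pair G T \<beta> l D D' ..
  have pk: "p i < A.k" if "i < A.k" for i using permutes_in_image[OF p, of i] that by simp
  have gs'p [simp]: "gs' ! p i \<in> carrier G" if "i < A.k" for i
    using pk[OF that] by (simp add: same_length)
  have "\<exists>s. s \<in> T \<and> gs' ! p i = s \<otimes> (h \<otimes> gs ! i)" if i: "i < A.k" for i
  proof -
    have "gs' ! p i \<in> T #> gs' ! p i" using A.rcos_self[OF gs'p[OF i] A.subgroup_T] .
    then show ?thesis unfolding cosets[OF i] by (auto simp: r_coset_def)
  qed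
  then have "\<forall>i. \<exists>s. i < A.k \<longrightarrow> s \<in> T \<and> gs' ! p i = s \<otimes> (h \<otimes> gs ! i)" by blast
  then have "\<exists>s. \<forall>i. i < A.k \<longrightarrow> s i \<in> T \<and> gs' ! p i = s i \<otimes> (h \<otimes> gs ! i)" by (rule choice)
  then obtain s where "\<forall>i. i < A.k \<longrightarrow> s i \<in> T \<and> gs' ! p i = s i \<otimes> (h \<otimes> gs ! i)" by (rule exE)
  then have s: "s i \<in> T" "gs' ! p i = s i \<otimes> (h \<otimes> gs ! i)" if "i < A.k" for i using that by auto
  have "\<exists>xy. fst xy \<in> D (inv (s i)) \<and> snd xy \<in> D (s i) \<and>
      fst xy * snd xy = 1\<^sub>m l \<and> snd xy * fst xy = 1\<^sub>m l" if i: "i < A.k" for i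
  proof -
    have si: "s i \<in> T" using s i by blast
    obtain y where y: "y \<in> D (s i)" "y \<noteq> 0\<^sub>m l l" using A.D_nonzero_ex[OF si] by blast
    obtain x where "x \<in> D (inv (s i))" "y * x = 1\<^sub>m l" "x * y = 1\<^sub>m l"
      using A.D_inverse[OF si y] by blast
    with y show ?thesis by (intro exI[of _ "(x, y)"]) simp
  qed
  then have "\<forall>i. \<exists>xy. i < A.k \<longrightarrow> fst xy \<in> D (inv (s i)) \<and> snd xy \<in> D (s i) \<and>
      fst xy * snd xy = 1\<^sub>m l \<and> snd xy * fst xy = 1\<^sub>m l" by blast
  then have "\<exists>f. \<forall>i. i < A.k \<longrightarrow> fst (f i) \<in> D (inv (s i)) \<and> snd (f i) \<in> D (s i) \<and>
      fst (f i) * snd (f i) = 1\<^sub>m l \<and> snd (f i) * fst (f i) = 1\<^sub>m l" by (rule choice)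
  then obtain f where f: "\<forall>i. i < A.k \<longrightarrow> fst (f i) \<in> D (inv (s i)) \<and> snd (f i) \<in> D (s i) \<and>
      fst (f i) * snd (f i) = 1\<^sub>m l \<and> snd (f i) * fst (f i) = 1\<^sub>m l" by (rule exE)
  define x y where "x i = fst (f i)" and "y i = snd (f i)" for i
  have x: "x i \<in> D (inv (s i))" and y: "y i \<in> D (s i)"
    and xy: "x i * y i = 1\<^sub>m l" "y i * x i = 1\<^sub>m l" if "i < A.k" for i
    using f that by (auto simp: x_def y_def)
  have xc: "x i \<in> carrier_mat l l" and yc: "y i \<in> carrier_mat l l" if "i < A.k" for i
    using A.D_carrier[OF x[OF that]] A.D_carrier[OF y[OF that]] s[OF that] by auto
  obtain m m' where m: "m \<in> carrier_mat l l" "m' \<in> carrier_mat l l" "m * m' = 1\<^sub>m l" "m' * m = 1\<^sub>m l"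
    and mD: "\<And>g x. g \<in> carrier G \<Longrightarrow> x \<in> D g \<Longrightarrow> m' * x * m \<in> D' g"
    and mD': "\<And>g y. g \<in> carrier G \<Longrightarrow> y \<in> D' g \<Longrightarrow> m * y * m' \<in> D g"
    using division_gradings_conjugate by blast
  have mm: "m * (m' * z) = z" "m' * (m * z) = z" if "z \<in> carrier_mat l l" for z
    using assoc_mult_mat[OF m(1,2) that] assoc_mult_mat[OF m(2,1) that] m that by simp_all
  have xyz: "x i * (y i * z) = z" "y i * (x i * z) = z" if "z \<in> carrier_mat l l" "i < A.k" for z i
    using assoc_mult_mat[OF xc[OF that(2)] yc[OF that(2)] that(1)]
      assoc_mult_mat[OF yc[OF that(2)] xc[OF that(2)] that(1)] xy[OF that(2)] that(1) by simp_all
  have deg: "inv (gs' ! p i) \<otimes> g \<otimes> gs' ! p j =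
      inv (s i) \<otimes> (inv (gs ! i) \<otimes> g \<otimes> gs ! j) \<otimes> s j"
    and deg': "inv (gs ! i) \<otimes> g \<otimes> gs ! j =
      s i \<otimes> (inv (gs' ! p i) \<otimes> g \<otimes> gs' ! p j) \<otimes> inv (s j)"
    if ij: "i < A.k" "j < A.k" and g: "g \<in> carrier G" for i j g
  proof -
    have sc: "s i \<in> carrier G" "s j \<in> carrier G" using s ij by simp_all
    have gsc: "gs ! i \<in> carrier G" "gs ! j \<in> carrier G" using ij by simp_all
    have "inv (gs' ! p i) = inv (s i) \<otimes> (inv h \<otimes> inv (gs ! i))"
      unfolding s(2)[OF ij(1)] using sc gsc h by (simp add: A.inv_mult)
    then have "inv (gs' ! p i) \<otimes> g \<otimes> gs' ! p j =
        (inv h \<otimes> h) \<otimes> (inv (s i) \<otimes> (inv (gs ! i) \<otimes> g \<otimes> gs ! j) \<otimes> s j)"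
      unfolding s(2)[OF ij(2)]
      by (simp only: A.m_ac A.m_closed A.inv_closed sc gsc h g)
    then show 1: "inv (gs' ! p i) \<otimes> g \<otimes> gs' ! p j =
      inv (s i) \<otimes> (inv (gs ! i) \<otimes> g \<otimes> gs ! j) \<otimes> s j"
      using sc gsc h g by simp
    have "s i \<otimes> (inv (s i) \<otimes> (inv (gs ! i) \<otimes> g \<otimes> gs ! j) \<otimes> s j) \<otimes> inv (s j) =
        (s i \<otimes> inv (s i)) \<otimes> (s j \<otimes> inv (s j)) \<otimes> (inv (gs ! i) \<otimes> g \<otimes> gs ! j)"
      by (simp only: A.m_ac A.m_closed A.inv_closed sc gsc h g)
    then show "inv (gs ! i) \<otimes> g \<otimes> gs ! j =
      s i \<otimes> (inv (gs' ! p i) \<otimes> g \<otimes> gs' ! p j) \<otimes> inv (s j)"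
      unfolding 1 using sc gsc h g by simp
  qed
  show ?thesis
  proof (rule block_monomial_isomorphism[OF p bi, where u = "\<lambda>i. m' * x i" and v = "\<lambda>i. y i * m"])
    fix i assume i: "i < A.k"
    note c = m(1,2) xc[OF i] yc[OF i]
    show "m' * x i \<in> carrier_mat l l" "y i * m \<in> carrier_mat l l"
      using c by (auto intro: mult_carrier_mat[of _ l l])
    show "m' * x i * (y i * m) = 1\<^sub>m l" "y i * m * (m' * x i) = 1\<^sub>m l"
      using c m xy[OF i] i by (simp_all add: A.square_simps xyz mm)
  next
    fix i j g z assume ij: "i < A.k" "j < A.k" and g: "g \<in> carrier G"
    have sc: "s i \<in> carrier G" "s j \<in> carrier G" using s ij by simp_all
    note c = m(1,2) xc[OF ij(1)] yc[OF ij(2)]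
    let ?d = "inv (gs ! i) \<otimes> g \<otimes> gs ! j"
    assume z: "z \<in> D ?d"
    have d: "?d \<in> carrier G" using ij g by simp
    have zc: "z \<in> carrier_mat l l" using A.D_carrier[OF z d] .
    have "x i * z * y j \<in> D (inv (s i) \<otimes> ?d \<otimes> s j)"
      using A.D_mult[OF _ sc(2) A.D_mult[OF _ d x[OF ij(1)] z] y[OF ij(2)]] sc d by simp
    then have "m' * (x i * z * y j) * m \<in> D' (inv (gs' ! p i) \<otimes> g \<otimes> gs' ! p j)"
      unfolding deg[OF ij g] using mD sc d by simp
    moreover have "m' * (x i * z * y j) * m = m' * x i * z * (y j * m)"
      using c zc by (simp add: A.square_simps)
    ultimately show "m' * x i * z * (y j * m) \<in> D' (inv (gs' ! p i) \<otimes> g \<otimes> gs' ! p j)" by simp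
  next
    fix i j g z assume ij: "i < A.k" "j < A.k" and g: "g \<in> carrier G"
    have sc: "s i \<in> carrier G" "s j \<in> carrier G" using s ij by simp_all
    note c = m(1,2) yc[OF ij(1)] xc[OF ij(2)]
    let ?d = "inv (gs' ! p i) \<otimes> g \<otimes> gs' ! p j"
    assume z: "z \<in> D' ?d"
    have d: "?d \<in> carrier G" using ij g by simp
    have zc: "z \<in> carrier_mat l l" using B.D_carrier[OF z d] .
    have "m * z * m' \<in> D ?d" using mD'[OF d z] .
    then have "y i * (m * z * m') * x j \<in> D (s i \<otimes> ?d \<otimes> inv (s j))"
      using A.D_mult[OF _ _ A.D_mult[OF sc(1) d y[OF ij(1)]] x[OF ij(2)]] sc d by simp
    then have "y i * (m * z * m') * x j \<in> D (inv (gs ! i) \<otimes> g \<otimes> gs ! j)"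
      unfolding deg'[OF ij g] .
    moreover have "y i * (m * z * m') * x j = y i * m * z * (m' * x j)"
      using c zc by (simp add: A.square_simps)
    ultimately show "y i * m * z * (m' * x j) \<in> D (inv (gs ! i) \<otimes> g \<otimes> gs ! j)" by simp
  qed
qed

section \<open>The parameters of a grading\<close>

text \<open>Squaring gives \<open>k\<^sup>2 c = n\<^sup>2\<close>, so \<open>k\<close> divides \<open>n\<close> and \<open>c\<close> is the square of the quotient.\<close>

lemma nat_mult_sqrt:
  assumes eq: "real k * sqrt (real c) = real n" and n: "n \<ge> 1"
  shows "n = k * floor_sqrt c" "floor_sqrt c > 0"
proof -
  have "real (k\<^sup>2 * c) = (real k * sqrt (real c))\<^sup>2" by (simp add: power_mult_distrib)
  also have "\<dots> = real (n\<^sup>2)" by (simp add: eq)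
  finally have sq: "k\<^sup>2 * c = n\<^sup>2" by (simp only: of_nat_eq_iff)
  have k: "k > 0" using sq n by (cases k) auto
  have "k\<^sup>2 dvd n\<^sup>2" using sq by (metis dvd_triv_left)
  then have "k dvd n" by simp
  then obtain m where m: "n = k * m" by (elim dvdE)
  then have "c = m\<^sup>2" using sq k by (simp add: power_mult_distrib)
  then have "floor_sqrt c = m" by simp
  then show "n = k * floor_sqrt c" "floor_sqrt c > 0" using m n by (auto intro: gr0I)
qed

lemma (in division_algebra) mem_rcoset_iff:
  assumes "y \<in> rcosets T" "g \<in> carrier G"
  shows "g \<in> y \<longleftrightarrow> T #> g = y"
proof -
  obtain a where a: "a \<in> carrier G" "y = T #> a" using assms(1) by (auto simp: RCOSETS_def)
  show ?thesis
    using repr_independence[OF _ a(1) subgroup_T, of g] rcos_self[OF assms(2) subgroup_T] a(2) by auto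
qed

lemma (in division_algebra) mem_l_coset_inv_iff:
  assumes y: "y \<in> rcosets T" and h: "h \<in> carrier G" and g: "g \<in> carrier G"
  shows "g \<in> inv h <# y \<longleftrightarrow> h \<otimes> g \<in> y"
proof
  have yc: "y \<subseteq> carrier G" using y rcosets_subset_PowG[OF subgroup_T] by blast
  assume "g \<in> inv h <# y"
  then obtain z where "z \<in> y" "g = inv h \<otimes> z" by (auto simp: l_coset_def)
  moreover have "h \<otimes> (inv h \<otimes> z) = z" if "z \<in> carrier G" for z
    using h that by (simp add: m_assoc[symmetric])
  ultimately show "h \<otimes> g \<in> y" using yc by auto
next
  assume "h \<otimes> g \<in> y"
  moreover have "g = inv h \<otimes> (h \<otimes> g)" using h g by (simp add: m_assoc[symmetric])
  ultimately show "g \<in> inv h <# y" by (auto simp: l_coset_def)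
qed

lemma (in division_algebra) l_coset_inv_rcosets:
  assumes y: "y \<in> rcosets T" and h: "h \<in> carrier G"
  shows "inv h <# y \<in> rcosets T"
proof -
  obtain a where a: "a \<in> carrier G" "y = T #> a" using y by (auto simp: RCOSETS_def)
  have "inv h \<otimes> (t \<otimes> a) = t \<otimes> (inv h \<otimes> a)" if "t \<in> T" for t
    using that a h by (intro m_lcomm) auto
  then have "inv h <# y = T #> (inv h \<otimes> a)"
    unfolding a(2) by (auto simp: l_coset_def r_coset_def)
  then show ?thesis using a h by (auto simp: RCOSETS_def)
qed

lemma shift_kappa_card:
  fixes G :: "('g, 'b) monoid_scheme" (structure)
  assumes A: "block_graded_algebra G T \<beta> l D (concat \<gamma>s) (map length \<gamma>s)"
    and q: "q < length \<gamma>s"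
    and \<kappa>: "\<And>x. x \<in> rcosets T \<Longrightarrow> length (filter (\<lambda>g. g \<in> x) (\<gamma>s ! q)) = \<kappa> x"
    and y: "y \<in> rcosets T" and h: "h \<in> carrier G"
  shows "shift_kappa G h \<kappa> y = card {i. i < length (concat \<gamma>s) \<and>
    block_index (map length \<gamma>s) i = q \<and> T #> (h \<otimes> concat \<gamma>s ! i) = y}"
proof -
  interpret A: block_graded_algebra G T \<beta> l D "concat \<gamma>s" "map length \<gamma>s" by (rule A)
  have "shift_kappa G h \<kappa> y = length (filter (\<lambda>g. g \<in> inv h <# y) (\<gamma>s ! q))"
    using \<kappa>[OF A.l_coset_inv_rcosets[OF y h]] by (simp add: shift_kappa_def)
  also have "\<dots> = card {i. i < length (concat \<gamma>s) \<and> block_index (map length \<gamma>s) i = q \<and>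
      concat \<gamma>s ! i \<in> inv h <# y}"
    by (rule card_concat_block[OF q, symmetric])
  also have "\<dots> = card {i. i < length (concat \<gamma>s) \<and> block_index (map length \<gamma>s) i = q \<and>
      T #> (h \<otimes> concat \<gamma>s ! i) = y}"
    using A.mem_l_coset_inv_iff[OF y h A.gs_nth] A.mem_rcoset_iff[OF y] h
    by (intro arg_cong[of _ _ card] Collect_cong) auto
  finally show ?thesis .
qed

text \<open>The size condition turns the square root of \<open>|T|\<close> into the natural number \<open>l\<close>, and the
  list of sizes \<open>ns\<close> into the \<open>l\<close>-fold of the lengths of the tuples.\<close>

lemma determines_gradingE:
  fixes G :: "('g, 'b) monoid_scheme" (structure) and \<beta> :: "'g \<Rightarrow> 'g \<Rightarrow> 'f::field"
  assumes G: "comm_group G" and ns: "ns \<noteq> []" "\<forall>m\<in>set ns. m \<ge> 1"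
    and par: "grading_parameters G ns T \<beta> \<kappa>s" and det: "determines_grading G ns T \<beta> \<kappa>s \<Gamma>"
  obtains \<gamma>s D where "length \<gamma>s = length ns"
    "block_graded_algebra G T \<beta> (floor_sqrt (card T)) D (concat \<gamma>s) (map length \<gamma>s)"
    "ns = map (\<lambda>m. m * floor_sqrt (card T)) (map length \<gamma>s)"
    "\<forall>g\<in>carrier G. \<Gamma> g =
      block_graded_algebra.component G (floor_sqrt (card T)) D (concat \<gamma>s) (map length \<gamma>s) g"
    "\<forall>i<length ns. \<forall>x\<in>rcosets T. length (filter (\<lambda>g. g \<in> x) (\<gamma>s ! i)) = (\<kappa>s ! i) x"
proof -
  let ?l = "floor_sqrt (card T)"
  have len: "length \<kappa>s = length ns"
    and size: "\<And>i. i < length ns \<Longrightarrow>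
      real (kappa_size G T (\<kappa>s ! i)) * sqrt (real (card T)) = real (ns ! i)"
    and T: "subgroup T G" "finite T" "nondeg_alternating_bichar G T \<beta>"
    using par unfolding grading_parameters_def by blast+
  obtain \<gamma>s D where \<gamma>s: "length \<gamma>s = length \<kappa>s"
    "\<forall>i < length \<kappa>s. set (\<gamma>s ! i) \<subseteq> carrier G \<and> length (\<gamma>s ! i) = kappa_size G T (\<kappa>s ! i) \<and>
       (\<forall>x \<in> rcosets T. length (filter (\<lambda>g. g \<in> x) (\<gamma>s ! i)) = (\<kappa>s ! i) x)"
    and D: "division_grading G ?l T \<beta> D"
    and \<Gamma>: "\<forall>g\<in>carrier G. \<Gamma> g = full_matrix_grading G (concat \<gamma>s) ?l D g \<inter> UT ns"
    using det unfolding determines_grading_def Let_def by blast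
  have pos: "ns ! i \<ge> 1" if "i < length ns" for i using ns(2) that by simp
  have nsi: "ns ! i = length (\<gamma>s ! i) * ?l" if "i < length ns" for i
    using nat_mult_sqrt(1)[OF size[OF that] pos[OF that]] \<gamma>s(2) len that by simp
  have l: "?l > 0" using nat_mult_sqrt(2)[OF size[of 0] pos[of 0]] ns(1) by simp
  have ns_eq: "ns = map (\<lambda>m. m * ?l) (map length \<gamma>s)"
    using \<gamma>s(1) len nsi by (intro nth_equalityI) auto
  have car: "set (concat \<gamma>s) \<subseteq> carrier G"
    using \<gamma>s by (fastforce simp: in_set_conv_nth)
  have A: "block_graded_algebra G T \<beta> ?l D (concat \<gamma>s) (map length \<gamma>s)"
    by (intro block_graded_algebra.intro division_algebra.intro division_algebra_axioms.intro
        block_graded_algebra_axioms.intro G T D l car) (simp add: length_concat)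
  show ?thesis
  proof (rule that[OF _ A ns_eq])
    show "length \<gamma>s = length ns" using \<gamma>s(1) len by simp
    show "\<forall>g\<in>carrier G. \<Gamma> g =
        block_graded_algebra.component G ?l D (concat \<gamma>s) (map length \<gamma>s) g"
      unfolding block_graded_algebra.component_def[OF A] ns_eq[symmetric] using \<Gamma> .
    show "\<forall>i<length ns. \<forall>x\<in>rcosets T. length (filter (\<lambda>g. g \<in> x) (\<gamma>s ! i)) = (\<kappa>s ! i) x"
      using \<gamma>s(2) len by simp
  qed
qed

lemma algebra_automorphism_inv_into:
  fixes \<phi> :: "'f::field mat \<Rightarrow> 'f mat"
  assumes aut: "algebra_automorphism (UT ns) \<phi>"
  shows "algebra_automorphism (UT ns) (inv_into (UT ns) \<phi>)"
proof -
  let ?A = "UT ns" and ?\<psi> = "inv_into (UT ns) \<phi>"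
  note phi = algebra_automorphismD[OF aut]
  have im: "\<phi> ` ?A = ?A" using phi(1) by (rule bij_betw_imp_surj_on)
  have psi: "?\<psi> x \<in> ?A" "\<phi> (?\<psi> x) = x" if "x \<in> ?A" for x
    using that inv_into_into[of x \<phi> ?A] f_inv_into_f[of x \<phi> ?A] unfolding im by auto
  have eq: "?\<psi> x = y" if "x \<in> ?A" "y \<in> ?A" "x = \<phi> y" for x y
    using phi(6)[OF psi(1)[OF that(1)] that(2)] psi(2)[OF that(1)] that(3) by simp
  show ?thesis
    unfolding algebra_automorphism_def
  proof (intro conjI ballI allI)
    show "bij_betw ?\<psi> ?A ?A" using phi(1) by (rule bij_betw_inv_into)
    fix x y :: "'f mat" and c assume x: "x \<in> ?A"
    show "?\<psi> (c \<cdot>\<^sub>m x) = c \<cdot>\<^sub>m ?\<psi> x"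
      using psi[OF x] x by (intro eq) (auto intro: UT_smult simp: phi(3))
    assume y: "y \<in> ?A"
    show "?\<psi> (x + y) = ?\<psi> x + ?\<psi> y"
      using psi[OF x] psi[OF y] x y by (intro eq) (auto intro: UT_add simp: phi(2))
    show "?\<psi> (x * y) = ?\<psi> x * ?\<psi> y"
      using psi[OF x] psi[OF y] x y by (intro eq) (auto intro: UT_mult simp: phi(4))
  qed
qed

theorem corollary10:
  fixes G :: "('g, 'b) monoid_scheme" (structure)
    and ns :: "nat list"
    and T T' :: "'g set"
    and \<beta> \<beta>' :: "'g \<Rightarrow> 'g \<Rightarrow> 'f::alg_closed_field"
    and \<kappa>s \<kappa>s' :: "('g set \<Rightarrow> nat) list"
    and \<Gamma> \<Gamma>' :: "'g \<Rightarrow> 'f mat set"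
  assumes "comm_group G"
    and "ns \<noteq> []" and "\<forall>m\<in>set ns. m \<ge> 1"
    and "grading_parameters G ns T \<beta> \<kappa>s"
    and "grading_parameters G ns T' \<beta>' \<kappa>s'"
    and "determines_grading G ns T \<beta> \<kappa>s \<Gamma>"
    and "determines_grading G ns T' \<beta>' \<kappa>s' \<Gamma>'"
  shows "isomorphic_gradings G (UT ns) \<Gamma> \<Gamma>' \<longleftrightarrow>
     T' = T \<and>
     (\<forall>u\<in>T. \<forall>v\<in>T. \<beta>' u v = \<beta> u v) \<and>
     (\<exists>g\<in>carrier G. \<forall>i < length ns. \<forall>x \<in> rcosets T.
        (\<kappa>s' ! i) x = shift_kappa G g (\<kappa>s ! i) x)"
    (is "?L \<longleftrightarrow> ?R")
proof -
  define l l' where "l = floor_sqrt (card T)" and "l' = floor_sqrt (card T')"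
  obtain \<gamma>s D where len: "length \<gamma>s = length ns"
    and A: "block_graded_algebra G T \<beta> l D (concat \<gamma>s) (map length \<gamma>s)"
    and ns: "ns = map (\<lambda>m. m * l) (map length \<gamma>s)"
    and \<Gamma>: "\<forall>g\<in>carrier G.
      \<Gamma> g = block_graded_algebra.component G l D (concat \<gamma>s) (map length \<gamma>s) g"
    and \<kappa>: "\<forall>i<length ns. \<forall>x\<in>rcosets T.
      length (filter (\<lambda>g. g \<in> x) (\<gamma>s ! i)) = (\<kappa>s ! i) x"
    unfolding l_def by (rule determines_gradingE[OF assms(1-4,6)])
  obtain \<gamma>s' D' where len': "length \<gamma>s' = length ns"
    and B: "block_graded_algebra G T' \<beta>' l' D' (concat \<gamma>s') (map length \<gamma>s')"
    and ns': "ns = map (\<lambda>m. m * l') (map length \<gamma>s')"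
    and \<Gamma>': "\<forall>g\<in>carrier G.
      \<Gamma>' g = block_graded_algebra.component G l' D' (concat \<gamma>s') (map length \<gamma>s') g"
    and \<kappa>': "\<forall>i<length ns. \<forall>x\<in>rcosets T'.
      length (filter (\<lambda>g. g \<in> x) (\<gamma>s' ! i)) = (\<kappa>s' ! i) x"
    unfolding l'_def by (rule determines_gradingE[OF assms(1-3,5,7)])
  interpret A: block_graded_algebra G T \<beta> l D "concat \<gamma>s" "map length \<gamma>s" by (rule A)
  interpret B: block_graded_algebra G T' \<beta>' l' D' "concat \<gamma>s'" "map length \<gamma>s'" by (rule B)
  have "0 < sum_list ns"
  proof -
    have "hd ns \<in> set ns" using assms(2) by simp
    then have "1 \<le> hd ns" "hd ns \<le> sum_list ns" using assms(3) by (auto intro: member_le_sum_list)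
    then show ?thesis by simp
  qed
  moreover have "sum_list ns = A.n" "sum_list ns = B.n"
    using A.sum_list_sizes B.sum_list_sizes ns ns' by simp_all
  ultimately have "0 < A.k * l" "0 < B.k * l'" by simp_all
  then have kpos: "0 < A.k" "0 < B.k" by (simp_all only: nat_0_less_mult_iff)
  have same: "map length \<gamma>s' = map length \<gamma>s \<and> length (concat \<gamma>s') = A.k" if "l' = l"
  proof -
    have "map (\<lambda>m. m * l) (map length \<gamma>s') = map (\<lambda>m. m * l) (map length \<gamma>s)"
      using ns ns' that by simp
    moreover have "inj (\<lambda>m. m * l)" using A.l_pos by (simp add: inj_def)
    ultimately have "map length \<gamma>s' = map length \<gamma>s" by (metis inj_map_eq_map)
    then show ?thesis by (simp add: length_concat)
  qed
  have \<kappa>0: "(\<kappa>s' ! q) y = card {i. i < length (concat \<gamma>s') \<and>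
      block_index (map length \<gamma>s') i = q \<and> T' #> concat \<gamma>s' ! i = y}"
    if q: "q < length ns" and y: "y \<in> rcosets T'" for q y
  proof -
    have "(\<kappa>s' ! q) y = length (filter (\<lambda>g. g \<in> y) (\<gamma>s' ! q))" using \<kappa>' q y by simp
    also have "\<dots> = card {i. i < length (concat \<gamma>s') \<and> block_index (map length \<gamma>s') i = q \<and>
        concat \<gamma>s' ! i \<in> y}"
      using q len' by (intro card_concat_block[symmetric]) simp
    also have "\<dots> = card {i. i < length (concat \<gamma>s') \<and> block_index (map length \<gamma>s') i = q \<and>
        T' #> concat \<gamma>s' ! i = y}"
      using B.mem_rcoset_iff[OF y B.gs_nth] by (intro arg_cong[of _ _ card] Collect_cong) auto
    finally show ?thesis .
  qed
  have \<kappa>h: "shift_kappa G h (\<kappa>s ! q) y = card {i. i < A.k \<and>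
      block_index (map length \<gamma>s) i = q \<and> T #> (h \<otimes> concat \<gamma>s ! i) = y}"
    if "q < length ns" "y \<in> rcosets T" "h \<in> carrier G" for q y h
    using that len \<kappa> by (intro shift_kappa_card[OF A]) auto
  show ?thesis
  proof
    assume ?L
    then obtain \<phi> where aut: "algebra_automorphism (UT ns) \<phi>"
      and iso: "\<And>g. g \<in> carrier G \<Longrightarrow> \<phi> ` \<Gamma> g = \<Gamma>' g"
      unfolding isomorphic_gradings_def by blast
    have iso1: "\<phi> ` A.component g = B.component g" if "g \<in> carrier G" for g
      using iso[OF that] unfolding bspec[OF \<Gamma> that] bspec[OF \<Gamma>' that] .
    have iso2: "inv_into (UT ns) \<phi> ` B.component g = A.component g" if "g \<in> carrier G" for g
    proof -
      have "A.component g \<subseteq> UT ns" unfolding A.component_def ns[symmetric] by blast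
      moreover have "inj_on \<phi> (UT ns)"
        using algebra_automorphismD(1)[OF aut] by (rule bij_betw_imp_inj_on)
      ultimately show ?thesis
        unfolding iso1[OF that, symmetric] by (intro inv_into_image_cancel)
    qed
    have "T' \<subseteq> T \<and> (\<forall>u\<in>T'. \<forall>v\<in>T'. \<beta>' u v = \<beta> u v)"
      by (rule support_and_bicharacter_determined[OF A B trans[OF ns[symmetric] ns'] kpos(1)
            aut[unfolded ns] iso1])
    moreover have "T \<subseteq> T'"
    proof -
      define \<psi> where "\<psi> = inv_into (UT ns) \<phi>"
      have "algebra_automorphism (UT ns) \<psi>"
        unfolding \<psi>_def by (rule algebra_automorphism_inv_into[OF aut])
      then show ?thesis
        using support_and_bicharacter_determined[OF B A trans[OF ns'[symmetric] ns] kpos(2) _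
            iso2[folded \<psi>_def]] unfolding ns'[symmetric] by blast
    qed
    ultimately have T: "T' = T" and \<beta>: "\<forall>u\<in>T. \<forall>v\<in>T. \<beta>' u v = \<beta> u v" by auto
    have ll: "l' = l" by (simp add: l_def l'_def T)
    note sm = same[OF ll]
    have B': "block_graded_algebra G T \<beta>' l D' (concat \<gamma>s') (map length \<gamma>s)"
      using B sm unfolding T ll by simp
    interpret pair: block_graded_pair G T \<beta> \<beta>' l D D' "concat \<gamma>s" "concat \<gamma>s'" "map length \<gamma>s"
      by (intro block_graded_pair.intro A B')
    have iso3: "\<phi> ` A.component g = pair.B.component g" if "g \<in> carrier G" for g
      using iso1[OF that] sm unfolding ll by simp
    obtain h where h: "h \<in> carrier G" and cards:
      "\<And>q y. card {i. i < A.k \<and> block_index (map length \<gamma>s) i = q \<and> T #> concat \<gamma>s' ! i = y} =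
        card {i. i < A.k \<and> block_index (map length \<gamma>s) i = q \<and> T #> (h \<otimes> concat \<gamma>s ! i) = y}"
      using pair.graded_iso_coset_cards[OF aut[unfolded ns] iso3 kpos(1)] by blast
    have "(\<kappa>s' ! q) y = shift_kappa G h (\<kappa>s ! q) y" if "q < length ns" "y \<in> rcosets T" for q y
      unfolding \<kappa>h[OF that h] cards[symmetric] \<kappa>0[unfolded T, OF that] using sm by simp
    with T \<beta> h show ?R by blast
  next
    assume R: ?R
    then have T: "T' = T" and \<beta>: "\<forall>u\<in>T. \<forall>v\<in>T. \<beta>' u v = \<beta> u v" by auto
    from R obtain h where h: "h \<in> carrier G"
      and \<kappa>eq: "\<And>q y. q < length ns \<Longrightarrow> y \<in> rcosets T \<Longrightarrow>
        (\<kappa>s' ! q) y = shift_kappa G h (\<kappa>s ! q) y" by blast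
    have ll: "l' = l" by (simp add: l_def l'_def T)
    note sm = same[OF ll]
    have "division_grading G l T \<beta> D'"
    proof -
      have "division_grading G l T \<beta>' D'" using B.division unfolding T ll .
      then show ?thesis using \<beta> unfolding division_grading_def by simp
    qed
    then have B': "block_graded_algebra G T \<beta> l D' (concat \<gamma>s') (map length \<gamma>s)"
      using B.gs_carrier B.length_gs sm A.comm_group_axioms A.subgroup_T A.finite_T A.bichar A.l_pos
      by (intro block_graded_algebra.intro division_algebra.intro division_algebra_axioms.intro
          block_graded_algebra_axioms.intro) simp_all
    \<comment> \<open>Equal multiplicities in every block and coset give a bijection that matches them; labels
      outside the ranges of blocks and cosets do not occur.\<close>
    let ?bi = "block_index (map length \<gamma>s)"
    let ?f = "\<lambda>i. (?bi i, T #> (h \<otimes> concat \<gamma>s ! i))" and ?f' = "\<lambda>i. (?bi i, T #> concat \<gamma>s' ! i)"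
    have "image_mset ?f (mset_set {..<A.k}) = image_mset ?f' (mset_set {..<A.k})"
    proof (rule multiset_eqI)
      fix z :: "nat \<times> 'g set"
      obtain q y where z: "z = (q, y)" by (cases z)
      have "card {i \<in> {..<A.k}. ?f i = (q, y)} = card {i \<in> {..<A.k}. ?f' i = (q, y)}"
      proof (cases "q < length ns \<and> y \<in> rcosets T")
        case True
        then have q: "q < length ns" and y: "y \<in> rcosets T" by auto
        show ?thesis
          using \<kappa>eq[OF q y] \<kappa>0[unfolded T, OF q y] \<kappa>h[OF q y h] sm by (simp add: conj_ac)
      next
        case False
        have "?bi i < length ns" if "i < A.k" for i
          using block_index_less_length[of i "map length \<gamma>s"] that len by (simp add: length_concat)
        moreover have "T #> (h \<otimes> concat \<gamma>s ! i) \<in> rcosets T" "T #> concat \<gamma>s' ! i \<in> rcosets T"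
          if "i < A.k" for i
          using that h sm A.gs_nth[of i] B.gs_nth[of i] A.rcosetsI[OF A.T_subset] by auto
        ultimately have "{i \<in> {..<A.k}. ?f i = (q, y)} = {}" "{i \<in> {..<A.k}. ?f' i = (q, y)} = {}"
          using False by auto
        then show ?thesis by (simp only:)
      qed
      then show "count (image_mset ?f (mset_set {..<A.k})) z =
          count (image_mset ?f' (mset_set {..<A.k})) z"
        by (simp add: count_image_mset_eq_card_vimage z)
    qed
    then obtain p where p: "p permutes {..<A.k}" "\<forall>i\<in>{..<A.k}. ?f i = ?f' (p i)"
      by (rule image_mset_eq_implies_permutes[OF finite_lessThan])
    have "\<exists>\<phi>. algebra_automorphism (UT A.sizes) \<phi> \<and> (\<forall>g\<in>carrier G. \<phi> ` A.component g =
        block_graded_algebra.component G l D' (concat \<gamma>s') (map length \<gamma>s) g)"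
      using p by (intro isomorphic_of_matching_cosets[OF A B' h p(1)]) auto
    then show ?L
      unfolding isomorphic_gradings_def ns[symmetric] using \<Gamma> \<Gamma>' sm ll by auto
  qed
qed

end
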